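(* Let $q$ be a power of a prime $p$, let $n\ge 2$ and $r\in\{\lceil n/2\rceil,\ldots,n-1\}$ be integers with $\gcd(n,r)=1$, and let $s$ be a positive integer with $s<n-1$. Let $g_s(y)\in\mathbb{F}_{q^n}[y]$ be a monic $q$-polynomial of degree $q^s$ that splits into linear factors over $\mathbb{F}_{q^n}$ and such that $g_s(g(y))=T_n(y)$ for some monic $q$-polynomial $g(y)\in\mathbb{F}_{q^n}[y]$. Let $\mathcal{X}_{n,r}^s$ be the curve over $\mathbb{F}_{q^n}$ with affine equation $g_s(y)=x^{q^n+q^{n-r}}-x^{q^{n-r}+1}$, let $H(P_\infty)$ be the Weierstrass semigroup of $\mathcal{X}_{n,r}^s$ at its unique point at infinity $P_\infty$, and let $u$ be the integer attached to $g_s$ as described in the context. If $s\le 2r-n$, then $$H(P_\infty)=\langle q^s,\ q^r+1\rangle.$$ If $s=2r-n+1$, then $$H(P_\infty)=\begin{cases}\langle q^s,\ q^r+q^{s-1},\ q^{r+1}+q,\ q^{r+s-1}+1\rangle, & \text{if } u=n-r-1,\\ \langle q^s,\ q^r+1\rangle, & \text{otherwise.}\end{cases}$$ Moreover, in these cases $H(P_\infty)$ is a telescopic semigroup and therefore symmetric.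
   Context: $T_n(y)=y+y^q+\cdots+y^{q^{n-1}}$. A $q$-polynomial over $\mathbb{F}_{q^n}$ is a polynomial of the form $a_\ell y^{q^\ell}+\cdots+a_1y^q+a_0y$ with coefficients in $\mathbb{F}_{q^n}$. The integer $u$: there exist unique $q$-polynomials $Q(y),U(y)\in\mathbb{F}_{q^n}[y]$ with $Q(y)^{q^{n-r}}=y+U(g_s(y))$ and $\deg U\le q^{n-r-1}$; $U$ is nonzero and $u$ is defined by $\deg U(y)=q^u$. The point $P_\infty=(0:1:0)$ of the projective closure of $\mathcal{X}_{n,r}^s$ corresponds to a unique point of the nonsingular projective model, also denoted $P_\infty$; it is $\mathbb{F}_{q^n}$-rational. The Weierstrass semigroup is $H(P_\infty)=\{m\in\mathbb{N}_0:\exists f\in\mathbb{F}_{q^n}(\mathcal{X}_{n,r}^s)\text{ with pole divisor }(f)_\infty=mP_\infty\}$. The notation $\langle a_1,\dots,a_m\rangle$ means the subsemigroup of $\mathbb{N}_0$ (containing $0$) generated by $a_1,\dots,a_m$. A sequence $(a_1,\ldots,a_m)$ of positive integers with greatest common divisor $1$ is called telescopic if, with $d_i=\gcd(a_1,\ldots,a_i)$ and $S_i$ the semigroup generated by $\{a_1/d_i,\ldots,a_i/d_i\}$, one has $a_i/d_i\in S_{i-1}$ for $i=2,\ldots,m$. A semigroup is telescopic if it is generated by a telescopic sequence. The semigroup $H(P_\infty)$ is symmetric if its largest gap (largest element of $\mathbb{N}_0\setminus H(P_\infty)$) equals $2g-1$, where $g$ is the genus of the curve (the number of gaps). *)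

theory Defs
  imports Complex_Main "HOL-Computational_Algebra.Computational_Algebra"
begin

definition q_polynomial :: "nat \<Rightarrow> 'a::comm_semiring_1 poly \<Rightarrow> bool" where
  "q_polynomial q p \<longleftrightarrow> (\<exists>l a. p = (\<Sum>i\<le>l. monom (a i) (q ^ i)))"

definition trace_poly :: "nat \<Rightarrow> nat \<Rightarrow> 'a::comm_semiring_1 poly" where
  "trace_poly q n = (\<Sum>i<n. monom 1 (q ^ i))"

definition splits :: "'a::field poly \<Rightarrow> bool" where
  "splits p \<longleftrightarrow> (\<exists>c as. p = smult c (\<Prod>a\<leftarrow>as. [:- a, 1:]))"

definition U_poly :: "nat \<Rightarrow> nat \<Rightarrow> nat \<Rightarrow> 'a::field poly \<Rightarrow> 'a poly" where
  "U_poly q n r gs = (THE U. q_polynomial q U \<and> degree U \<le> q ^ (n - r - 1) \<and>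
     (\<exists>Q. q_polynomial q Q \<and> Q ^ (q ^ (n - r)) = [:0, 1:] + pcompose U gs))"

definition u_of :: "nat \<Rightarrow> nat \<Rightarrow> nat \<Rightarrow> 'a::field poly \<Rightarrow> nat" where
  "u_of q n r gs = (THE u. U_poly q n r gs \<noteq> 0 \<and> degree (U_poly q n r gs) = q ^ u)"

text \<open>Elements of \<open>K[x,y]\<close> are polynomials in \<open>y\<close> with coefficients in \<open>K[x]\<close>.\<close>

definition curve_poly :: "nat \<Rightarrow> nat \<Rightarrow> nat \<Rightarrow> 'a::field poly \<Rightarrow> 'a poly poly" where
  "curve_poly q n r gs = map_poly (\<lambda>a. [:a:]) gs
     - [:monom 1 (q ^ n + q ^ (n - r)) - monom 1 (q ^ (n - r) + 1):]"

definition eval2 :: "('a::field \<Rightarrow> 'f::field) \<Rightarrow> 'f \<Rightarrow> 'f \<Rightarrow> 'a poly poly \<Rightarrow> 'f" where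
  "eval2 \<iota> x y P = poly (map_poly (\<lambda>a. poly (map_poly \<iota> a) x) P) y"

text \<open>The field \<open>'f\<close>, with the embedding \<open>\<iota>\<close> of \<open>K\<close> and the coordinate functions
  \<open>x\<close> and \<open>y\<close>, is the function field of the affine plane curve \<open>f = 0\<close>, that is, the
  field of fractions of the coordinate ring \<open>K[x,y]/(f)\<close>: the second clause says that
  evaluation induces an embedding of \<open>K[x,y]/(f)\<close>, the third that every element
  of \<open>'f\<close> is a quotient of two elements of its image.\<close>

definition is_function_field ::
  "'a::field poly poly \<Rightarrow> ('a \<Rightarrow> 'f::field) \<Rightarrow> 'f \<Rightarrow> 'f \<Rightarrow> bool" where
  "is_function_field f \<iota> x y \<longleftrightarrow>
     (\<iota> 1 = 1 \<and> (\<forall>a b. \<iota> (a + b) = \<iota> a + \<iota> b) \<and> (\<forall>a b. \<iota> (a * b) = \<iota> a * \<iota> b)) \<and>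
     (\<forall>P. eval2 \<iota> x y P = 0 \<longleftrightarrow> f dvd P) \<and>
     (\<forall>z. \<exists>P R. eval2 \<iota> x y R \<noteq> 0 \<and> z = eval2 \<iota> x y P / eval2 \<iota> x y R)"

text \<open>The (closed) points of the nonsingular projective model are the places of the function
  field over \<open>K\<close>; a place is represented by its valuation ring.\<close>

definition places :: "('a::field \<Rightarrow> 'f::field) \<Rightarrow> 'f set set" where
  "places \<iota> = {V. range \<iota> \<subset> V \<and> V \<subset> UNIV \<and>
     (\<forall>a\<in>V. \<forall>b\<in>V. a - b \<in> V \<and> a * b \<in> V) \<and> (\<forall>z. z \<in> V \<or> inverse z \<in> V)}"

definition max_ideal :: "'f::field set \<Rightarrow> 'f set" where
  "max_ideal V = {z \<in> V. z = 0 \<or> inverse z \<notin> V}"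

definition uniformizer :: "'f::field set \<Rightarrow> 'f \<Rightarrow> bool" where
  "uniformizer V t \<longleftrightarrow> max_ideal V = (\<lambda>w. t * w) ` V"

text \<open>The discrete valuation \<open>v\<^sub>P(z)\<close>, meaningful for \<open>z \<noteq> 0\<close> only.\<close>

definition valuation :: "'f::field set \<Rightarrow> 'f \<Rightarrow> int" where
  "valuation V z = (THE k. \<exists>t w. uniformizer V t \<and> w \<in> V - max_ideal V \<and> z = t powi k * w)"

text \<open>The coefficient of a place in the pole divisor \<open>(z)\<^sub>\<infinity>\<close>.\<close>

definition pole_coeff :: "'f::field set \<Rightarrow> 'f \<Rightarrow> nat" where
  "pole_coeff V z = nat (- valuation V z)"

text \<open>The place \<open>V\<close> lies over the point \<open>(a : b : d)\<close> of the projective closure: after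
  scaling by some \<open>l\<close>, the homogeneous coordinates \<open>(x : y : 1)\<close> have residues \<open>a, b, d\<close>.\<close>

definition lies_over ::
  "('a::field \<Rightarrow> 'f::field) \<Rightarrow> 'f \<Rightarrow> 'f \<Rightarrow> 'f set \<Rightarrow> 'a \<times> 'a \<times> 'a \<Rightarrow> bool" where
  "lies_over \<iota> x y V = (\<lambda>(a, b, d). \<exists>l. l * x - \<iota> a \<in> max_ideal V \<and>
     l * y - \<iota> b \<in> max_ideal V \<and> l - \<iota> d \<in> max_ideal V)"

definition P_infty :: "('a::field \<Rightarrow> 'f::field) \<Rightarrow> 'f \<Rightarrow> 'f \<Rightarrow> 'f set" where
  "P_infty \<iota> x y = (THE V. V \<in> places \<iota> \<and> lies_over \<iota> x y V (0, 1, 0))"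

definition weierstrass_semigroup :: "('a::field \<Rightarrow> 'f::field) \<Rightarrow> 'f set \<Rightarrow> nat set" where
  "weierstrass_semigroup \<iota> P = {m. \<exists>z. z \<noteq> 0 \<and>
     (\<forall>V\<in>places \<iota>. pole_coeff V z = (if V = P then m else 0))}"

inductive_set semigroup_gen :: "nat set \<Rightarrow> nat set" for A where
  zero: "0 \<in> semigroup_gen A"
| add: "a \<in> A \<Longrightarrow> m \<in> semigroup_gen A \<Longrightarrow> a + m \<in> semigroup_gen A"

text \<open>With \<open>d i = gcd(a\<^sub>1, \<dots>, a\<^sub>i)\<close>; the list entry \<open>as ! (i - 1)\<close> is \<open>a\<^sub>i\<close>.\<close>

definition telescopic_sequence :: "nat list \<Rightarrow> bool" where
  "telescopic_sequence as \<longleftrightarrow> as \<noteq> [] \<and> (\<forall>a\<in>set as. 0 < a) \<and> Gcd (set as) = 1 \<and>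
     (let d = (\<lambda>i. Gcd (set (take i as)));
          S = (\<lambda>i. semigroup_gen ((\<lambda>a. a div d i) ` set (take i as)))
      in \<forall>i\<in>{2..length as}. as ! (i - 1) div d i \<in> S (i - 1))"

definition telescopic :: "nat set \<Rightarrow> bool" where
  "telescopic H \<longleftrightarrow> (\<exists>as. telescopic_sequence as \<and> H = semigroup_gen (set as))"

text \<open>The largest gap is \<open>2 g - 1\<close>, where \<open>g\<close> is the number of gaps.\<close>

definition symmetric_semigroup :: "nat set \<Rightarrow> bool" where
  "symmetric_semigroup H \<longleftrightarrow> (\<exists>F. F \<notin> H \<and> (\<forall>k. k \<notin> H \<longrightarrow> k \<le> F) \<and>
     int F = 2 * int (card (- H)) - 1)"

end

theory Submission
  imports Defs
begin

text \<open>Let \<open>K\<close> be the field with \<open>Q = q\<^sup>n\<close> elements and \<open>N = q\<^bsup>n-r\<^esup>\<close>. The hypothesis on \<open>gs\<close> gives a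
  \<open>q\<close>-polynomial \<open>h\<close> with \<open>gs(h) = h(gs) = X - X\<^sup>Q\<close>, so on the curve \<open>y\<close> differs from \<open>y\<^sup>Q\<close> by a
  polynomial in \<open>x\<close>. Hence modulo every prime of \<open>K[x]\<close> some power of the Frobenius map is the
  identity on \<open>A = K[x,y]\<close>. So the curve is unramified over the affine \<open>x\<close>-line, and \<open>A\<close> is the ring
  of functions with poles at \<open>P\<^sub>\<infinity>\<close> only; no genus enters.

  Truncating \<open>h\<close> below degree \<open>N\<close> gives \<open>- U\<close>, and \<open>y - U(x\<^bsup>N+1\<^esup>)\<close> is the \<open>N\<close>-th power of an element
  \<open>w\<close> with \<open>A = K[x,w]\<close>. It satisfies an equation of degree \<open>q\<^sup>s\<close> over \<open>K[x]\<close> whose right-hand side is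
  \<open>x\<^bsup>q^r+1\<^esup>\<close> minus a polynomial in \<open>x\<^bsup>N+1\<^esup>\<close> with degree governed by \<open>u\<close>. If \<open>x\<^bsup>q^r+1\<^esup>\<close> dominates, the
  powers of \<open>w\<close> form a \<open>K[x]\<close>-basis of \<open>A\<close> with pole orders distinct modulo \<open>q\<^sup>s\<close>. Otherwise
  such a basis consists of monomials in \<open>w\<close>, \<open>z = w\<^sup>q + c x\<^bsup>N+1\<^esup>\<close> and
  \<open>t = z\<^bsup>q^(s-2)\<^esup> + c' x\<^sup>\<alpha> w\<close>, where \<open>z\<close> and \<open>t\<close> arise by cancelling leading terms.
  In both cases the pole orders of the basis elements determine the semigroup.\<close>

section \<open>Valuation rings of a field\<close>

text \<open>Pole divisors quantify over all places, and \<open>valuation\<close> and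
  \<open>P_infty\<close> are definite descriptions, so no pole order is available before places are
  known to be discrete and the pole of x is known to be unique. Until then values are compared up to
  units only (\<open>sim\<close>).

  The polynomial h is g(X - X^q), because T_n(X - X^q) telescopes.

  The equation for w has right-hand side x^(q^r+1) minus a polynomial of degree (N+1) q^(s+u) / N.
  As N+1 < 2N, this degree is at most q^r if s+u < r; if s+u = r, it is q^r + q^(2r-n). Since u <=
  n-r-1, the second case arises in the theorem only for s = 2r-n+1 and u = n-r-1. Then the pole
  orders of w and x share the factor q^(s-1), so the powers of w no longer separate the residues
  modulo q^s. The corrections z and t lower this common factor to q and then to 1, which is the gcd
  chain of the telescopic sequence. The roots of coefficients that z and t need exist because
  Frobenius is bijective on K.\<close>

locale field_subring =
  fixes V :: "'f::field set"
  assumes one_mem: "1 \<in> V"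
    and diff_mem: "\<And>a b. a \<in> V \<Longrightarrow> b \<in> V \<Longrightarrow> a - b \<in> V"
    and mult_mem: "\<And>a b. a \<in> V \<Longrightarrow> b \<in> V \<Longrightarrow> a * b \<in> V"
begin

lemma zero_mem: "0 \<in> V"
  using diff_mem[OF one_mem one_mem] by simp

lemma uminus_mem: "a \<in> V \<Longrightarrow> - a \<in> V"
  using diff_mem[OF zero_mem] by fastforce

lemma add_mem: "a \<in> V \<Longrightarrow> b \<in> V \<Longrightarrow> a + b \<in> V"
  using diff_mem[of a "- b"] uminus_mem by simp

lemma power_mem: "a \<in> V \<Longrightarrow> a ^ n \<in> V"
  by (induction n) (auto simp: one_mem mult_mem)

lemma sum_mem: "(\<And>i. i \<in> S \<Longrightarrow> f i \<in> V) \<Longrightarrow> sum f S \<in> V"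
  by (induction S rule: infinite_finite_induct) (auto simp: zero_mem add_mem)

definition adjoin :: "'f \<Rightarrow> 'f set" where
  "adjoin w = {poly p w | p. \<forall>i. coeff p i \<in> V}"

lemma adjoinI: "(\<And>i. coeff p i \<in> V) \<Longrightarrow> poly p w \<in> adjoin w"
  by (auto simp: adjoin_def)

lemma subset_adjoin: "V \<subseteq> adjoin w"
proof
  fix a assume "a \<in> V"
  then show "a \<in> adjoin w"
    using adjoinI[of "[:a:]" w] by (auto simp: coeff_pCons zero_mem split: nat.splits)
qed

lemma mem_adjoin: "w \<in> adjoin w"
  using adjoinI[of "[:0, 1:]" w] by (auto simp: coeff_pCons zero_mem one_mem split: nat.splits)

lemma field_subring_adjoin: "field_subring (adjoin w)"
proof
  show "1 \<in> adjoin w" using subset_adjoin one_mem by blast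
next
  fix a b assume "a \<in> adjoin w" "b \<in> adjoin w"
  then obtain p q where pq: "a = poly p w" "b = poly q w"
    "\<And>i. coeff p i \<in> V" "\<And>i. coeff q i \<in> V" by (auto simp: adjoin_def)
  show "a - b \<in> adjoin w" using adjoinI[of "p - q" w] pq by (simp add: diff_mem)
  show "a * b \<in> adjoin w"
    using adjoinI[of "p * q" w] pq by (simp add: coeff_mult sum_mem mult_mem)
qed

end

section \<open>Units, maximal ideal and comparison of values in a valuation ring\<close>

locale valuation_ring = field_subring V for V :: "'f::field set" +
  assumes total: "\<And>z. z \<in> V \<or> inverse z \<in> V"
begin

text \<open>As \<open>inverse 0 = 0\<close>, the last two conjuncts alone would admit 0.\<close>

definition unt :: "'f \<Rightarrow> bool" where
  "unt z \<longleftrightarrow> z \<noteq> 0 \<and> z \<in> V \<and> inverse z \<in> V"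

lemma unt_iff: "unt z \<longleftrightarrow> z \<in> V - max_ideal V"
  by (auto simp: unt_def max_ideal_def)

lemma unt_mult: "unt a \<Longrightarrow> unt b \<Longrightarrow> unt (a * b)"
  by (auto simp: unt_def mult_mem)

lemma unt_inverse: "unt a \<Longrightarrow> unt (inverse a)"
  by (auto simp: unt_def)

lemma unt_one: "unt 1"
  by (auto simp: unt_def one_mem)

lemma unt_power: "unt a \<Longrightarrow> unt (a ^ n)"
  by (induction n) (auto simp: unt_one unt_mult)

lemma max_ideal_mult: "a \<in> max_ideal V \<Longrightarrow> b \<in> V \<Longrightarrow> a * b \<in> max_ideal V"
proof -
  assume a: "a \<in> max_ideal V" and b: "b \<in> V"
  have False if "a * b \<noteq> 0" "inverse (a * b) \<in> V"
  proof -
    have "inverse a = b * inverse (a * b)" using that(1) by (simp add: field_simps)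
    then have "inverse a \<in> V" using b that(2) by (metis mult_mem)
    then show False using a that(1) by (auto simp: max_ideal_def)
  qed
  then show ?thesis using a b by (auto simp: max_ideal_def mult_mem)
qed

lemma max_ideal_subset: "a \<in> max_ideal V \<Longrightarrow> a \<in> V"
  by (simp add: max_ideal_def)

lemma zero_max_ideal: "0 \<in> max_ideal V"
  by (simp add: max_ideal_def zero_mem)

lemma one_not_max_ideal: "1 \<notin> max_ideal V"
  by (simp add: max_ideal_def one_mem)

lemma not_mem_inverse: "z \<notin> V \<Longrightarrow> inverse z \<in> max_ideal V"
  using total[of z] by (auto simp: max_ideal_def)

lemma max_ideal_uminus: "a \<in> max_ideal V \<Longrightarrow> - a \<in> max_ideal V"
  using max_ideal_mult[of a "- 1"] uminus_mem[OF one_mem] by simp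

text \<open>Of two nonzero elements one divides the other in \<open>V\<close>; factoring out the
  divisor \<open>c\<close> leaves 1 + d/c, which lies in \<open>V\<close>.\<close>

lemma max_ideal_add: "a \<in> max_ideal V \<Longrightarrow> b \<in> max_ideal V \<Longrightarrow> a + b \<in> max_ideal V"
proof -
  assume a: "a \<in> max_ideal V" and b: "b \<in> max_ideal V"
  have *: "c + d \<in> max_ideal V" if "c \<noteq> 0" "d / c \<in> V" "c \<in> max_ideal V" for c d
  proof -
    have "c * (1 + d / c) \<in> max_ideal V" using that one_mem add_mem max_ideal_mult by blast
    then show ?thesis using that(1) by (simp add: distrib_left)
  qed
  show ?thesis
  proof (cases "a = 0 \<or> b = 0")
    case False
    then show ?thesis using *[of a b] *[of b a] total[of "a / b"] a b by (auto simp: add.commute)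
  qed (use a b in auto)
qed

lemma unt_add: "unt a \<Longrightarrow> b \<in> max_ideal V \<Longrightarrow> unt (a + b)"
  using max_ideal_add[of "a + b" "- b"] max_ideal_uminus[of b]
  by (auto simp: unt_iff add_mem max_ideal_subset)

lemma max_ideal_power: "a \<in> max_ideal V \<Longrightarrow> n > 0 \<Longrightarrow> a ^ n \<in> max_ideal V"
  by (cases n) (auto simp: max_ideal_mult power_mem max_ideal_subset)

lemma power_memD: "a ^ n \<in> V \<Longrightarrow> n > 0 \<Longrightarrow> a \<in> V"
proof (rule ccontr)
  assume a: "a ^ n \<in> V" "n > 0" "a \<notin> V"
  then have "inverse a ^ n * a ^ n \<in> max_ideal V"
    by (intro max_ideal_mult max_ideal_power not_mem_inverse)
  moreover have "a \<noteq> 0" using a(3) zero_mem by auto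
  ultimately show False using one_not_max_ideal by (simp flip: power_mult_distrib)
qed

lemma unt_powerD: "unt (a ^ n) \<Longrightarrow> n > 0 \<Longrightarrow> unt a"
proof -
  assume a: "unt (a ^ n)" and n: "n > 0"
  have a0: "a \<noteq> 0" using a n by (auto simp: unt_def)
  have "a \<in> V"
  proof (rule ccontr)
    assume "a \<notin> V"
    then have "inverse (a ^ n) \<in> max_ideal V"
      using max_ideal_power[OF not_mem_inverse n] by (simp add: power_inverse)
    then show False using unt_inverse[OF a] by (simp add: unt_iff)
  qed
  moreover have "inverse a \<in> V"
  proof (rule ccontr)
    assume "inverse a \<notin> V"
    then have "a ^ n \<in> max_ideal V"
      using max_ideal_power[OF not_mem_inverse n, of "inverse a"] by simp
    then show False using a by (simp add: unt_iff)
  qed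
  ultimately show ?thesis using a0 by (simp add: unt_def)
qed

lemma max_ideal_powerD: "a ^ n \<in> max_ideal V \<Longrightarrow> n > 0 \<Longrightarrow> a \<in> max_ideal V"
proof (rule ccontr)
  assume a: "a ^ n \<in> max_ideal V" and n: "n > 0" and "a \<notin> max_ideal V"
  then consider "unt a" | "a \<notin> V" by (auto simp: unt_iff)
  then show False
  proof cases
    case 1 then show False using a unt_power[OF 1, of n] by (simp add: unt_iff)
  next
    case 2
    then have "inverse (a ^ n) \<in> max_ideal V"
      using max_ideal_power[OF not_mem_inverse n] by (simp add: power_inverse)
    then have "inverse (a ^ n) * a ^ n \<in> max_ideal V"
      using a max_ideal_mult max_ideal_subset by blast
    then show False using 2 one_not_max_ideal zero_mem by (cases "a = 0") auto
  qed
qed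

text \<open>Equality of valuations, stated without a value group.\<close>

definition sim :: "'f \<Rightarrow> 'f \<Rightarrow> bool" where
  "sim a b \<longleftrightarrow> a \<noteq> 0 \<and> b \<noteq> 0 \<and> unt (a / b)"

lemma sim_refl: "a \<noteq> 0 \<Longrightarrow> sim a a"
  by (simp add: sim_def unt_one)

lemma sim_nonzero: "sim a b \<Longrightarrow> a \<noteq> 0" "sim a b \<Longrightarrow> b \<noteq> 0"
  by (auto simp: sim_def)

lemma sim_sym: "sim a b \<Longrightarrow> sim b a"
  using unt_inverse[of "a / b"] by (auto simp: sim_def)

lemma sim_trans: "sim a b \<Longrightarrow> sim b c \<Longrightarrow> sim a c"
  using unt_mult[of "a / b" "b / c"] by (auto simp: sim_def)

lemma sim_mult: "sim a b \<Longrightarrow> sim c d \<Longrightarrow> sim (a * c) (b * d)"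
  using unt_mult[of "a / b" "c / d"] by (auto simp: sim_def)

lemma sim_inverse: "sim a b \<Longrightarrow> sim (inverse a) (inverse b)"
  using unt_inverse[of "a / b"] by (auto simp: sim_def field_simps)

lemma sim_power: "sim a b \<Longrightarrow> sim (a ^ n) (b ^ n)"
  using unt_power[of "a / b" n] by (auto simp: sim_def power_divide)

lemma sim_powi: "sim a b \<Longrightarrow> sim (a powi n) (b powi n)"
  by (auto simp: power_int_def intro!: sim_power sim_inverse)

text \<open>The value group is torsion free. Equations give asymptotics only for certain powers;
  this lemma brings them down to the roots.\<close>

lemma sim_powerD: "sim (a ^ n) (b ^ n) \<Longrightarrow> n > 0 \<Longrightarrow> sim a b"
  using unt_powerD[of "a / b" n] by (auto simp: sim_def power_divide)

lemma sim_add: "b \<noteq> 0 \<Longrightarrow> a / b \<in> max_ideal V \<Longrightarrow> sim (b + a) b"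
proof -
  assume *: "b \<noteq> 0" "a / b \<in> max_ideal V"
  then have "unt (1 + a / b)" using unt_add unt_one by blast
  moreover have "1 + a / b = (b + a) / b" using * by (simp add: field_simps)
  ultimately show ?thesis using * by (auto simp: sim_def unt_def)
qed

lemma sim_unt_mult: "unt u \<Longrightarrow> a \<noteq> 0 \<Longrightarrow> sim (u * a) a"
  by (auto simp: sim_def unt_def)

lemma sim_mem_iff: "sim a b \<Longrightarrow> a \<in> V \<longleftrightarrow> b \<in> V"
proof -
  have "sim a b \<Longrightarrow> b \<in> V \<Longrightarrow> a \<in> V" for a b
    using mult_mem[of "a / b" b] by (auto simp: sim_def unt_def)
  then show "sim a b \<Longrightarrow> a \<in> V \<longleftrightarrow> b \<in> V" using sim_sym by blast
qed

lemma sim_max_ideal_iff: "sim a b \<Longrightarrow> a \<in> max_ideal V \<longleftrightarrow> b \<in> max_ideal V"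
  using sim_mem_iff[of a b] sim_mem_iff[OF sim_inverse, of a b]
  by (auto simp: max_ideal_def sim_nonzero)

lemma powi_max_ideal:
  assumes "t \<in> max_ideal V" "k > 0"
  shows "t powi k \<in> max_ideal V"
  using max_ideal_power[OF assms(1), of "nat k"] assms(2) by (simp add: power_int_def)

lemma powi_not_mem:
  assumes "t \<in> max_ideal V" "t \<noteq> 0" "k < 0"
  shows "t powi k \<notin> V"
proof
  assume "t powi k \<in> V"
  then have "t powi k * t powi (- k) \<in> max_ideal V"
    using powi_max_ideal[OF assms(1), of "- k"] assms(3) max_ideal_mult by (metis mult.commute neg_0_less_iff_less)
  then show False using one_not_max_ideal assms(2) by (simp flip: power_int_add)
qed

lemma powi_mem_iff:
  assumes "t \<in> max_ideal V" "t \<noteq> 0"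
  shows "t powi k \<in> V \<longleftrightarrow> k \<ge> 0"
  using powi_not_mem[OF assms] powi_max_ideal[OF assms(1)] max_ideal_subset one_mem
  by (cases "k = 0"; cases "k < 0") force+

lemma sim_powi_mem_iff:
  assumes "t \<in> max_ideal V" "t \<noteq> 0" "sim z (t powi k)"
  shows "z \<in> V \<longleftrightarrow> k \<ge> 0"
  using powi_mem_iff[OF assms(1,2)] sim_mem_iff[OF assms(3)] by simp

lemma sim_powi_max_ideal_iff:
  assumes "t \<in> max_ideal V" "t \<noteq> 0" "sim z (t powi k)"
  shows "z \<in> max_ideal V \<longleftrightarrow> k > 0"
proof -
  have "t powi k \<in> max_ideal V \<longleftrightarrow> t powi k \<in> V \<and> t powi (- k) \<notin> V"
    using assms(2) by (simp add: max_ideal_def power_int_minus)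
  then show ?thesis
    using sim_max_ideal_iff[OF assms(3)] powi_mem_iff[OF assms(1,2), of k]
      powi_mem_iff[OF assms(1,2), of "- k"] by auto
qed

lemma sim_powi_unique:
  assumes "t \<in> max_ideal V" "t \<noteq> 0" "sim z (t powi k)" "sim z (t powi l)"
  shows "k = l"
proof -
  have "sim (t powi k * inverse (t powi l)) (z * inverse z)"
    using assms(3,4) sim_sym sim_inverse sim_mult by blast
  then have s: "sim (t powi (k - l)) 1"
    using assms(2) sim_nonzero(1)[OF assms(3)] by (simp add: power_int_diff divide_inverse)
  then show ?thesis
    using powi_mem_iff[OF assms(1,2), of "k - l"] sim_mem_iff[OF s] one_mem
      powi_mem_iff[OF assms(1,2), of "l - k"] sim_mem_iff[OF sim_inverse[OF s]]
    by (simp flip: power_int_minus)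
qed

lemma sim_powi_add:
  assumes "t \<in> max_ideal V" "t \<noteq> 0" "sim a (t powi k)" "sim b (t powi l)" "k < l"
  shows "sim (a + b) (t powi k)"
proof -
  have a0: "a \<noteq> 0" using assms(3) by (simp add: sim_nonzero)
  have "sim (b / a) (t powi l / t powi k)"
    using sim_mult[OF assms(4) sim_inverse[OF assms(3)]] by (simp add: divide_inverse)
  then have "sim (b / a) (t powi (l - k))" using assms(2) by (simp add: power_int_diff)
  then have "b / a \<in> max_ideal V"
    using sim_powi_max_ideal_iff[OF assms(1,2)] assms(5) by simp
  then show ?thesis using sim_add[OF a0] sim_trans assms(3) by blast
qed

text \<open>Distinct exponents exclude cancellation, so the term of least exponent
  dominates.\<close>

lemma sim_powi_sum:
  assumes t: "t \<in> max_ideal V" "t \<noteq> 0"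
    and "finite S" "S \<noteq> {}" "\<And>i. i \<in> S \<Longrightarrow> sim (a i) (t powi (k i))" "inj_on k S"
  shows "sim (sum a S) (t powi (Min (k ` S)))"
  using assms(3-)
proof (induction S rule: finite_ne_induct)
  case (insert i S)
  have "k i \<notin> k ` S" using insert.prems(2) insert.hyps by auto
  then have "k i \<noteq> Min (k ` S)" using Min_in[of "k ` S"] insert.hyps by fastforce
  moreover have "sim (sum a S) (t powi (Min (k ` S)))" "sim (a i) (t powi (k i))"
    using insert by (auto simp: inj_on_def)
  ultimately have "sim (a i + sum a S) (t powi (min (k i) (Min (k ` S))))"
    using sim_powi_add[OF t, of "a i" "k i" "sum a S" "Min (k ` S)"]
      sim_powi_add[OF t, of "sum a S" "Min (k ` S)" "a i" "k i"]
    by (cases "k i < Min (k ` S)") (auto simp: min_def add.commute)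
  then show ?case using insert.hyps by simp
qed simp

section \<open>Discrete valuations\<close>

context
  fixes t
  assumes t: "t \<in> max_ideal V" "t \<noteq> 0" and discrete: "\<And>z. z \<noteq> 0 \<Longrightarrow> \<exists>k. sim z (t powi k)"
begin

lemma uniformizer_discrete: "uniformizer V t"
proof -
  have "z \<in> (\<lambda>w. t * w) ` V" if z: "z \<in> max_ideal V" for z
  proof (cases "z = 0")
    case False
    then obtain k where k: "sim z (t powi k)" using discrete by blast
    then have "k > 0" using sim_powi_max_ideal_iff[OF t] z by simp
    have "sim (z * inverse t) (t powi k * inverse t)"
      using k t sim_mult sim_refl by simp
    then have "sim (z / t) (t powi (k - 1))"
      using t by (simp add: power_int_diff divide_inverse)
    then have "z / t \<in> V" using sim_powi_mem_iff[OF t] \<open>k > 0\<close> by simp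
    then show ?thesis using t by (intro image_eqI[of _ _ "z / t"]) auto
  qed (use zero_mem in auto)
  then show ?thesis using max_ideal_mult[OF t(1)] by (auto simp: uniformizer_def)
qed

text \<open>The definite description ranges over all uniformizers, so uniqueness of \<open>k\<close>
  needs that any other uniformizer \<open>t'\<close> and \<open>t\<close> divide each other, hence
  agree up to a unit.\<close>

lemma valuation_discrete:
  assumes "sim z (t powi k)"
  shows "valuation V z = k"
proof -
  have *: "\<exists>t w. uniformizer V t \<and> w \<in> V - max_ideal V \<and> z = t powi k * w"
    using uniformizer_discrete assms t
    by (intro exI[of _ t] exI[of _ "z / t powi k"]) (auto simp: sim_def unt_iff)
  have "l = k" if "\<exists>t w. uniformizer V t \<and> w \<in> V - max_ideal V \<and> z = t powi l * w" for l
  proof -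
    from that obtain t' w where w: "uniformizer V t'" "w \<in> V - max_ideal V" "z = t' powi l * w"
      by blast
    have "t' * 1 \<in> max_ideal V" "t' * 0 \<in> max_ideal V"
      using w(1) one_mem zero_mem unfolding uniformizer_def by (metis imageI)+
    then have t': "t' \<in> max_ideal V" by simp
    obtain w' where w': "t = t' * w'" "w' \<in> V" using w(1) t unfolding uniformizer_def by blast
    then have t'0: "t' \<noteq> 0" using t by auto
    obtain w'' where w'': "t' = t * w''" "w'' \<in> V"
      using uniformizer_discrete t' unfolding uniformizer_def by blast
    have "w' * w'' = 1" using w' w'' t by (metis mult.assoc mult_cancel_left2)
    then have "inverse w' = w''" by (metis inverse_unique)
    then have "unt w'" using w' w'' t by (auto simp: unt_def)
    then have "sim t t'" using sim_unt_mult[OF _ t'0, of w'] w'(1) by (simp add: mult.commute)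
    then have "sim (t powi l) (t' powi l)" by (rule sim_powi)
    moreover have "sim z (t' powi l)"
      using sim_unt_mult[of w "t' powi l"] w t'0 by (simp add: unt_iff mult.commute)
    ultimately have "sim z (t powi l)" using sim_sym sim_trans by blast
    then show ?thesis using sim_powi_unique[OF t] assms by blast
  qed
  then show ?thesis using * unfolding valuation_def by blast
qed

lemma pole_coeff_eq_0_iff:
  assumes "z \<noteq> 0"
  shows "pole_coeff V z = 0 \<longleftrightarrow> z \<in> V"
proof -
  obtain k where k: "sim z (t powi k)" using discrete assms by blast
  then show ?thesis
    using valuation_discrete[OF k] sim_powi_mem_iff[OF t k] by (simp add: pole_coeff_def)
qed

end

end

section \<open>Extension of a subring to a valuation ring\<close>

context field_subring
begin

text \<open>Chevalley's argument: in a subring maximal among those avoiding \<open>z\<close>, the element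
  \<open>1 - z\<^sup>-\<^sup>1 p'(0)\<close> is a unit, so the relation \<open>p'\<close> lowers the degree of the relation \<open>p\<close>.\<close>

lemma adjoin_degree_reduction:
  assumes max: "\<And>W. field_subring W \<Longrightarrow> V \<subseteq> W \<Longrightarrow> z \<notin> W \<Longrightarrow> W = V"
    and z: "inverse z \<in> V" "z \<notin> V"
    and w: "w \<noteq> 0" "\<And>i. coeff p i \<in> V" "z = poly p w"
      "\<And>i. coeff p' i \<in> V" "z = poly p' (inverse w)" "degree p' \<le> degree p"
  obtains e where "\<And>i. coeff e i \<in> V" "z = poly e w" "degree e < degree p"
proof -
  have z0: "z \<noteq> 0" using z zero_mem by auto
  define n where "n = degree p"
  define k where "k = degree p'"
  define c where "c = 1 - inverse z * coeff p' 0"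
  have c0: "c \<noteq> 0"
  proof
    assume "c = 0"
    then have "z = coeff p' 0" using z0 by (simp add: c_def field_simps)
    then show False using z w by metis
  qed
  \<comment> \<open>Otherwise maximality gives z = f(1/c), so z c^d lies in \<open>V\<close> for d =
    \<open>degree f\<close>. But z (1 - c) = p'(0), so z - z c^d telescopes into terms c^i p'(0) of
    \<open>V\<close>, and z itself would lie in \<open>V\<close>.\<close>
  have "inverse c \<in> V"
  proof (rule ccontr)
    assume "inverse c \<notin> V"
    then have "z \<in> adjoin (inverse c)"
      using max[OF field_subring_adjoin subset_adjoin] mem_adjoin by blast
    then obtain f where f: "z = poly f (inverse c)" "\<And>i. coeff f i \<in> V"
      by (auto simp: adjoin_def)
    have cV: "c \<in> V" unfolding c_def using w z by (intro diff_mem mult_mem one_mem) auto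
    have "z * c ^ degree f = (\<Sum>i\<le>degree f. coeff f i * c ^ (degree f - i))"
      unfolding f(1) poly_altdef sum_distrib_right
    proof (rule sum.cong)
      fix i assume "i \<in> {..degree f}"
      then have "c ^ degree f = c ^ i * c ^ (degree f - i)" by (simp flip: power_add)
      then show "coeff f i * inverse c ^ i * c ^ degree f = coeff f i * c ^ (degree f - i)"
        using c0 by (simp add: power_inverse)
    qed simp
    also have "\<dots> \<in> V" using f cV by (intro sum_mem mult_mem power_mem) auto
    finally have *: "z * c ^ degree f \<in> V" .
    have "z - z * c ^ l \<in> V" for l
    proof (induction l)
      case (Suc l)
      have "z - z * c ^ Suc l = (z - z * c ^ l) + c ^ l * coeff p' 0"
        using z0 by (simp add: c_def field_simps)
      then show ?case using add_mem[OF Suc mult_mem[OF power_mem[OF cV] w(4)]] by metis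
    qed (simp add: zero_mem)
    then have "z - z * c ^ degree f + z * c ^ degree f \<in> V" using * add_mem by blast
    then show False using z by simp
  qed
  have n0: "n > 0"
  proof (rule ccontr)
    assume "\<not> n > 0"
    then obtain a where "p = [:a:]" using degree_eq_zeroE[of p] by (auto simp: n_def)
    then show False using w(2)[of 0] w(3) z by simp
  qed
  \<comment> \<open>Multiplying z = p'(1/w) by w^k and moving the term j = 0 to the left gives z c
    w^k = e(w): the power w^k becomes a combination of lower powers of w.\<close>
  define e where "e = (\<Sum>j\<in>{1..k}. monom (coeff p' j) (k - j))"
  have eV: "coeff e i \<in> V" for i
    unfolding e_def coeff_sum coeff_monom using w zero_mem by (intro sum_mem) auto
  have degE: "degree e \<le> k - 1"
    unfolding e_def by (intro degree_sum_le) (auto intro: order.trans[OF degree_monom_le])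
  have "z * w ^ k = (\<Sum>j\<le>k. coeff p' j * w ^ (k - j))"
    unfolding w(5) poly_altdef sum_distrib_right k_def
  proof (rule sum.cong)
    fix i assume "i \<in> {..degree p'}"
    then have "w ^ degree p' = w ^ i * w ^ (degree p' - i)" by (simp flip: power_add)
    then show "coeff p' i * inverse w ^ i * w ^ degree p' = coeff p' i * w ^ (degree p' - i)"
      using w(1) by (simp add: power_inverse)
  qed simp
  also have "\<dots> = coeff p' 0 * w ^ k + (\<Sum>j\<in>{1..k}. coeff p' j * w ^ (k - j))"
    by (simp add: atMost_atLeast0 sum.atLeast_Suc_atMost)
  also have "(\<Sum>j\<in>{1..k}. coeff p' j * w ^ (k - j)) = poly e w"
    by (simp add: e_def poly_sum poly_monom)
  finally have "c * w ^ k = inverse z * poly e w"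
    using z0 by (simp add: c_def field_simps)
  then have wk: "w ^ k = inverse z * inverse c * poly e w"
    using c0 by (metis (no_types, opaque_lifting) mult.assoc mult.commute mult.left_commute right_inverse mult_1)
  \<comment> \<open>The leading power of \<open>p\<close> is split as w^n = w^k w^(n-k), possible
    since k <= n, and w^k is replaced by lower powers.\<close>
  define f where "f = smult (coeff p n * inverse z * inverse c) (e * monom 1 (n - k)) + (p - monom (coeff p n) n)"
  have "poly f w = coeff p n * (inverse z * inverse c * poly e w) * w ^ (n - k) + z - coeff p n * w ^ n"
    by (simp add: f_def poly_monom w(3))
  also have "\<dots> = z"
    using w(6) unfolding wk[symmetric] by (simp add: n_def k_def mult.assoc flip: power_add)
  finally have 1: "z = poly f w" by simp
  have 2: "coeff f i \<in> V" for i
    unfolding f_def using w eV z \<open>inverse c \<in> V\<close>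
    by (auto simp: coeff_mult coeff_monom intro!: add_mem diff_mem mult_mem sum_mem one_mem zero_mem)
  have "degree (p - monom (coeff p n) n) < n"
    using n0 by (intro degree_lessI) (auto simp: n_def coeff_eq_0 le_less)
  moreover have "degree (e * monom 1 (n - k)) < n" if "k > 0"
  proof -
    have "degree (e * monom 1 (n - k)) \<le> degree e + degree (monom (1::'f) (n - k))"
      by (rule degree_mult_le)
    also have "\<dots> \<le> k - 1 + (n - k)" using degE degree_monom_le[of "1::'f" "n-k"] by linarith
    also have "\<dots> < n" using that w(6) n_def k_def by linarith
    finally show ?thesis .
  qed
  moreover have "e = 0" if "k = 0" using that by (simp add: e_def)
  ultimately have "degree f < n"
    unfolding f_def using n0 degree_smult_le[of "coeff p n * inverse z * inverse c" "e * monom 1 (n - k)"]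
    by (intro degree_add_less) (cases "k = 0", auto)
  then show ?thesis using that[of f] 1 2 by (auto simp: n_def)
qed

text \<open>If neither \<open>w\<close> nor its inverse lay in \<open>V\<close>, maximality would
  express \<open>z\<close> as a polynomial in each of them. Of two such relations of least degree,
  the one of larger degree could be shortened by the other.\<close>

lemma valuation_ring_if_maximal:
  assumes max: "\<And>W. field_subring W \<Longrightarrow> V \<subseteq> W \<Longrightarrow> z \<notin> W \<Longrightarrow> W = V"
    and z: "inverse z \<in> V" "z \<notin> V"
  shows "valuation_ring V"
proof (unfold_locales, rule ccontr)
  fix w assume w: "\<not> (w \<in> V \<or> inverse w \<in> V)"
  have ex: "\<exists>p. ((\<forall>i. coeff p i \<in> V) \<and> z = poly p v) \<and>
      (\<forall>p'. (\<forall>i. coeff p' i \<in> V) \<and> z = poly p' v \<longrightarrow> degree p \<le> degree p')" if "v \<notin> V" for v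
  proof -
    have "z \<in> adjoin v" using max[OF field_subring_adjoin subset_adjoin] mem_adjoin that by blast
    then obtain p where "(\<forall>i. coeff p i \<in> V) \<and> z = poly p v" by (auto simp: adjoin_def)
    from ex_has_least_nat[of "\<lambda>p. (\<forall>i. coeff p i \<in> V) \<and> z = poly p v", OF this, of degree]
    show ?thesis .
  qed
  obtain p where p: "\<And>i. coeff p i \<in> V" "z = poly p w"
      "\<And>f. \<lbrakk>\<And>i. coeff f i \<in> V; z = poly f w\<rbrakk> \<Longrightarrow> degree p \<le> degree f"
    using ex[of w] w by blast
  obtain p' where p': "\<And>i. coeff p' i \<in> V" "z = poly p' (inverse w)"
      "\<And>f. \<lbrakk>\<And>i. coeff f i \<in> V; z = poly f (inverse w)\<rbrakk> \<Longrightarrow> degree p' \<le> degree f"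
    using ex[of "inverse w"] w by blast
  have w0: "w \<noteq> 0" using w zero_mem by auto
  show False
  proof (cases "degree p' \<le> degree p")
    case True
    from adjoin_degree_reduction[OF max z w0 p(1,2) p'(1,2) True] obtain e
      where "\<And>i. coeff e i \<in> V" "z = poly e w" "degree e < degree p" by blast
    then show False using p(3)[of e] by simp
  next
    case False
    have "z = poly p (inverse (inverse w))" "inverse w \<noteq> 0" "degree p \<le> degree p'"
      using p(2) w0 False by simp_all
    from adjoin_degree_reduction[OF max z this(2) p'(1,2) p(1) this(1,3)] obtain e
      where "\<And>i. coeff e i \<in> V" "z = poly e (inverse w)" "degree e < degree p'" by blast
    then show False using p'(3)[of e] by simp
  qed
qed

text \<open>Applied to two rings: K[1/x], which yields a place at infinity, and A[1/w], which yields
  a place where \<open>w\<close> has a pole unless \<open>w\<close> is integral over A.\<close>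

theorem exists_valuation_ring_avoiding:
  assumes z: "inverse z \<in> V" "z \<notin> V"
  obtains W where "valuation_ring W" "V \<subseteq> W" "z \<notin> W"
proof -
  define R where "R = {W. field_subring W \<and> V \<subseteq> W \<and> z \<notin> W}"
  have "\<exists>W\<in>R. \<forall>X\<in>R. W \<subseteq> X \<longrightarrow> X = W"
  proof (rule subset_Zorn_nonempty)
    show "R \<noteq> {}" using z field_subring_axioms by (auto simp: R_def)
  next
    fix C assume C: "C \<noteq> {}" "subset.chain R C"
    then have CR: "\<And>W. W \<in> C \<Longrightarrow> field_subring W \<and> V \<subseteq> W \<and> z \<notin> W"
      unfolding subset_chain_def R_def by blast
    have ex: "\<exists>W\<in>C. a \<in> W \<and> b \<in> W" if "a \<in> \<Union>C" "b \<in> \<Union>C" for a b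
    proof -
      obtain W W' where W: "W \<in> C" "W' \<in> C" "a \<in> W" "b \<in> W'" using \<open>a \<in> \<Union>C\<close> \<open>b \<in> \<Union>C\<close> by blast
      moreover have "W \<subseteq> W' \<or> W' \<subseteq> W" using C(2) W unfolding subset_chain_def by blast
      ultimately show ?thesis by blast
    qed
    have "field_subring (\<Union>C)"
    proof
      show "1 \<in> \<Union>C" using C(1) CR field_subring.one_mem by blast
    next
      fix a b assume "a \<in> \<Union>C" "b \<in> \<Union>C"
      then obtain W where "W \<in> C" "a \<in> W" "b \<in> W" using ex by blast
      then show "a - b \<in> \<Union>C" "a * b \<in> \<Union>C"
        using CR field_subring.diff_mem field_subring.mult_mem by (metis UnionI)+
    qed
    then show "\<Union>C \<in> R" using C(1) CR by (auto simp: R_def)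
  qed
  then obtain W where W: "W \<in> R" and max: "\<And>X. X \<in> R \<Longrightarrow> W \<subseteq> X \<Longrightarrow> X = W" by blast
  then have W': "field_subring W" "V \<subseteq> W" "z \<notin> W" "inverse z \<in> W" using z by (auto simp: R_def)
  have "valuation_ring W"
  proof (rule field_subring.valuation_ring_if_maximal[OF W'(1) _ W'(4,3)])
    fix X assume "field_subring X" "W \<subseteq> X" "z \<notin> X"
    then show "X = W" using max[of X] W'(2) by (simp add: R_def)
  qed
  then show ?thesis using W'(2,3) by (rule that)
qed

end

section \<open>Coordinate rings of plane curves\<close>

locale ring_homomorphism =
  fixes \<phi> :: "'r::comm_ring_1 \<Rightarrow> 's::comm_ring_1"
  assumes hom_1: "\<phi> 1 = 1"
    and hom_add: "\<phi> (a + b) = \<phi> a + \<phi> b"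
    and hom_mult: "\<phi> (a * b) = \<phi> a * \<phi> b"
begin

lemma hom_0 [simp]: "\<phi> 0 = 0"
  using hom_add[of 0 0] by simp

lemma hom_uminus: "\<phi> (- a) = - \<phi> a"
  using hom_add[of a "- a"] by (simp add: eq_neg_iff_add_eq_0 add.commute)

lemma hom_diff: "\<phi> (a - b) = \<phi> a - \<phi> b"
  using hom_add[of a "- b"] by (simp add: hom_uminus)

lemma hom_power: "\<phi> (a ^ n) = \<phi> a ^ n"
  by (induction n) (auto simp: hom_1 hom_mult)

lemma hom_sum: "\<phi> (sum f S) = (\<Sum>i\<in>S. \<phi> (f i))"
  by (induction S rule: infinite_finite_induct) (auto simp: hom_add)

lemma hom_of_nat: "\<phi> (of_nat n) = of_nat n"
  by (induction n) (auto simp: hom_add hom_1)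

text \<open>Used in two layers: \<open>K.hev x\<close> evaluates K[X], and being a homomorphism
  itself it is the coefficient map of \<open>Kx.hev y\<close> on K[X][Y], which is
  \<open>eval2\<close>.\<close>

definition hev :: "'s \<Rightarrow> 'r poly \<Rightarrow> 's" where
  "hev z p = poly (map_poly \<phi> p) z"

lemma hev_pCons: "hev z (pCons c p) = \<phi> c + z * hev z p"
  by (simp add: hev_def map_poly_pCons)

lemma hev_0 [simp]: "hev z 0 = 0"
  by (simp add: hev_def)

lemma hev_const [simp]: "hev z [:c:] = \<phi> c"
  by (simp add: hev_pCons)

lemma hev_X [simp]: "hev z [:0, 1:] = z"
  by (simp add: hev_pCons hom_1)

lemma hev_add: "hev z (p + q) = hev z p + hev z q"
proof -
  have "map_poly \<phi> (p + q) = map_poly \<phi> p + map_poly \<phi> q"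
    by (rule poly_eqI) (simp add: coeff_map_poly hom_add)
  then show ?thesis by (simp add: hev_def)
qed

lemma hev_smult: "hev z (smult c p) = \<phi> c * hev z p"
  by (induction p) (auto simp: hev_pCons hom_mult algebra_simps)

lemma hev_mult: "hev z (p * q) = hev z p * hev z q"
  by (induction p) (auto simp: hev_pCons hev_add hev_smult algebra_simps)

lemma ring_homomorphism_hev: "ring_homomorphism (hev z)"
  by unfold_locales (auto simp: hev_add hev_mult one_pCons hom_1)

lemmas hev_diff = ring_homomorphism.hom_diff[OF ring_homomorphism_hev]
lemmas hev_uminus = ring_homomorphism.hom_uminus[OF ring_homomorphism_hev]
lemmas hev_power = ring_homomorphism.hom_power[OF ring_homomorphism_hev]
lemmas hev_sum = ring_homomorphism.hom_sum[OF ring_homomorphism_hev]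

lemma hev_monom: "hev z (monom c n) = \<phi> c * z ^ n"
  by (simp add: hev_def map_poly_monom poly_monom)

lemma hev_pcompose: "hev z (pcompose p q) = hev (hev z q) p"
  by (induction p) (auto simp: pcompose_pCons hev_add hev_mult hev_pCons)

lemma hev_altdef: "hev z p = (\<Sum>i\<le>degree p. \<phi> (coeff p i) * z ^ i)"
proof -
  have "hev z p = hev z (\<Sum>i\<le>degree p. monom (coeff p i) i)"
    using poly_as_sum_of_monoms[of p] by simp
  then show ?thesis by (simp add: hev_sum hev_monom)
qed

end

section \<open>The coordinate ring inside the function field\<close>

locale plane_curve =
  fixes \<iota> :: "'a::field \<Rightarrow> 'f::field" and x y :: 'f and G :: "'a poly poly"
  assumes function_field: "is_function_field G \<iota> x y"
    and monic: "lead_coeff G = 1" and degree_pos: "degree G > 0"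
begin

sublocale K: ring_homomorphism \<iota>
  using function_field by unfold_locales (auto simp: is_function_field_def)

sublocale Kx: ring_homomorphism "K.hev x"
  by (rule K.ring_homomorphism_hev)

lemma eval2_eq: "eval2 \<iota> x y P = Kx.hev y P"
proof -
  have "K.hev x = (\<lambda>a. poly (map_poly \<iota> a) x)" by (rule ext) (simp add: K.hev_def)
  then show ?thesis unfolding eval2_def Kx.hev_def by simp
qed

lemma hev_eq_0_iff: "Kx.hev y P = 0 \<longleftrightarrow> G dvd P"
  using function_field by (simp add: is_function_field_def eval2_eq)

lemma iota_eq_0_iff: "\<iota> c = 0 \<longleftrightarrow> c = 0"
proof
  assume "\<iota> c = 0"
  show "c = 0"
  proof (rule ccontr)
    assume "c \<noteq> 0"
    then have "\<iota> c * \<iota> (inverse c) = 1" by (simp add: K.hom_1 flip: K.hom_mult)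
    then show False using \<open>\<iota> c = 0\<close> by simp
  qed
qed simp

lemma iota_inverse: "\<iota> (inverse c) = inverse (\<iota> c)"
proof (cases "c = 0")
  case False
  then have "\<iota> c * \<iota> (inverse c) = 1" by (simp add: K.hom_1 flip: K.hom_mult)
  then show ?thesis by (metis inverse_unique)
qed simp

text \<open>This is transcendence of \<open>x\<close> over K: \<open>G\<close> has positive degree
  in Y, so it divides no nonzero polynomial in X alone.\<close>

lemma hev_x_eq_0_iff: "K.hev x D = 0 \<longleftrightarrow> D = 0"
proof
  assume "K.hev x D = 0"
  then have "G dvd [:D:]" using hev_eq_0_iff[of "[:D:]"] by simp
  then show "D = 0" using degree_pos dvd_imp_degree_le by (metis degree_pCons_0 le_zero_eq not_less pCons_eq_0_iff)
qed simp

definition A :: "'f set" where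
  "A = range (Kx.hev y)"

sublocale A: field_subring A
proof
  show "1 \<in> A" unfolding A_def by (rule image_eqI[of _ _ "[:1:]"]) (auto simp: K.hom_1 one_pCons)
next
  fix a b assume "a \<in> A" "b \<in> A"
  then show "a - b \<in> A" "a * b \<in> A"
    unfolding A_def by (auto simp flip: Kx.hev_diff Kx.hev_mult)
qed

lemma hev_x_mem: "K.hev x D \<in> A"
  unfolding A_def by (rule image_eqI[of _ _ "[:D:]"]) auto

lemma iota_mem: "\<iota> c \<in> A"
  using hev_x_mem[of "[:c:]"] by simp

lemma x_mem: "x \<in> A"
  using hev_x_mem[of "[:0, 1:]"] by simp

lemma y_mem: "y \<in> A"
  unfolding A_def by (rule image_eqI[of _ _ "[:0, 1:]"]) (simp_all add: Kx.hev_pCons K.hom_1 one_pCons)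

lemma hev_x_induct:
  assumes "\<And>c. \<iota> c \<in> S" "x \<in> S" "\<And>a b. a \<in> S \<Longrightarrow> b \<in> S \<Longrightarrow> a + b \<in> S"
    and "\<And>a b. a \<in> S \<Longrightarrow> b \<in> S \<Longrightarrow> a * b \<in> S"
  shows "K.hev x D \<in> S"
  using assms(1)[of 0] by (induction D) (auto simp: K.hev_pCons assms)

lemma A_subset:
  assumes "\<And>c. \<iota> c \<in> S" "x \<in> S" "y \<in> S" "\<And>a b. a \<in> S \<Longrightarrow> b \<in> S \<Longrightarrow> a + b \<in> S"
    and "\<And>a b. a \<in> S \<Longrightarrow> b \<in> S \<Longrightarrow> a * b \<in> S"
  shows "A \<subseteq> S"
proof -
  have "Kx.hev y P \<in> S" for P
    using assms(1)[of 0] hev_x_induct[of S, OF assms(1,2,4,5)]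
    by (induction P) (auto simp: Kx.hev_pCons assms)
  then show ?thesis by (auto simp: A_def)
qed

lemma fraction: obtains a b where "a \<in> A" "b \<in> A" "b \<noteq> 0" "z = a / b"
  using function_field unfolding is_function_field_def eval2_eq A_def by (metis rangeI)

text \<open>Among the polynomials whose value is a nonzero multiple of \<open>b\<close>, one of minimal degree in \<open>y\<close>
  has degree 0, since otherwise pseudo-division of \<open>G\<close> by it would produce a smaller one.\<close>

lemma dvd_hev_x:
  assumes "b \<in> A" "b \<noteq> 0"
  obtains c D where "c \<in> A" "D \<noteq> 0" "b * c = K.hev x D"
proof -
  define S where "S = {d. Kx.hev y d \<noteq> 0 \<and> (\<exists>c\<in>A. Kx.hev y d = b * c)}"
  have "\<exists>d. d \<in> S" using assms A.one_mem unfolding S_def A_def by fastforce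
  then obtain d where d: "d \<in> S" and min: "\<And>e. e \<in> S \<Longrightarrow> degree d \<le> degree e"
    using ex_has_least_nat[of "\<lambda>d. d \<in> S" _ degree] by blast
  have d0: "Kx.hev y d \<noteq> 0" "d \<noteq> 0" using d by (auto simp: S_def)
  obtain c where c: "c \<in> A" "Kx.hev y d = b * c" using d by (auto simp: S_def)
  have G0: "G \<noteq> 0" using degree_pos by auto
  have G_eval: "Kx.hev y G = 0" by (simp add: hev_eq_0_iff)
  have dG: "degree d < degree G"
  proof -
    obtain q r where qr: "pseudo_divmod d G = (q, r)" by fastforce
    from pseudo_divmod[OF G0 qr] monic have r: "d = G * q + r" "r = 0 \<or> degree r < degree G" by auto
    then have "Kx.hev y r = Kx.hev y d" by (simp add: Kx.hev_add Kx.hev_mult G_eval)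
    then have "r \<in> S" "r \<noteq> 0" using d d0 by (auto simp: S_def)
    then show ?thesis using min r(2) by fastforce
  qed
  define l where "l = lead_coeff d ^ (Suc (degree G) - degree d)"
  have l0: "l \<noteq> 0" using d0 by (simp add: l_def)
  obtain q r where qr: "pseudo_divmod G d = (q, r)" by fastforce
  from pseudo_divmod[OF d0(2) qr] have r: "smult l G = d * q + r" "r = 0 \<or> degree r < degree d"
    by (auto simp: l_def)
  have "Kx.hev y r = - (Kx.hev y d * Kx.hev y q)"
    using arg_cong[OF r(1), of "Kx.hev y"]
    by (simp add: Kx.hev_add Kx.hev_mult Kx.hev_smult G_eval eq_neg_iff_add_eq_0 add.commute)
  then have "Kx.hev y r = b * (- (c * Kx.hev y q))" by (simp add: c)
  moreover have "- (c * Kx.hev y q) \<in> A" using c A.uminus_mem A.mult_mem by (auto simp: A_def)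
  ultimately have "\<exists>e\<in>A. Kx.hev y r = b * e" by blast
  then have "Kx.hev y r \<noteq> 0 \<Longrightarrow> r \<in> S" by (simp add: S_def)
  then have r_eval: "Kx.hev y r = 0" using r(2) min by fastforce
  \<comment> \<open>A multiple of \<open>G\<close> of smaller degree vanishes, so
    \<open>r = 0\<close>. Then d(y) q(y) = 0 with d(y) nonzero makes \<open>G\<close> divide
    \<open>q\<close>, and cancelling \<open>G\<close> leaves \<open>[:l:] = d * q'\<close>, which
    forces degree 0.\<close>
  then have "G dvd r" by (simp add: hev_eq_0_iff)
  then have "r = 0" using r(2) dG dvd_imp_degree_le[of G r] by (cases "r = 0") auto
  then have "Kx.hev y d * Kx.hev y q = 0"
    using arg_cong[OF r(1), of "Kx.hev y"] by (simp add: Kx.hev_mult Kx.hev_smult G_eval)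
  then have "G dvd q" using d0 by (simp add: hev_eq_0_iff)
  then obtain q' where "q = G * q'" by auto
  then have "G * [:l:] = G * (d * q')" using r(1) \<open>r = 0\<close> by (simp add: mult_ac)
  then have dq: "[:l:] = d * q'" using G0 mult_left_cancel[of G "[:l:]" "d * q'"] by blast
  then have "q' \<noteq> 0" using l0 by auto
  then have "degree d + degree q' = degree [:l:]" using dq degree_mult_eq[of d q'] d0 by simp
  then have "degree d = 0" by simp
  then obtain D where "d = [:D:]" using degree_eq_zeroE by blast
  then show ?thesis using that[OF c(1), of D] c(2) d0 by simp
qed

end

section \<open>Frobenius and the finite places\<close>

lemma prime_CHAR_eq:
  assumes "prime p" "of_nat p = (0 :: 'b::comm_ring_1)"
  shows "CHAR('b) = p"
proof -
  have "CHAR('b) dvd p" using assms(2) by (simp add: of_nat_eq_0_iff_char_dvd)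
  then show ?thesis using assms(1) by (auto simp: prime_nat_iff)
qed

lemma frobenius_add:
  fixes a b :: "'b::comm_ring_1"
  assumes "prime p" "of_nat p = (0 :: 'b)"
  shows "(a + b) ^ (p ^ k) = a ^ (p ^ k) + b ^ (p ^ k)"
  using freshmans_dream'[of "p ^ k" k a b] assms prime_CHAR_eq by blast

lemma frobenius_diff:
  fixes a b :: "'b::comm_ring_1"
  assumes "prime p" "of_nat p = (0 :: 'b)"
  shows "(a - b) ^ (p ^ k) = a ^ (p ^ k) - b ^ (p ^ k)"
  using frobenius_add[OF assms, of "a - b" b k] by (simp add: eq_diff_eq)

lemma frobenius_sum:
  fixes f :: "'i \<Rightarrow> 'b::comm_ring_1"
  assumes "prime p" "of_nat p = (0 :: 'b)"
  shows "sum f S ^ (p ^ k) = (\<Sum>i\<in>S. f i ^ (p ^ k))"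
  using assms prime_gt_0_nat[OF assms(1)]
  by (induction S rule: infinite_finite_induct) (auto simp: frobenius_add[OF assms] power_0_left)

lemma finite_polys_degree_less: "finite {p :: 'a::{zero,finite} poly. p = 0 \<or> degree p < d}"
proof (rule finite_subset)
  show "{p :: 'a poly. p = 0 \<or> degree p < d} \<subseteq> Poly ` {xs. set xs \<subseteq> UNIV \<and> length xs \<le> d}"
  proof
    fix p :: "'a poly" assume "p \<in> {p. p = 0 \<or> degree p < d}"
    then have "length (coeffs p) \<le> d" by (cases "p = 0") (auto simp: length_coeffs_degree)
    then show "p \<in> Poly ` {xs. set xs \<subseteq> UNIV \<and> length xs \<le> d}"
      by (intro image_eqI[of _ _ "coeffs p"]) auto
  qed
qed (intro finite_imageI finite_lists_length_le finite)

text \<open>The relation \<open>power_y\<close> carries the whole analysis of the places with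
  \<open>x\<close> regular. It makes \<open>y\<close> integral over K[x] and the Frobenius map on A
  periodic modulo each prime of K[x]. It is instantiated with \<open>p ^ m\<close> the order of
  K.\<close>

locale frobenius_curve = plane_curve \<iota> x y G
  for \<iota> :: "'a::{field,finite} \<Rightarrow> 'f::field" and x y G +
  fixes p m :: nat and h0 :: "'a poly"
  assumes p: "prime p" "of_nat p = (0 :: 'a)" "m > 0"
    and power_K: "\<And>c :: 'a. c ^ (p ^ m) = c"
    and power_y: "y ^ (p ^ m) = y - K.hev x h0"
begin

lemma char_F: "of_nat p = (0 :: 'f)"
  using K.hom_of_nat[of p] p by simp

lemma char_poly: "of_nat p = (0 :: 'a poly)"
  using p by (simp add: of_nat_poly)

lemma one_less_pm: "1 < p ^ m"
  using p prime_gt_1_nat by (metis one_less_power)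

lemma power_K_iter: "c ^ (p ^ (m * j)) = (c::'a)"
proof (induction j)
  case (Suc j)
  have "c ^ (p ^ (m * Suc j)) = (c ^ (p ^ (m * j))) ^ (p ^ m)"
    by (simp add: power_add mult.commute flip: power_mult)
  then show ?case by (simp add: Suc power_K)
qed simp

lemma hev_power_p:
  assumes "m dvd k"
  shows "K.hev z D ^ (p ^ k) = K.hev (z ^ (p ^ k)) D"
proof -
  obtain j where j: "k = m * j" using assms by blast
  have "K.hev z D ^ (p ^ k) = (\<Sum>i\<le>degree D. (\<iota> (coeff D i) * z ^ i) ^ (p ^ k))"
    unfolding K.hev_altdef by (rule frobenius_sum[OF p(1) char_F])
  also have "\<dots> = (\<Sum>i\<le>degree D. \<iota> (coeff D i) * (z ^ (p ^ k)) ^ i)"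
    by (intro sum.cong refl) (simp add: power_mult_distrib j power_K_iter power_commutes
        flip: K.hom_power power_mult, simp add: mult.commute)
  finally show ?thesis by (simp add: K.hev_altdef)
qed

lemma power_y_iter: "\<exists>H. y ^ (p ^ (m * j)) = y - K.hev x H"
proof (induction j)
  case (Suc j)
  then obtain H where H: "y ^ (p ^ (m * j)) = y - K.hev x H" by blast
  have "y ^ (p ^ (m * Suc j)) = (y ^ (p ^ (m * j))) ^ (p ^ m)"
    by (simp add: power_add mult.commute flip: power_mult)
  also have "\<dots> = y - K.hev x (h0 + pcompose H (monom 1 (p ^ m)))"
    by (simp add: H frobenius_diff[OF p(1) char_F] power_y hev_power_p K.hev_add K.hev_pcompose
        K.hev_monom K.hom_1)
  finally show ?case by blast
qed (auto intro: exI[of _ 0])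

text \<open>The residue ring modulo \<open>P\<close> is finite, so two Frobenius powers of X
  coincide there. Their difference is itself a Frobenius power of some X^(p^(mj)) - X, and
  \<open>P\<close> is prime.\<close>

lemma prime_dvd_X_power_diff:
  fixes P :: "'a poly"
  assumes "prime_elem P"
  shows "\<exists>j>0. P dvd monom 1 (p ^ (m * j)) - monom 1 1"
proof -
  let ?f = "\<lambda>i. monom 1 (p ^ (m * i)) mod P"
  have P0: "P \<noteq> 0" using assms by auto
  have "range ?f \<subseteq> {r. r = 0 \<or> degree r < degree P}"
    using degree_mod_less[OF P0] by blast
  then have "finite (range ?f)" using finite_subset finite_polys_degree_less by blast
  then have "\<not> inj ?f" using finite_imageD by blast
  then obtain i j where ij: "i < j" "?f i = ?f j"
    unfolding inj_def by (metis nat_neq_iff)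
  then have "P dvd monom 1 (p ^ (m * j)) - monom 1 (p ^ (m * i))"
    by (metis mod_eq_dvd_iff)
  also have "monom 1 (p ^ (m * j)) - monom 1 (p ^ (m * i)) =
      (monom 1 (p ^ (m * (j - i))) - monom (1::'a) 1) ^ (p ^ (m * i))"
    using ij(1) by (simp add: frobenius_diff[OF p(1) char_poly] monom_power flip: power_add add_mult_distrib2)
  finally have "P dvd monom 1 (p ^ (m * (j - i))) - monom 1 1"
    using assms prime_elem_dvd_power by blast
  then show ?thesis using ij(1) by (intro exI[of _ "j - i"]) auto
qed

text \<open>Modulo a prime \<open>P\<close> of \<open>K[x]\<close>, some power \<open>Q\<close> of the Frobenius map fixes \<open>x\<close> and maps \<open>y\<close>
  to a translate \<open>y - H\<close>; so its \<open>p\<close>-th iterate is the identity on the coordinate ring.\<close>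

lemma frobenius_periodic:
  assumes "prime_elem P"
  obtains e where "e > 0" "\<And>a. a \<in> A \<Longrightarrow> \<exists>c\<in>A. a ^ (p ^ e) - a = K.hev x P * c"
proof -
  obtain j where j: "j > 0" and "P dvd monom 1 (p ^ (m * j)) - monom 1 1"
    using prime_dvd_X_power_diff[OF assms] by blast
  then obtain R where R: "monom 1 (p ^ (m * j)) - monom 1 1 = P * R" by blast
  define eqv where "eqv a b \<longleftrightarrow> (\<exists>c\<in>A. a - b = K.hev x P * c)" for a b
  have refl: "eqv a a" for a unfolding eqv_def using A.zero_mem by (intro bexI[of _ 0]) auto
  have add: "eqv (a + c) (b + d)" if "eqv a b" "eqv c d" for a b c d
  proof -
    from that obtain u v where "u \<in> A" "v \<in> A" "a - b = K.hev x P * u" "c - d = K.hev x P * v"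
      by (auto simp: eqv_def)
    then show ?thesis unfolding eqv_def
      by (intro bexI[of _ "u + v"]) (auto simp: A.add_mem algebra_simps)
  qed
  have mult: "eqv (a * c) (b * d)" if "eqv a b" "eqv c d" "a \<in> A" "d \<in> A" for a b c d
  proof -
    from that obtain u v where uv: "u \<in> A" "v \<in> A" "a - b = K.hev x P * u" "c - d = K.hev x P * v"
      by (auto simp: eqv_def)
    have "a * c - b * d = a * (c - d) + (a - b) * d" by (simp add: algebra_simps)
    also have "\<dots> = K.hev x P * (a * v + u * d)" unfolding uv by (simp add: algebra_simps)
    finally show ?thesis unfolding eqv_def
      using uv that by (intro bexI[of _ "a * v + u * d"]) (auto simp: A.add_mem A.mult_mem)
  qed
  have trans: "eqv a c" if "eqv a b" "eqv b c" for a b c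
  proof -
    from that obtain u v where "u \<in> A" "v \<in> A" "a - b = K.hev x P * u" "b - c = K.hev x P * v"
      by (auto simp: eqv_def)
    then show ?thesis unfolding eqv_def
      by (intro bexI[of _ "u + v"]) (auto simp: A.add_mem algebra_simps)
  qed
  have power: "eqv (a ^ k) (b ^ k)" if "eqv a b" "a \<in> A" "b \<in> A" for a b k
    by (induction k) (auto simp: refl mult that A.power_mem)
  define S where "S k = {a \<in> A. eqv (a ^ (p ^ k)) a}" for k
  have S_add: "a + b \<in> S k" if "a \<in> S k" "b \<in> S k" for a b k
    using that by (auto simp: S_def add A.add_mem frobenius_add[OF p(1) char_F])
  have S_mult: "a * b \<in> S k" if "a \<in> S k" "b \<in> S k" for a b k
    using that by (auto simp: S_def mult A.power_mem A.mult_mem power_mult_distrib)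
  have iota_power: "\<iota> c ^ (p ^ (m * i)) = \<iota> c" for c i
    by (simp add: power_K_iter flip: K.hom_power)
  have x1: "eqv (x ^ (p ^ (m * j))) x"
    unfolding eqv_def using arg_cong[OF R, of "K.hev x"]
    by (intro bexI[of _ "K.hev x R"]) (auto simp: K.hev_diff K.hev_mult K.hev_monom K.hom_1 hev_x_mem)
  have D1: "eqv (K.hev x D ^ (p ^ (m * j))) (K.hev x D)" for D
  proof -
    have "K.hev x D \<in> S (m * j)"
      using x1 by (intro hev_x_induct S_add S_mult) (auto simp: S_def iota_power refl iota_mem x_mem)
    then show ?thesis by (simp add: S_def)
  qed
  obtain H where H: "y ^ (p ^ (m * j)) = y - K.hev x H" using power_y_iter by blast
  have pow: "z ^ (p ^ (m * j * Suc i)) = (z ^ (p ^ (m * j * i))) ^ (p ^ (m * j))" for i and z :: 'f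
    by (simp add: power_add mult.commute flip: power_mult)
  have mem: "y - of_nat i * K.hev x H \<in> A" for i
    using hev_x_mem[of "of_nat i * H"] y_mem by (simp add: K.hev_mult A.diff_mem Kx.hom_of_nat)
  have yi: "eqv (y ^ (p ^ (m * j * i))) (y - of_nat i * K.hev x H)" for i
  proof (induction i)
    case (Suc i)
    have "eqv (y ^ (p ^ (m * j * Suc i))) ((y - of_nat i * K.hev x H) ^ (p ^ (m * j)))"
      unfolding pow by (intro power Suc A.power_mem y_mem mem)
    also have "(y - of_nat i * K.hev x H) ^ (p ^ (m * j)) = y - K.hev x H + - (K.hev x (of_nat i * H) ^ (p ^ (m * j)))"
      by (simp add: frobenius_diff[OF p(1) char_F] H K.hev_mult Kx.hom_of_nat)
    finally have 1: "eqv (y ^ (p ^ (m * j * Suc i))) \<dots>" .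
    have "eqv (- (K.hev x (of_nat i * H) ^ (p ^ (m * j)))) (- (K.hev x (of_nat i * H)))"
      using mult[OF refl[of "-1"] D1[of "of_nat i * H"]] hev_x_mem A.uminus_mem[OF A.one_mem] by simp
    from trans[OF 1 add[OF refl this]] show ?case
      by (simp add: K.hev_mult Kx.hom_of_nat algebra_simps)
  qed (simp add: refl)
  have xi: "eqv (x ^ (p ^ (m * j * i))) x" for i
  proof (induction i)
    case (Suc i)
    then show ?case unfolding pow
      by (intro trans[OF power x1] A.power_mem x_mem)
  qed (simp add: refl)
  have "eqv (a ^ (p ^ (m * j * p))) a" if "a \<in> A" for a
  proof -
    have "A \<subseteq> S (m * j * p)"
      using xi[of p] yi[of p] iota_power[of _ "j * p"]
      by (intro A_subset S_add S_mult)
        (auto simp: S_def refl iota_mem x_mem y_mem char_F mult.assoc)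
    then show ?thesis using that by (auto simp: S_def)
  qed
  then show ?thesis using that[of "m * j * p"] j p prime_gt_0_nat unfolding eqv_def by auto
qed

end

lemma exists_irreducible_factor:
  fixes D :: "'a::field poly"
  assumes "degree D > 0"
  obtains P where "prime_elem P" "degree P > 0" "P dvd D"
proof -
  obtain P where P: "degree P > 0" "P dvd D"
    and min: "\<And>R. degree R > 0 \<Longrightarrow> R dvd D \<Longrightarrow> degree P \<le> degree R"
    using ex_has_least_nat[of "\<lambda>P. degree P > 0 \<and> P dvd D" D degree] assms by auto
  have "irreducible P"
  proof (rule irreducibleI)
    show "P \<noteq> 0" using P by auto
    then show "\<not> P dvd 1" using P by (simp add: is_unit_iff_degree)
  next
    fix a b assume ab: "P = a * b"
    then have ab0: "a \<noteq> 0" "b \<noteq> 0" using P by auto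
    then have "degree P = degree a + degree b" using ab degree_mult_eq by blast
    moreover have "degree a > 0 \<Longrightarrow> degree P \<le> degree a" "degree b > 0 \<Longrightarrow> degree P \<le> degree b"
      using min ab P(2) dvd_trans by (auto intro: dvd_mult_left dvd_mult_right)
    ultimately have "degree a = 0 \<or> degree b = 0" by linarith
    then show "a dvd 1 \<or> b dvd 1" using ab0 by (auto simp: is_unit_iff_degree)
  qed
  then show ?thesis using that P field_poly_irreducible_imp_prime by blast
qed

section \<open>Places at which \<open>x\<close> is regular\<close>

lemma (in plane_curve) place_valuation_ring: "V \<in> places \<iota> \<Longrightarrow> valuation_ring V"
  using K.hom_1 by unfold_locales (auto simp: places_def subset_iff psubset_eq intro: rangeI)

lemma (in plane_curve) iota_mem_place: "V \<in> places \<iota> \<Longrightarrow> \<iota> c \<in> V"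
  by (auto simp: places_def)

context frobenius_curve
begin

text \<open>At a pole of \<open>y\<close> the relation \<open>power_y\<close>, divided by
  \<open>y\<close>, would put a positive power of \<open>y\<close> into \<open>V\<close>.\<close>

lemma coordinate_ring_subset_place:
  assumes V: "V \<in> places \<iota>" and xV: "x \<in> V"
  shows "A \<subseteq> V"
proof -
  interpret valuation_ring V using V by (rule place_valuation_ring)
  have KV: "K.hev x D \<in> V" for D
    using xV V by (intro hev_x_induct) (auto simp: add_mem mult_mem iota_mem_place)
  have "y \<in> V"
  proof (rule ccontr)
    assume y: "y \<notin> V"
    then have y0: "y \<noteq> 0" and iy: "inverse y \<in> max_ideal V" using zero_mem not_mem_inverse by auto
    have "y ^ (p ^ m - 1) * y = y - K.hev x h0"
      using power_y one_less_pm by (metis less_trans power_minus_mult zero_less_one)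
    then have "y ^ (p ^ m - 1) = 1 + - (K.hev x h0) * inverse y" using y0 by (simp add: field_simps)
    also have "\<dots> \<in> V"
      using max_ideal_subset[OF iy] KV by (intro add_mem mult_mem one_mem uminus_mem)
    finally have "y ^ (p ^ m - 1) \<in> V" .
    then have "inverse y ^ (p ^ m - 1) * y ^ (p ^ m - 1) \<in> max_ideal V"
      using max_ideal_mult[OF max_ideal_power[OF iy]] one_less_pm by simp
    then show False using y0 one_not_max_ideal by (simp flip: power_mult_distrib)
  qed
  then show ?thesis
    using xV V by (intro A_subset) (auto simp: add_mem mult_mem iota_mem_place)
qed

text \<open>The maximal ideal contracts to a prime of K[x]. It is nonzero: the denominator of an
  element outside \<open>V\<close> lies in the maximal ideal, and by \<open>dvd_hev_x\<close> it
  divides some nonzero D(x).\<close>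

lemma finite_place_prime:
  assumes V: "V \<in> places \<iota>" and xV: "x \<in> V"
  obtains P where "P \<noteq> 0" "prime_elem P" "\<And>D. K.hev x D \<in> max_ideal V \<longleftrightarrow> P dvd D"
proof -
  interpret valuation_ring V using V by (rule place_valuation_ring)
  have AV: "A \<subseteq> V" using assms by (rule coordinate_ring_subset_place)
  have KV: "K.hev x D \<in> V" for D using AV hev_x_mem by blast
  have "V \<noteq> UNIV" using V by (auto simp: places_def)
  then obtain z where z: "z \<notin> V" by blast
  obtain a b where ab: "a \<in> A" "b \<in> A" "b \<noteq> 0" "z = a / b" using fraction by blast
  have bm: "b \<in> max_ideal V"
  proof (rule ccontr)
    assume "b \<notin> max_ideal V"
    then have "inverse b \<in> V" using ab AV by (auto simp: max_ideal_def)
    then show False using z ab AV by (metis divide_inverse mult_mem subsetD)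
  qed
  obtain c D where "c \<in> A" "D \<noteq> 0" "b * c = K.hev x D" using dvd_hev_x ab by metis
  then have "D \<noteq> 0 \<and> K.hev x D \<in> max_ideal V" using bm AV max_ideal_mult by (metis subsetD)
  then obtain P where P: "P \<noteq> 0" "K.hev x P \<in> max_ideal V"
    and min: "\<And>D. D \<noteq> 0 \<Longrightarrow> K.hev x D \<in> max_ideal V \<Longrightarrow> degree P \<le> degree D"
    using ex_has_least_nat[of "\<lambda>D. D \<noteq> 0 \<and> K.hev x D \<in> max_ideal V" D degree] by blast
  have dvd: "K.hev x D \<in> max_ideal V \<longleftrightarrow> P dvd D" for D
  proof
    assume D: "K.hev x D \<in> max_ideal V"
    have "K.hev x (D mod P) = K.hev x D + - (K.hev x P * K.hev x (D div P))"
      by (simp add: K.hev_diff K.hev_mult flip: minus_mult_div_eq_mod)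
    also have "\<dots> \<in> max_ideal V"
      using D P KV by (intro max_ideal_add max_ideal_uminus max_ideal_mult)
    finally have "D mod P = 0 \<or> degree P \<le> degree (D mod P)" using min by blast
    then show "P dvd D" using degree_mod_less[OF P(1), of D] by auto
  next
    assume "P dvd D"
    then show "K.hev x D \<in> max_ideal V" using P KV max_ideal_mult by (auto simp: K.hev_mult)
  qed
  have "prime_elem P"
  proof (rule prime_elemI)
    show "\<not> P dvd 1" using dvd[of 1] one_not_max_ideal by (simp add: one_pCons K.hom_1)
  next
    fix a b assume "P dvd a * b"
    then have ab: "K.hev x a * K.hev x b \<in> max_ideal V" using dvd by (simp flip: K.hev_mult)
    show "P dvd a \<or> P dvd b"
    proof (rule ccontr)
      assume "\<not> (P dvd a \<or> P dvd b)"
      then have "unt (K.hev x a)" "unt (K.hev x b)" using dvd KV by (auto simp: unt_iff)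
      then show False using unt_mult ab by (auto simp: unt_iff)
    qed
  qed (rule P)
  then show ?thesis using that P dvd by blast
qed

text \<open>The curve is unramified over the \<open>x\<close>-line: an element \<open>a\<close> of the maximal ideal divides
  \<open>a - a\<^sup>Q\<close>, which is a multiple of \<open>P(x)\<close>, with a unit as quotient.\<close>

lemma finite_place_discrete:
  assumes V: "V \<in> places \<iota>" and xV: "x \<in> V"
  obtains t where "t \<in> max_ideal V" "t \<noteq> 0"
    "\<And>z. z \<noteq> 0 \<Longrightarrow> \<exists>k. valuation_ring.sim V z (t powi k)"
proof -
  interpret valuation_ring V using V by (rule place_valuation_ring)
  have AV: "A \<subseteq> V" using assms by (rule coordinate_ring_subset_place)
  obtain P where P: "P \<noteq> 0" "prime_elem P" "\<And>D. K.hev x D \<in> max_ideal V \<longleftrightarrow> P dvd D"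
    using finite_place_prime[OF assms] by blast
  define t where "t = K.hev x P"
  have t: "t \<in> max_ideal V" "t \<noteq> 0" using P hev_x_eq_0_iff by (auto simp: t_def)
  obtain e where e: "e > 0" "\<And>a. a \<in> A \<Longrightarrow> \<exists>c\<in>A. a ^ (p ^ e) - a = t * c"
    using frobenius_periodic[OF P(2)] unfolding t_def by blast
  \<comment> \<open>The exponent \<open>l\<close> in the product with the cofactor \<open>c\<close>
    bounds how often \<open>t\<close> splits off \<open>b\<close>. It replaces the value of
    \<open>b\<close>, which is not yet known to exist, as induction measure.\<close>
  have factor: "\<exists>k u. unt u \<and> b = t ^ k * u"
    if "b \<in> A" "c \<in> A" "b * c = t ^ l * d" "d \<in> A" "unt d" for b c d l
    using that
  proof (induction l arbitrary: b d)
    case 0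
    have "unt b"
    proof (rule ccontr)
      assume "\<not> unt b"
      then have "b \<in> max_ideal V" using 0 AV by (auto simp: unt_iff)
      then have "b * c \<in> max_ideal V" using 0 AV max_ideal_mult by auto
      then show False using 0 by (simp add: unt_iff)
    qed
    then show ?case by (intro exI[of _ 0] exI[of _ b]) simp
  next
    case (Suc l)
    show ?case
    proof (cases "unt b")
      case True
      then show ?thesis by (intro exI[of _ 0] exI[of _ b]) simp
    next
      case False
      then have bm: "b \<in> max_ideal V" using Suc.prems AV by (auto simp: unt_iff)
      define v where "v = b ^ (p ^ e - 1) - 1"
      have "1 < p ^ e" using e(1) p(1) prime_gt_1_nat by (metis one_less_power)
      then have "b ^ (p ^ e - 1) \<in> max_ideal V" using bm max_ideal_power by simp
      then have v: "unt v" using unt_add[of "- 1" "b ^ (p ^ e - 1)"] one_mem uminus_mem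
        by (simp add: v_def unt_def)
      have vA: "v \<in> A" unfolding v_def using Suc.prems by (intro A.diff_mem A.power_mem A.one_mem)
      have "b ^ (p ^ e - 1) * b = b ^ (p ^ e)"
        using \<open>1 < p ^ e\<close> by (metis less_trans power_minus_mult zero_less_one)
      then have bv: "b * v = b ^ (p ^ e) - b" by (simp add: v_def algebra_simps)
      then obtain b' where b': "b' \<in> A" "b * v = t * b'" using e(2) Suc.prems by metis
      have "t * (b' * c) = t * (t ^ l * (v * d))"
      proof -
        have "t * (b' * c) = (b * v) * c" by (simp add: b'(2))
        also have "\<dots> = (b * c) * v" by (simp add: mult_ac)
        finally show ?thesis by (simp add: Suc.prems(3) mult_ac)
      qed
      then have "b' * c = t ^ l * (v * d)" using t by simp
      then obtain k u where "unt u" "b' = t ^ k * u"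
        using Suc.IH[OF b'(1) Suc.prems(2)] A.mult_mem vA Suc.prems(4,5) v unt_mult by blast
      then have "b * v = t ^ Suc k * u" using b'(2) by simp
      then have "b = t ^ Suc k * (u * inverse v)" using v by (auto simp: unt_def field_simps)
      then show ?thesis using unt_mult[OF \<open>unt u\<close> unt_inverse[OF v]] by blast
    qed
  qed
  have split: "\<exists>l d. D = P ^ l * d \<and> \<not> P dvd d" if "D \<noteq> 0" for D
    using that
  proof (induction "degree D" arbitrary: D rule: less_induct)
    case less
    show ?case
    proof (cases "P dvd D")
      case True
      then obtain D' where D': "D = P * D'" by auto
      have "degree P > 0" using P(1,2) by (metis is_unit_iff_degree neq0_conv prime_elem_def)
      then have "degree D' < degree D" using D' less.prems by (auto simp: degree_mult_eq)
      then obtain l d where "D' = P ^ l * d \<and> \<not> P dvd d" using less.hyps[of D'] less.prems D' by auto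
      then show ?thesis using D' by (intro exI[of _ "Suc l"] exI[of _ d]) auto
    qed (auto intro: exI[of _ 0])
  qed
  have sim: "\<exists>k::int. sim b (t powi k)" if "b \<in> A" "b \<noteq> 0" for b
  proof -
    obtain c D where c: "c \<in> A" "D \<noteq> 0" "b * c = K.hev x D" using dvd_hev_x \<open>b \<in> A\<close> \<open>b \<noteq> 0\<close> by metis
    obtain l d where d: "D = P ^ l * d" "\<not> P dvd d" using split c(2) by blast
    then have "unt (K.hev x d)" using P(3) hev_x_mem[of d] AV by (auto simp: unt_iff)
    then obtain k u where "unt u" "b = t ^ k * u"
      using factor[OF \<open>b \<in> A\<close> c(1), of l "K.hev x d"] c(3) d hev_x_mem
      by (auto simp: K.hev_mult K.hev_power t_def)
    then show ?thesis using t sim_unt_mult[of u "t ^ k"]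
      by (intro exI[of _ "int k"]) (simp add: mult.commute)
  qed
  have "\<exists>k. sim z (t powi k)" if "z \<noteq> 0" for z
  proof -
    obtain a b where ab: "a \<in> A" "b \<in> A" "b \<noteq> 0" "z = a / b" using fraction by blast
    then have "a \<noteq> 0" using \<open>z \<noteq> 0\<close> by auto
    then obtain k l where "sim a (t powi k)" "sim b (t powi l)" using sim ab by blast
    then have "sim z (t powi (k - l))"
      using sim_mult[OF _ sim_inverse] t ab by (simp add: divide_inverse power_int_diff)
    then show ?thesis by blast
  qed
  then show ?thesis using that t by blast
qed

text \<open>The primes of a denominator D(x) are stripped off one at a time. If t = P(x) and t w
  lies in A, regularity makes \<open>w\<close> integral over A, so a power of t w lies in t A. But
  A/tA is reduced, because a Frobenius power is the identity on it; hence t w lies in t A and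
  \<open>w\<close> in A.\<close>

lemma mem_A_if_regular:
  assumes reg: "\<And>V. V \<in> places \<iota> \<Longrightarrow> x \<in> V \<Longrightarrow> z \<in> V"
  shows "z \<in> A"
proof -
  have "\<forall>z. (\<forall>V\<in>places \<iota>. x \<in> V \<longrightarrow> z \<in> V) \<longrightarrow> (\<exists>a\<in>A. K.hev x D * z = a) \<longrightarrow> z \<in> A" if "D \<noteq> 0" for D
    using that
  proof (induction "degree D" arbitrary: D rule: less_induct)
    case less
    show ?case
    proof (intro allI impI)
      fix z assume z: "\<forall>V\<in>places \<iota>. x \<in> V \<longrightarrow> z \<in> V" and a: "\<exists>a\<in>A. K.hev x D * z = a"
      show "z \<in> A"
      proof (cases "degree D = 0")
        case True
        then obtain c where "D = [:c:]" using degree_eq_zeroE by blast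
        then have "\<iota> c * z \<in> A" "c \<noteq> 0" using a less.prems by auto
        then have "\<iota> (inverse c) * (\<iota> c * z) \<in> A" using A.mult_mem iota_mem by blast
        then show ?thesis using \<open>c \<noteq> 0\<close>
          by (simp add: iota_inverse iota_eq_0_iff flip: mult.assoc)
      next
        case False
        then obtain P where P: "prime_elem P" "degree P > 0" "P dvd D"
          using exists_irreducible_factor by (metis neq0_conv)
        then obtain D' where D': "D = P * D'" by auto
        define t where "t = K.hev x P"
        have t: "t \<noteq> 0" using P hev_x_eq_0_iff by (auto simp: t_def)
        obtain e where e: "e > 0" "\<And>a. a \<in> A \<Longrightarrow> \<exists>c\<in>A. a ^ (p ^ e) - a = t * c"
          using frobenius_periodic[OF P(1)] unfolding t_def by blast
        define w where "w = K.hev x D' * z"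
        have tw: "t * w \<in> A" using a by (auto simp: w_def t_def D' K.hev_mult mult.assoc)
        have w: "w \<in> V" if "V \<in> places \<iota>" "x \<in> V" for V
        proof -
          interpret valuation_ring V using that(1) by (rule place_valuation_ring)
          show ?thesis unfolding w_def
            using that z coordinate_ring_subset_place hev_x_mem by (intro mult_mem) auto
        qed
        have "w \<in> A"
        proof (cases "w = 0")
          case False
          \<comment> \<open>A relation w = f(1/w) over A is an integral equation for
            \<open>w\<close>. Without one, some place would contain A but not
            \<open>w\<close>.\<close>
          have "w \<in> A.adjoin (inverse w)"
          proof (rule ccontr)
            assume n: "w \<notin> A.adjoin (inverse w)"
            obtain V where V: "valuation_ring V" "A.adjoin (inverse w) \<subseteq> V" "w \<notin> V"
              using field_subring.exists_valuation_ring_avoiding[OF A.field_subring_adjoin A.mem_adjoin n] .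
            have AV: "A \<subseteq> V" using V(2) A.subset_adjoin by blast
            interpret valuation_ring V by (rule V)
            have "V \<in> places \<iota>"
              unfolding places_def using AV V(3) iota_mem one_mem zero_mem total diff_mem mult_mem
            proof (intro CollectI conjI ballI allI psubsetI)
              show "range \<iota> \<noteq> V"
              proof
                assume *: "range \<iota> = V"
                then obtain c where "x = \<iota> c" using AV x_mem by blast
                then have "K.hev x [:- c, 1:] = 0" by (simp add: K.hev_pCons K.hom_uminus K.hom_1)
                then show False by (simp only: hev_x_eq_0_iff) simp
              qed
            qed auto
            then show False using w AV x_mem V(3) by blast
          qed
          then obtain f where f: "w = poly f (inverse w)" "\<And>i. coeff f i \<in> A"
            by (auto simp: A.adjoin_def)
          define k where "k = degree f"
          have "(t * w) ^ Suc k = t ^ Suc k * w ^ k * w" by (simp add: power_mult_distrib mult_ac)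
          also have "\<dots> = t ^ Suc k * w ^ k * (\<Sum>i\<le>k. coeff f i * inverse w ^ i)"
            using f(1) unfolding poly_altdef k_def by simp
          also have "\<dots> = (\<Sum>i\<le>k. t * (coeff f i * t ^ i * (t * w) ^ (k - i)))"
            unfolding sum_distrib_left
          proof (rule sum.cong)
            fix i assume "i \<in> {..k}"
            then have "w ^ k = w ^ (k - i) * w ^ i" "t ^ k = t ^ (k - i) * t ^ i" by (simp_all flip: power_add)
            then show "t ^ Suc k * w ^ k * (coeff f i * inverse w ^ i) = t * (coeff f i * t ^ i * (t * w) ^ (k - i))"
              using False by (simp add: power_inverse power_mult_distrib mult_ac)
          qed simp
          also have "\<dots> = t * (\<Sum>i\<le>k. coeff f i * t ^ i * (t * w) ^ (k - i))"
            by (simp add: sum_distrib_left)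
          finally obtain s where s: "s \<in> A" "(t * w) ^ Suc k = t * s"
            using f(2) tw hev_x_mem[of P] unfolding t_def[symmetric]
            by (metis (no_types, lifting) A.mult_mem A.power_mem A.sum_mem)
          \<comment> \<open>A single exponent p^e may be smaller than the exponent k + 1 for which a
            power of t w is known to lie in t A; p^(e (k + 1)) is large enough.\<close>
          have iter: "\<exists>c\<in>A. (t * w) ^ (p ^ (e * j)) - t * w = t * c" for j
          proof (induction j)
            case 0
            then show ?case using A.zero_mem by (intro bexI[of _ 0]) auto
          next
            case (Suc j)
            obtain c where c: "c \<in> A" "(t * w) ^ (p ^ (e * j)) - t * w = t * c" using Suc by blast
            obtain d where d: "d \<in> A" "((t * w) ^ (p ^ (e * j))) ^ (p ^ e) - (t * w) ^ (p ^ (e * j)) = t * d"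
              using e(2) A.power_mem[OF tw] by blast
            have "(t * w) ^ (p ^ (e * Suc j)) = ((t * w) ^ (p ^ (e * j))) ^ (p ^ e)"
              by (simp add: power_add mult.commute flip: power_mult)
            then have "(t * w) ^ (p ^ (e * Suc j)) - t * w = t * (d + c)"
              using c(2) d(2) unfolding distrib_left by (metis add_diff_eq diff_add_cancel)
            then show ?case using A.add_mem c d by blast
          qed
          obtain c where c: "c \<in> A" "(t * w) ^ (p ^ (e * Suc k)) - t * w = t * c" using iter by blast
          have "Suc k < p ^ Suc k" using less_exp[of "Suc k"] power_mono[of 2 p "Suc k"] p(1) prime_ge_2_nat
            by (meson less_le_trans zero_le_numeral)
          also have "p ^ Suc k \<le> p ^ (e * Suc k)" using e(1) p(1) prime_ge_1_nat by (intro power_increasing) (cases e; auto)+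
          finally have "(t * w) ^ (p ^ (e * Suc k)) = (t * w) ^ Suc k * (t * w) ^ (p ^ (e * Suc k) - Suc k)"
            by (metis le_add_diff_inverse less_imp_le power_add)
          then have "(t * w) ^ (p ^ (e * Suc k)) = t * s * (t * w) ^ (p ^ (e * Suc k) - Suc k)"
            using s(2) by simp
          moreover have "t * w = (t * w) ^ (p ^ (e * Suc k)) - t * c"
          proof -
            have "a - b = d \<Longrightarrow> b = a - d" for a b d :: 'f by (simp add: algebra_simps)
            then show ?thesis using c(2) by blast
          qed
          ultimately have "t * w = t * s * (t * w) ^ (p ^ (e * Suc k) - Suc k) - t * c" by argo
          also have "\<dots> = t * (s * (t * w) ^ (p ^ (e * Suc k) - Suc k) - c)"
            by (simp only: right_diff_distrib mult.assoc)
          finally have "t * w = t * (s * (t * w) ^ (p ^ (e * Suc k) - Suc k) - c)" .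
          then have "w = s * (t * w) ^ (p ^ (e * Suc k) - Suc k) - c" using t by simp
          then show ?thesis using s c tw by (metis A.diff_mem A.mult_mem A.power_mem)
        qed (simp add: A.zero_mem)
        moreover have "degree D' < degree D" "D' \<noteq> 0" using P less.prems D' by (auto simp: degree_mult_eq)
        ultimately show ?thesis using less.hyps[of D'] z w_def by blast
      qed
    qed
  qed
  moreover obtain D where "D \<noteq> 0" "K.hev x D * z \<in> A"
  proof -
    obtain a b where ab: "a \<in> A" "b \<in> A" "b \<noteq> 0" "z = a / b" using fraction by blast
    obtain c D where c: "c \<in> A" "D \<noteq> 0" "b * c = K.hev x D" using dvd_hev_x ab by metis
    have "K.hev x D * z = a * c" using ab by (simp flip: c(3))
    then show ?thesis using that c(2) ab c(1) A.mult_mem by simp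
  qed
  ultimately show ?thesis using reg by blast
qed

end

text \<open>By transcendence \<open>x\<close> does not lie in K[1/x], so some valuation ring
  contains K[1/x] but not \<open>x\<close>.\<close>

lemma (in plane_curve) exists_infinite_place:
  obtains V where "V \<in> places \<iota>" "x \<notin> V"
proof -
  let ?B = "range (K.hev (inverse x))"
  interpret B: field_subring ?B
  proof
    show "1 \<in> ?B" by (rule image_eqI[of _ _ "[:1:]"]) (auto simp: K.hom_1)
  next
    fix a b assume "a \<in> ?B" "b \<in> ?B"
    then show "a - b \<in> ?B" "a * b \<in> ?B" by (auto simp flip: K.hev_diff K.hev_mult)
  qed
  have x0: "x \<noteq> 0" using hev_x_eq_0_iff[of "[:0, 1:]"] by simp
  have xB: "x \<notin> ?B"
  proof
    assume "x \<in> ?B"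
    then obtain D where D: "x = K.hev (inverse x) D" by blast
    define d where "d = degree D"
    \<comment> \<open>The reversed polynomial x^d D(1/x), of degree at most d, while x * x^d has
      degree d + 1.\<close>
    define E where "E = (\<Sum>i\<le>d. monom (coeff D i) (d - i))"
    have "x * x ^ d = (\<Sum>i\<le>d. \<iota> (coeff D i) * inverse x ^ i) * x ^ d"
      using D unfolding K.hev_altdef d_def by simp
    also have "\<dots> = K.hev x E"
      unfolding E_def K.hev_sum K.hev_monom sum_distrib_right
    proof (rule sum.cong)
      fix i assume "i \<in> {..d}"
      then have "x ^ d = x ^ (d - i) * x ^ i" by (simp flip: power_add)
      then show "\<iota> (coeff D i) * inverse x ^ i * x ^ d = \<iota> (coeff D i) * x ^ (d - i)"
        using x0 by (simp add: power_inverse)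
    qed simp
    finally have "K.hev x (monom 1 (Suc d) - E) = 0" by (simp add: K.hev_diff K.hev_monom K.hom_1)
    then have "E = monom 1 (Suc d)" by (simp add: hev_x_eq_0_iff)
    moreover have "degree E \<le> d"
      unfolding E_def by (intro degree_sum_le) (auto intro: order.trans[OF degree_monom_le])
    ultimately show False by (simp add: degree_monom_eq)
  qed
  have "inverse x \<in> ?B" by (rule image_eqI[of _ _ "[:0, 1:]"]) auto
  then obtain V where V: "valuation_ring V" "?B \<subseteq> V" "x \<notin> V"
    using B.exists_valuation_ring_avoiding xB by blast
  interpret valuation_ring V by (rule V)
  have "\<iota> c \<in> V" for c using V(2) K.hev_const[of "inverse x" c] by (metis rangeI subsetD)
  moreover have "range \<iota> \<noteq> V"
  proof
    assume *: "range \<iota> = V"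
    then obtain c where c: "inverse x = \<iota> c" using \<open>inverse x \<in> ?B\<close> V(2) by blast
    then have "x = \<iota> (inverse c)" by (metis iota_inverse inverse_inverse_eq)
    then show False using * V(3) by blast
  qed
  ultimately have "V \<in> places \<iota>"
    unfolding places_def using V(3) total diff_mem mult_mem by auto
  then show ?thesis using that V(3) by blast
qed

section \<open>The place at infinity\<close>

text \<open>The numbers \<open>\<mu> j\<close> form the Apery set of \<open>H\<close> with respect
  to \<open>e\<close>: the least elements of the residue classes. With F =
  \<open>\<mu> (e - 1) - e\<close>, the duality \<open>sym\<close> makes k -> F - k exchange the
  gaps and the elements of \<open>H\<close> up to F, so there are equally many of both. The
  assumption \<open>le\<close> keeps the subtraction in F from being truncated.\<close>

lemma symmetric_semigroupI:
  fixes \<mu> :: "nat \<Rightarrow> nat"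
  assumes e: "e > 0" and inj: "inj_on (\<lambda>j. \<mu> j mod e) {..<e}"
    and sym: "\<And>j. j < e \<Longrightarrow> \<mu> j + \<mu> (e - 1 - j) = \<mu> (e - 1)"
    and le: "e \<le> \<mu> (e - 1)"
    and H: "H = {i * e + \<mu> j | i j. j < e}"
  shows "symmetric_semigroup H"
proof -
  define F where "F = \<mu> (e - 1) - e"
  \<comment> \<open>With an integer coefficient i every k has the form i e + \<open>\<mu> j\<close>;
    the gaps are the k with i negative.\<close>
  have mem: "k \<in> H \<longleftrightarrow> i \<ge> 0" if "int k = i * int e + int (\<mu> j)" "j < e" for k i j
  proof
    assume "k \<in> H"
    then obtain i' j' where k: "k = i' * e + \<mu> j'" "j' < e" using H by auto
    have "int k mod int e = int (\<mu> j) mod int e" unfolding that(1) by simp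
    moreover have "int k mod int e = int (\<mu> j') mod int e" unfolding k(1) by simp
    ultimately have "\<mu> j mod e = \<mu> j' mod e" by (simp flip: zmod_int)
    then have "j = j'" using inj_onD[OF inj, of j j'] that(2) k(2) by simp
    then have "i = int i'" using that(1) k e by simp
    then show "i \<ge> 0" by simp
  next
    assume "i \<ge> 0"
    then have "k = nat i * e + \<mu> j" using that(1)
      by (metis int_nat_eq nat_int of_nat_add of_nat_mult)
    then show "k \<in> H" using H that(2) by blast
  qed
  have "(\<lambda>j. \<mu> j mod e) ` {..<e} = {..<e}"
    using e by (intro endo_inj_surj inj) auto
  then have ex: "\<exists>i j. int k = i * int e + int (\<mu> j) \<and> j < e" for k
  proof -
    have "k mod e \<in> (\<lambda>j. \<mu> j mod e) ` {..<e}"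
      using \<open>(\<lambda>j. \<mu> j mod e) ` {..<e} = {..<e}\<close> e by simp
    then obtain j where j: "j < e" "k mod e = \<mu> j mod e" by auto
    then have "int e dvd int k - int (\<mu> j)" by (metis mod_eq_dvd_iff zmod_int)
    then obtain i where "int k - int (\<mu> j) = int e * i" by auto
    then show ?thesis using j(1) by (intro exI[of _ i] exI[of _ j]) (simp add: algebra_simps)
  qed
  have dual: "int F - int k = (- 1 - i) * int e + int (\<mu> (e - 1 - j))"
    if "int k = i * int e + int (\<mu> j)" "j < e" for k i j
    using that le arg_cong[OF sym[OF that(2)], of int] by (simp add: F_def algebra_simps of_nat_diff)
  have "F \<notin> H" using mem[of F "- 1" "e - 1"] le e by (simp add: F_def of_nat_diff)
  have gap_le: "k \<le> F" if "k \<notin> H" for k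
  proof -
    obtain i j where ij: "int k = i * int e + int (\<mu> j)" "j < e" using ex by blast
    then have "- 1 - i \<ge> 0" using mem that by auto
    then have "0 \<le> (- 1 - i) * int e + int (\<mu> (e - 1 - j))"
      by (intro add_nonneg_nonneg mult_nonneg_nonneg) auto
    then show ?thesis using dual[OF ij] by linarith
  qed
  have flip: "F - k \<in> H \<longleftrightarrow> k \<notin> H" if "k \<le> F" for k
  proof -
    obtain i j where ij: "int k = i * int e + int (\<mu> j)" "j < e" using ex by blast
    then show ?thesis
      using mem[OF ij] mem[of "F - k" "- 1 - i" "e - 1 - j"] dual[OF ij] that e by (auto simp: of_nat_diff)
  qed
  have "bij_betw (\<lambda>k. F - k) (- H) (H \<inter> {..F})"
  proof (rule bij_betwI[where g = "\<lambda>k. F - k"])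
    show "(\<lambda>k. F - k) \<in> - H \<rightarrow> H \<inter> {..F}"
    proof
      fix k assume "k \<in> - H"
      then show "F - k \<in> H \<inter> {..F}" using flip[of k] gap_le[of k] by simp
    qed
    show "(\<lambda>k. F - k) \<in> H \<inter> {..F} \<rightarrow> - H"
    proof
      fix k assume "k \<in> H \<inter> {..F}"
      then show "F - k \<in> - H" using flip[of k] by simp
    qed
    show "F - (F - k) = k" if "k \<in> - H" for k using gap_le[of k] that by simp
    show "F - (F - k) = k" if "k \<in> H \<inter> {..F}" for k using that by simp
  qed
  then have card: "card (H \<inter> {..F}) = card (- H)" by (metis bij_betw_same_card)
  have "- H \<subseteq> {..F}" using gap_le by blast
  then have "finite (- H)" by (rule finite_subset) simp
  then have "card (- H \<union> (H \<inter> {..F})) = card (- H) + card (H \<inter> {..F})"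
    by (intro card_Un_disjoint) auto
  moreover have "- H \<union> (H \<inter> {..F}) = {..F}" using gap_le by auto
  ultimately have "card {..F} = card (- H) + card (H \<inter> {..F})" by simp
  then have "int F = 2 * int (card (- H)) - 1" using card by simp
  then show ?thesis using \<open>F \<notin> H\<close> gap_le unfolding symmetric_semigroup_def by blast
qed

text \<open>Nonzero constants are units at every place, so at a pole of \<open>z\<close> the leading
  term dominates.\<close>

lemma (in plane_curve) sim_hev:
  assumes V: "V \<in> places \<iota>" and z: "z \<notin> V" and "D \<noteq> 0"
  shows "valuation_ring.sim V (K.hev z D) (z ^ degree D)"
proof -
  interpret valuation_ring V using V by (rule place_valuation_ring)
  have z0: "z \<noteq> 0" using z zero_mem by auto
  have iz: "inverse z \<in> max_ideal V" using z by (rule not_mem_inverse)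
  show ?thesis
    using assms(3)
  proof (induction D)
    case (pCons c D)
    show ?case
    proof (cases "D = 0")
      case True
      then have "c \<noteq> 0" using pCons by auto
      then have "unt (\<iota> c)" using iota_mem_place[OF V] iota_inverse[of c]
        by (metis iota_eq_0_iff unt_def)
      then show ?thesis using True \<open>c \<noteq> 0\<close> by (simp add: sim_def iota_eq_0_iff)
    next
      case False
      then have s: "sim (z * K.hev z D) (z ^ degree (pCons c D))"
        using pCons sim_mult[OF sim_refl[OF z0]] by simp
      then have "sim (inverse (z * K.hev z D)) (inverse (z ^ degree (pCons c D)))" by (rule sim_inverse)
      moreover have "inverse (z ^ degree (pCons c D)) \<in> max_ideal V"
        using max_ideal_power[OF iz, of "degree (pCons c D)"] False by (simp add: power_inverse)
      ultimately have "inverse (z * K.hev z D) \<in> max_ideal V" by (simp add: sim_max_ideal_iff)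
      then have "inverse (z * K.hev z D) * \<iota> c \<in> max_ideal V"
        using iota_mem_place[OF V] by (rule max_ideal_mult)
      then have "\<iota> c / (z * K.hev z D) \<in> max_ideal V" by (metis divide_inverse mult.commute)
      then have "sim (z * K.hev z D + \<iota> c) (z * K.hev z D)"
        using sim_nonzero(1)[OF s] by (rule sim_add[rotated])
      then have "sim (z * K.hev z D + \<iota> c) (z ^ degree (pCons c D))" using s by (rule sim_trans)
      then show ?thesis by (simp add: K.hev_pCons add.commute)
    qed
  qed simp
qed

text \<open>A \<open>K[x]\<close>-basis \<open>B\<close> of the coordinate ring. Since \<open>x\<close> will have pole order \<open>e\<close>, the assumption
  \<open>B_sim\<close> says that \<open>B j\<close> has pole order \<open>\<mu> j\<close>, before any valuation is known to exist.\<close>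

locale infinite_basis = frobenius_curve \<iota> x y G p m h0
  for \<iota> :: "'a::{field,finite} \<Rightarrow> 'f::field" and x y G p m h0 +
  fixes e :: nat and B :: "nat \<Rightarrow> 'f" and \<mu> :: "nat \<Rightarrow> nat" and d :: nat
  assumes e_pos: "e > 0"
    and B_mem: "\<And>j. j < e \<Longrightarrow> B j \<in> A"
    and span: "\<And>a. a \<in> A \<Longrightarrow> \<exists>c. a = (\<Sum>j<e. K.hev x (c j) * B j)"
    and inj: "inj_on (\<lambda>j. \<mu> j mod e) {..<e}"
    and B_sim: "\<And>V j. V \<in> places \<iota> \<Longrightarrow> x \<notin> V \<Longrightarrow> j < e \<Longrightarrow> valuation_ring.sim V (B j ^ e) (x ^ \<mu> j)"
    and coprime: "\<exists>j<e. coprime (\<mu> j) e"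
    and y_sim: "\<And>V. V \<in> places \<iota> \<Longrightarrow> x \<notin> V \<Longrightarrow> valuation_ring.sim V (y ^ e) (x ^ d)"
    and e_less_d: "e < d"
begin

text \<open>The pole order is read off the coefficients, hence the same for every place with a pole of \<open>x\<close>;
  this makes such a place unique.\<close>

definition pole_order :: "'f \<Rightarrow> int" where
  "pole_order a = (let c = (SOME c. a = (\<Sum>j<e. K.hev x (c j) * B j)) in
     - Min ((\<lambda>j. - int (degree (c j) * e + \<mu> j)) ` {j. j < e \<and> c j \<noteq> 0}))"

text \<open>For an index i with \<open>\<mu> i\<close> coprime to \<open>e\<close>, Bezout gives a
  monomial in \<open>x\<close> and \<open>B i\<close> whose \<open>e\<close>-th power is 1/x up to a
  unit. In terms of it the fractional comparisons of \<open>B_sim\<close> become integral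
  orders.\<close>

lemma infinite_uniformizer:
  assumes V: "V \<in> places \<iota>" and xV: "x \<notin> V"
  obtains t where "t \<in> max_ideal V" "t \<noteq> 0" "valuation_ring.sim V x (t powi (- int e))"
    "\<And>j. j < e \<Longrightarrow> valuation_ring.sim V (B j) (t powi (- int (\<mu> j)))"
proof -
  interpret valuation_ring V using V by (rule place_valuation_ring)
  have x0: "x \<noteq> 0" using xV zero_mem by auto
  obtain i where i: "i < e" "coprime (\<mu> i) e" using coprime by blast
  have Bi: "sim (B i ^ e) (x ^ \<mu> i)" using B_sim V xV i by blast
  obtain a b where ab: "a * int e + b * int (\<mu> i) = - 1"
  proof -
    have "gcd (int e) (int (\<mu> i)) = 1" using i(2) by (simp add: coprime_commute flip: gcd_int_int_eq)
    then obtain a b where "a * int e + b * int (\<mu> i) = 1" using bezout_int by metis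
    then have "(- a) * int e + (- b) * int (\<mu> i) = - 1" by simp
    then show ?thesis using that by blast
  qed
  define t where "t = x powi a * B i powi b"
  have B0: "B i \<noteq> 0" using sim_nonzero(1)[OF Bi] e_pos by auto
  have t0: "t \<noteq> 0" using x0 B0 by (simp add: t_def)
  have "t ^ e = x powi (a * int e) * (B i ^ e) powi b"
    by (simp add: t_def power_mult_distrib power_int_power power_int_power' mult.commute)
  moreover have "sim \<dots> (x powi (a * int e) * (x ^ \<mu> i) powi b)"
    using Bi x0 by (intro sim_mult sim_powi sim_refl) auto
  moreover have "x powi (a * int e) * (x ^ \<mu> i) powi b = x powi (- 1)"
    using x0 by (simp add: power_int_power mult.commute flip: power_int_add ab)
  ultimately have te: "sim (t ^ e) (inverse x)" by (simp add: power_int_minus)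
  then have "t ^ e \<in> max_ideal V" using not_mem_inverse[OF xV] sim_max_ideal_iff by blast
  then have t: "t \<in> max_ideal V" using max_ideal_powerD e_pos by blast
  have xt: "sim x (t powi (- int e))"
    using sim_inverse[OF sim_sym[OF te]] by (simp add: power_int_minus)
  have "sim (B j) (t powi (- int (\<mu> j)))" if "j < e" for j
  proof -
    have "sim (x ^ \<mu> j) ((t powi (- int e)) ^ \<mu> j)" using xt by (rule sim_power)
    also have "(t powi (- int e)) ^ \<mu> j = (t powi (- int (\<mu> j))) ^ e"
      by (simp add: power_int_power' mult.commute power_int_minus power_inverse flip: power_mult)
    finally show ?thesis using B_sim[OF V xV that] sim_trans sim_powerD e_pos by blast
  qed
  then show ?thesis using that t t0 xt by blast
qed

text \<open>The terms of the expansion have orders \<open>degree (c j) * e + \<mu> j\<close>,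
  pairwise incongruent modulo \<open>e\<close>, so nothing cancels.\<close>

lemma pole_order:
  assumes "a \<in> A" "a \<noteq> 0"
  shows "\<exists>i j. j < e \<and> pole_order a = int (i * e + \<mu> j)"
    and "\<lbrakk>V \<in> places \<iota>; x \<notin> V; t \<in> max_ideal V; t \<noteq> 0; valuation_ring.sim V x (t powi (- int e));
      \<And>j. j < e \<Longrightarrow> valuation_ring.sim V (B j) (t powi (- int (\<mu> j)))\<rbrakk>
      \<Longrightarrow> valuation_ring.sim V a (t powi (- pole_order a))"
proof -
  define c where "c = (SOME c. a = (\<Sum>j<e. K.hev x (c j) * B j))"
  have c: "a = (\<Sum>j<e. K.hev x (c j) * B j)" unfolding c_def using someI_ex[OF span[OF assms(1)]] .
  define S where "S = {j. j < e \<and> c j \<noteq> 0}"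
  define k where "k j = - int (degree (c j) * e + \<mu> j)" for j
  have aS: "a = (\<Sum>j\<in>S. K.hev x (c j) * B j)"
    unfolding c S_def by (rule sum.mono_neutral_right) auto
  have "S \<noteq> {}"
  proof
    assume "S = {}"
    then show False using aS assms(2) by simp
  qed
  then have S: "finite S" "S \<noteq> {}" by (auto simp: S_def)
  have po: "pole_order a = - Min (k ` S)" by (simp add: pole_order_def k_def S_def c_def Let_def)
  obtain j where "j \<in> S" "Min (k ` S) = k j" using Min_in[of "k ` S"] S by fastforce
  then show "\<exists>i j. j < e \<and> pole_order a = int (i * e + \<mu> j)"
    by (intro exI[of _ "degree (c j)"] exI[of _ j]) (simp add: po k_def S_def)
  have injk: "inj_on k S"
  proof (rule inj_onI)
    fix i j assume ij: "i \<in> S" "j \<in> S" "k i = k j"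
    then have "degree (c i) * e + \<mu> i = degree (c j) * e + \<mu> j"
      unfolding k_def by (metis neg_equal_iff_equal of_nat_eq_iff)
    then have "\<mu> i mod e = \<mu> j mod e" by (metis mod_mult_self3)
    then show "i = j" using inj_onD[OF inj, of i j] ij by (simp add: S_def)
  qed
  assume V: "V \<in> places \<iota>" "x \<notin> V" and t: "t \<in> max_ideal V" "t \<noteq> 0"
    and x: "valuation_ring.sim V x (t powi (- int e))"
    and B: "\<And>j. j < e \<Longrightarrow> valuation_ring.sim V (B j) (t powi (- int (\<mu> j)))"
  interpret valuation_ring V using V(1) by (rule place_valuation_ring)
  have "sim (K.hev x (c j) * B j) (t powi (k j))" if "j \<in> S" for j
  proof -
    have "sim (K.hev x (c j)) (x ^ degree (c j))" using sim_hev V that by (simp add: S_def)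
    moreover have "sim (x ^ degree (c j)) ((t powi (- int e)) ^ degree (c j))" using x by (rule sim_power)
    ultimately have "sim (K.hev x (c j)) (t powi (- int (degree (c j) * e)))"
      using sim_trans[of "K.hev x (c j)" "x ^ degree (c j)"] by (simp add: power_int_power' mult.commute)
    then have "sim (K.hev x (c j) * B j) (t powi (- int (degree (c j) * e)) * t powi (- int (\<mu> j)))"
      using B that by (intro sim_mult) (auto simp: S_def)
    then show ?thesis using t(2) by (simp add: k_def flip: power_int_add)
  qed
  then have "sim (\<Sum>j\<in>S. K.hev x (c j) * B j) (t powi Min (k ` S))"
    by (intro sim_powi_sum[OF t S _ injk])
  then show "sim a (t powi (- pole_order a))" by (simp add: po flip: aS)
qed

lemma infinite_place_unique:
  assumes "V \<in> places \<iota>" "x \<notin> V" "V' \<in> places \<iota>" "x \<notin> V'"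
  shows "V \<subseteq> V'"
proof
  fix z assume z: "z \<in> V"
  have *: "z \<in> W \<longleftrightarrow> pole_order a \<le> pole_order b"
    if W: "W \<in> places \<iota>" "x \<notin> W" and ab: "a \<in> A" "b \<in> A" "a \<noteq> 0" "b \<noteq> 0" "z = a / b" for W a b
  proof -
    interpret valuation_ring W using W(1) by (rule place_valuation_ring)
    obtain t where t: "t \<in> max_ideal W" "t \<noteq> 0" "sim x (t powi (- int e))"
      "\<And>j. j < e \<Longrightarrow> sim (B j) (t powi (- int (\<mu> j)))" using infinite_uniformizer[OF W] by blast
    have "sim z (t powi (- pole_order a) * inverse (t powi (- pole_order b)))"
      unfolding ab(5) divide_inverse
      using pole_order(2)[OF _ _ W t] ab by (intro sim_mult sim_inverse)
    then have "sim z (t powi (- pole_order a + pole_order b))"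
      using t(2) by (metis minus_minus power_int_add power_int_minus)
    then show ?thesis using sim_powi_mem_iff[OF t(1,2)] by auto
  qed
  show "z \<in> V'"
  proof (cases "z = 0")
    case True
    then show ?thesis
      using valuation_ring.axioms(1)[OF place_valuation_ring[OF assms(3)]] field_subring.zero_mem by blast
  next
    case False
    obtain a b where ab: "a \<in> A" "b \<in> A" "b \<noteq> 0" "z = a / b" using fraction by blast
    then show ?thesis using *[of V a b] *[of V' a b] assms z False by auto
  qed
qed

text \<open>At a pole of \<open>x\<close> the inequality \<open>e < d\<close> makes \<open>y\<close>
  the dominant homogeneous coordinate, so 1/y is the scaling factor. Conversely, if \<open>x\<close>
  is regular, so is \<open>y\<close>, and no scaling factor in the maximal ideal can bring
  \<open>y\<close> to residue 1.\<close>

lemma lies_over_iff: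
  assumes V: "V \<in> places \<iota>"
  shows "lies_over \<iota> x y V (0, 1, 0) \<longleftrightarrow> x \<notin> V"
proof -
  interpret valuation_ring V using V by (rule place_valuation_ring)
  show ?thesis
  proof
    assume "lies_over \<iota> x y V (0, 1, 0)"
    then obtain l where l: "l * y - 1 \<in> max_ideal V" "l \<in> max_ideal V"
      by (auto simp: lies_over_def K.hom_1)
    show "x \<notin> V"
    proof
      assume "x \<in> V"
      then have "y \<in> V" using coordinate_ring_subset_place[OF V] y_mem by blast
      then have "l * y + - (l * y - 1) \<in> max_ideal V"
        using l by (intro max_ideal_add max_ideal_uminus max_ideal_mult)
      then show False using one_not_max_ideal by simp
    qed
  next
    assume xV: "x \<notin> V"
    then have x0: "x \<noteq> 0" using zero_mem by auto
    have ys: "sim (y ^ e) (x ^ d)" using y_sim V xV by blast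
    then have y0: "y \<noteq> 0" using sim_nonzero(1)[OF ys] e_pos by auto
    have im: "inverse (x ^ k) \<in> max_ideal V" if "k > 0" for k
      using max_ideal_power[OF not_mem_inverse[OF xV] that] by (simp add: power_inverse)
    have "inverse (y ^ e) \<in> max_ideal V"
      using sim_max_ideal_iff[OF sim_inverse[OF ys]] im e_less_d by simp
    then have 1: "inverse y \<in> max_ideal V"
      using max_ideal_powerD[of "inverse y" e] e_pos by (simp add: power_inverse)
    have "sim (x ^ e * inverse (y ^ e)) (x ^ e * inverse (x ^ d))"
      using x0 ys by (intro sim_mult sim_inverse sim_refl) auto
    also have "x ^ e * inverse (x ^ d) = inverse (x ^ (d - e))"
      using x0 e_less_d by (simp add: field_simps flip: power_add)
    finally have "x ^ e * inverse (y ^ e) \<in> max_ideal V"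
      using sim_max_ideal_iff im e_less_d by simp
    then have "x * inverse y \<in> max_ideal V"
      using max_ideal_powerD[of "x * inverse y" e] e_pos by (simp add: power_inverse power_mult_distrib)
    then show "lies_over \<iota> x y V (0, 1, 0)"
      using 1 y0 zero_max_ideal unfolding lies_over_def
      by (auto simp: K.hom_1 mult.commute intro!: exI[of _ "inverse y"])
  qed
qed

lemma P_infty_unique:
  "P_infty \<iota> x y \<in> places \<iota>" "x \<notin> P_infty \<iota> x y"
  "\<And>V. V \<in> places \<iota> \<Longrightarrow> x \<in> V \<longleftrightarrow> V \<noteq> P_infty \<iota> x y"
proof -
  obtain V where V: "V \<in> places \<iota>" "x \<notin> V" using exists_infinite_place by blast
  have "P_infty \<iota> x y = V"
    unfolding P_infty_def
  proof (rule the_equality)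
    show "V \<in> places \<iota> \<and> lies_over \<iota> x y V (0, 1, 0)" using V lies_over_iff by blast
  next
    fix W assume "W \<in> places \<iota> \<and> lies_over \<iota> x y W (0, 1, 0)"
    then show "W = V" using V lies_over_iff infinite_place_unique by blast
  qed
  then show "P_infty \<iota> x y \<in> places \<iota>" "x \<notin> P_infty \<iota> x y"
    "\<And>V. V \<in> places \<iota> \<Longrightarrow> x \<in> V \<longleftrightarrow> V \<noteq> P_infty \<iota> x y"
    using V infinite_place_unique by blast+
qed

text \<open>A function without poles outside P_infty is regular wherever \<open>x\<close> is, hence
  lies in A by \<open>mem_A_if_regular\<close>. Reading \<open>pole_coeff V z = 0\<close> as
  membership in \<open>V\<close> relies on discreteness, which is supplied for all places.\<close>

lemma weierstrass_semigroup_eq_pole_order: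
  "weierstrass_semigroup \<iota> (P_infty \<iota> x y) = {nat (pole_order a) | a. a \<in> A \<and> a \<noteq> 0}"
proof -
  let ?P = "P_infty \<iota> x y"
  interpret valuation_ring ?P using P_infty_unique(1) by (rule place_valuation_ring)
  obtain t where t: "t \<in> max_ideal ?P" "t \<noteq> 0" "sim x (t powi (- int e))"
    "\<And>j. j < e \<Longrightarrow> sim (B j) (t powi (- int (\<mu> j)))"
    using infinite_uniformizer[OF P_infty_unique(1,2)] by blast
  note pole = pole_order(2)[OF _ _ P_infty_unique(1,2) t]
  have discrete: "\<exists>k. sim z (t powi k)" if "z \<noteq> 0" for z
  proof -
    obtain a b where ab: "a \<in> A" "b \<in> A" "b \<noteq> 0" "z = a / b" using fraction by blast
    then have "a \<noteq> 0" using \<open>z \<noteq> 0\<close> by auto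
    then have "sim z (t powi (- pole_order a) * inverse (t powi (- pole_order b)))"
      unfolding ab(4) divide_inverse using ab pole by (intro sim_mult sim_inverse)
    then have "sim z (t powi (- pole_order a + pole_order b))"
      using t(2) by (metis minus_minus power_int_add power_int_minus)
    then show ?thesis by blast
  qed
  have pole_A: "pole_coeff ?P a = nat (pole_order a)" if "a \<in> A" "a \<noteq> 0" for a
    using valuation_discrete[OF t(1,2) discrete pole[OF that]] by (simp add: pole_coeff_def)
  have fin: "pole_coeff V z = 0 \<longleftrightarrow> z \<in> V" if "V \<in> places \<iota>" "V \<noteq> ?P" "z \<noteq> 0" for V z
  proof -
    have "x \<in> V" using P_infty_unique(3) that by blast
    then show ?thesis
      using finite_place_discrete[OF that(1)] that(3)
        valuation_ring.pole_coeff_eq_0_iff[OF place_valuation_ring[OF that(1)]] by metis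
  qed
  show ?thesis
  proof (intro equalityI subsetI)
    fix k assume "k \<in> weierstrass_semigroup \<iota> ?P"
    then obtain z where z: "z \<noteq> 0" "\<And>V. V \<in> places \<iota> \<Longrightarrow> pole_coeff V z = (if V = ?P then k else 0)"
      by (auto simp: weierstrass_semigroup_def)
    have "z \<in> A"
    proof (rule mem_A_if_regular)
      fix V assume "V \<in> places \<iota>" "x \<in> V"
      then have "V \<noteq> ?P" using P_infty_unique(3) by blast
      then show "z \<in> V" using fin[of V z] z \<open>V \<in> places \<iota>\<close> by simp
    qed
    moreover have "k = nat (pole_order z)"
      using z(2)[OF P_infty_unique(1)] pole_A[OF calculation z(1)] by simp
    ultimately show "k \<in> {nat (pole_order a) | a. a \<in> A \<and> a \<noteq> 0}" using z(1) by blast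
  next
    fix k assume "k \<in> {nat (pole_order a) | a. a \<in> A \<and> a \<noteq> 0}"
    then obtain a where a: "a \<in> A" "a \<noteq> 0" "k = nat (pole_order a)" by blast
    have "pole_coeff V a = (if V = ?P then k else 0)" if V: "V \<in> places \<iota>" for V
    proof (cases "V = ?P")
      case False
      then have "a \<in> V" using coordinate_ring_subset_place V P_infty_unique(3) a(1) by blast
      then show ?thesis using fin V False a(2) by simp
    qed (use pole_A a in simp)
    then show "k \<in> weierstrass_semigroup \<iota> ?P"
      using a(2) unfolding weierstrass_semigroup_def by blast
  qed
qed

text \<open>\<open>pole_order\<close> rests on an arbitrary choice of coefficients, so the value is
  not read off but obtained from uniqueness of the exponent of a uniformizer.\<close>

lemma pole_order_monomial:
  assumes "j < e"
  shows "x ^ i * B j \<in> A" "x ^ i * B j \<noteq> 0" "pole_order (x ^ i * B j) = int (i * e + \<mu> j)"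
proof -
  let ?P = "P_infty \<iota> x y"
  interpret valuation_ring ?P using P_infty_unique(1) by (rule place_valuation_ring)
  obtain t where t: "t \<in> max_ideal ?P" "t \<noteq> 0" "sim x (t powi (- int e))"
    "\<And>j. j < e \<Longrightarrow> sim (B j) (t powi (- int (\<mu> j)))"
    using infinite_uniformizer[OF P_infty_unique(1,2)] by blast
  have s: "sim (x ^ i * B j) ((t powi (- int e)) ^ i * t powi (- int (\<mu> j)))"
    using t assms by (intro sim_mult sim_power) auto
  have "(t powi (- int e)) ^ i * t powi (- int (\<mu> j)) = t powi (- int (i * e + \<mu> j))"
    using t(2) by (simp add: power_int_power' algebra_simps flip: power_int_add)
  with s have s': "sim (x ^ i * B j) (t powi (- int (i * e + \<mu> j)))" by simp
  show 1: "x ^ i * B j \<in> A" "x ^ i * B j \<noteq> 0"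
    using B_mem assms x_mem sim_nonzero(1)[OF s] by (auto intro: A.mult_mem A.power_mem)
  show "pole_order (x ^ i * B j) = int (i * e + \<mu> j)"
    using sim_powi_unique[OF t(1,2) s' pole_order(2)[OF 1 P_infty_unique(1,2) t]] by simp
qed

theorem weierstrass_semigroup_eq:
  "weierstrass_semigroup \<iota> (P_infty \<iota> x y) = {i * e + \<mu> j | i j. j < e}"
proof (intro equalityI subsetI)
  fix k assume "k \<in> weierstrass_semigroup \<iota> (P_infty \<iota> x y)"
  then obtain a where "a \<in> A" "a \<noteq> 0" "k = nat (pole_order a)"
    by (auto simp: weierstrass_semigroup_eq_pole_order)
  moreover obtain i j where "j < e" "pole_order a = int (i * e + \<mu> j)"
    using pole_order(1)[of a] calculation by blast
  ultimately have "k = i * e + \<mu> j" by (metis nat_int)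
  then show "k \<in> {i * e + \<mu> j | i j. j < e}" using \<open>j < e\<close> by blast
next
  fix k assume "k \<in> {i * e + \<mu> j | i j. j < e}"
  then obtain i j where "k = i * e + \<mu> j" "j < e" by blast
  then show "k \<in> weierstrass_semigroup \<iota> (P_infty \<iota> x y)"
    unfolding weierstrass_semigroup_eq_pole_order using pole_order_monomial[of j i]
    by (intro CollectI exI[of _ "x ^ i * B j"]) (simp del: of_nat_add of_nat_mult)
qed

text \<open>Closure under addition is not visible in the form i e + \<open>\<mu> j\<close>; it comes
  from multiplying functions.\<close>

lemma weierstrass_semigroup_add:
  assumes "k \<in> weierstrass_semigroup \<iota> (P_infty \<iota> x y)" "l \<in> weierstrass_semigroup \<iota> (P_infty \<iota> x y)"
  shows "k + l \<in> weierstrass_semigroup \<iota> (P_infty \<iota> x y)"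
proof -
  let ?P = "P_infty \<iota> x y"
  interpret valuation_ring ?P using P_infty_unique(1) by (rule place_valuation_ring)
  obtain t where t: "t \<in> max_ideal ?P" "t \<noteq> 0" "sim x (t powi (- int e))"
    "\<And>j. j < e \<Longrightarrow> sim (B j) (t powi (- int (\<mu> j)))"
    using infinite_uniformizer[OF P_infty_unique(1,2)] by blast
  note pole = pole_order(2)[OF _ _ P_infty_unique(1,2) t]
  obtain a b where ab: "a \<in> A" "a \<noteq> 0" "k = nat (pole_order a)" "b \<in> A" "b \<noteq> 0" "l = nat (pole_order b)"
    using assms by (auto simp: weierstrass_semigroup_eq_pole_order)
  have "sim (a * b) (t powi (- pole_order a) * t powi (- pole_order b))"
    using pole ab by (intro sim_mult)
  then have "sim (a * b) (t powi (- (pole_order a + pole_order b)))"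
    using t(2) by (simp flip: power_int_add)
  then have "pole_order (a * b) = pole_order a + pole_order b"
    using sim_powi_unique[OF t(1,2) _ pole[of "a * b"]] ab A.mult_mem by fastforce
  moreover have "pole_order a \<ge> 0" "pole_order b \<ge> 0" using pole_order(1) ab by fastforce+
  ultimately have "k + l = nat (pole_order (a * b))" using ab by simp
  then show ?thesis
    unfolding weierstrass_semigroup_eq_pole_order using ab A.mult_mem
    by (intro CollectI exI[of _ "a * b"]) auto
qed

end

section \<open>Linearised polynomials\<close>

text \<open>The translation by 1 permutes the field, so it does not change the sum of all
  elements.\<close>

lemma of_nat_card_UNIV_eq_0: "of_nat (card (UNIV :: 'a set)) = (0 :: 'a::{field,finite})"
proof -
  have "(\<Sum>a\<in>UNIV. a + (1 :: 'a)) = (\<Sum>a\<in>UNIV. a)"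
    by (rule sum.reindex_bij_witness[of _ "\<lambda>a. a - 1" "\<lambda>a. a + 1"]) auto
  then show ?thesis by (simp add: sum.distrib)
qed

lemma power_card_UNIV: "(c :: 'a::{field,finite}) ^ card (UNIV :: 'a set) = c"
proof (cases "c = 0")
  case False
  have "(\<Prod>b\<in>UNIV - {0}. c * b) = (\<Prod>b\<in>UNIV - {0}. b)"
    by (rule prod.reindex_bij_witness[of _ "\<lambda>b. b / c" "\<lambda>b. c * b"]) (use False in auto)
  then have "c ^ card (UNIV - {0 :: 'a}) = 1" by (simp add: prod.distrib)
  then have "c ^ Suc (card (UNIV - {0 :: 'a})) = c" by simp
  then show ?thesis by (simp only: card_Suc_Diff1[OF finite UNIV_I])
qed (simp add: card_gt_0_iff)

lemma q_polynomial_coeff_nonzero: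
  assumes "q_polynomial q P" "coeff P m \<noteq> 0"
  shows "\<exists>i. m = q ^ i"
proof -
  obtain l a where "P = (\<Sum>i\<le>l. monom (a i) (q ^ i))" using assms(1) by (auto simp: q_polynomial_def)
  then have *: "coeff P m = (\<Sum>i\<le>l. if q ^ i = m then a i else 0)" by (simp add: coeff_sum)
  show ?thesis
  proof (rule ccontr)
    assume "\<not> ?thesis"
    then have "coeff P m = 0" unfolding * by (intro sum.neutral) auto
    then show False using assms(2) by simp
  qed
qed

lemma q_polynomial_expand:
  assumes q: "q > 1" and P: "\<And>m. coeff P m \<noteq> 0 \<Longrightarrow> \<exists>i. m = q ^ i" and deg: "degree P \<le> q ^ l"
  shows "P = (\<Sum>i\<le>l. monom (coeff P (q ^ i)) (q ^ i))"
proof (rule poly_eqI)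
  fix m
  have *: "coeff (\<Sum>i\<le>l. monom (coeff P (q ^ i)) (q ^ i)) m = (\<Sum>i\<le>l. if q ^ i = m then coeff P m else 0)"
    unfolding coeff_sum by (intro sum.cong) auto
  show "coeff P m = coeff (\<Sum>i\<le>l. monom (coeff P (q ^ i)) (q ^ i)) m"
  proof (cases "coeff P m = 0")
    case False
    then obtain j where j: "m = q ^ j" using P by blast
    have "q ^ j \<le> q ^ l" using le_degree[OF False] deg j by simp
    then have "j \<le> l" using q by simp
    then show ?thesis unfolding * using q by (simp add: j)
  qed (simp add: * cong: if_cong)
qed

lemma q_polynomial_iff:
  assumes "q > 1"
  shows "q_polynomial q P \<longleftrightarrow> (\<forall>m. coeff P m \<noteq> 0 \<longrightarrow> (\<exists>i. m = q ^ i))"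
proof
  assume P: "\<forall>m. coeff P m \<noteq> 0 \<longrightarrow> (\<exists>i. m = q ^ i)"
  have "degree P \<le> q ^ degree P" using power_gt_expt[OF assms[unfolded One_nat_def], of "degree P"] by simp
  then show "q_polynomial q P"
    using q_polynomial_expand[OF assms _ \<open>degree P \<le> q ^ degree P\<close>] P
    unfolding q_polynomial_def by (intro exI[of _ "degree P"] exI[of _ "\<lambda>i. coeff P (q ^ i)"]) blast
qed (use q_polynomial_coeff_nonzero in blast)

lemma q_polynomialD:
  assumes "q > 1" "q_polynomial q P" "degree P \<le> q ^ l"
  shows "P = (\<Sum>i\<le>l. monom (coeff P (q ^ i)) (q ^ i))"
  using q_polynomial_expand[OF assms(1) _ assms(3)] q_polynomial_coeff_nonzero[OF assms(2)] by blast

lemma q_polynomial_degree: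
  assumes "q_polynomial q P" "P \<noteq> 0"
  obtains i where "degree P = q ^ i"
  using q_polynomial_coeff_nonzero[OF assms(1), of "degree P"] assms(2) by auto

lemma q_polynomial_add:
  assumes "q > 1" "q_polynomial q P" "q_polynomial q Q"
  shows "q_polynomial q (P + Q)"
  using assms unfolding q_polynomial_iff[OF assms(1)] by (metis add.right_neutral add_0 coeff_add)

lemma q_polynomial_uminus:
  assumes "q > 1" "q_polynomial q (P :: 'a::comm_ring_1 poly)"
  shows "q_polynomial q (- P)"
  using assms unfolding q_polynomial_iff[OF assms(1)] by simp

lemma q_polynomial_diff:
  assumes "q > 1" "q_polynomial q P" "q_polynomial q (Q :: 'a::comm_ring_1 poly)"
  shows "q_polynomial q (P - Q)"
  using q_polynomial_add[OF assms(1,2) q_polynomial_uminus[OF assms(1,3)]] by simp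

lemma q_polynomial_sum:
  assumes "q > 1" "\<And>i. i \<in> S \<Longrightarrow> q_polynomial q (f i)"
  shows "q_polynomial q (sum f S)"
  using assms(2)
proof (induction S rule: infinite_finite_induct)
  case (insert i S)
  then show ?case by (simp add: q_polynomial_add[OF assms(1)])
qed (simp_all add: q_polynomial_iff[OF assms(1)])

lemma q_polynomial_monom: "q > 1 \<Longrightarrow> q_polynomial q (monom c (q ^ i))"
  by (auto simp: q_polynomial_iff)

lemma q_polynomial_map_poly:
  "q > 1 \<Longrightarrow> f 0 = 0 \<Longrightarrow> q_polynomial q P \<Longrightarrow> q_polynomial q (map_poly f P)"
  by (simp add: q_polynomial_iff coeff_map_poly) metis

lemma pcompose_monom: "pcompose (monom c i) Q = smult c (Q ^ i)"
  for Q :: "'a::comm_ring_1 poly"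
proof (induction i)
  case (Suc i)
  have "pcompose (monom c (Suc i)) Q = Q * pcompose (monom c i) Q" by (simp add: monom_Suc pcompose_pCons)
  then show ?case using Suc by simp
qed (simp add: monom_0)

lemma smult_sum_right: "smult c (sum f S) = (\<Sum>i\<in>S. smult c (f i))"
  by (induction S rule: infinite_finite_induct) (auto simp: smult_add_right)

lemma pcompose_power: "pcompose (P ^ n) Q = pcompose P Q ^ n" for Q :: "'a::comm_ring_1 poly"
  by (induction n) (simp_all add: pcompose_mult pcompose_1)

lemma pcompose_monom_right_eq: "pcompose P (monom 1 n) = (\<Sum>i\<le>degree P. monom (coeff P i) (n * i))"
  for P :: "'a::comm_ring_1 poly"
proof -
  have "pcompose P (monom 1 n) = pcompose (\<Sum>i\<le>degree P. monom (coeff P i) i) (monom 1 n)"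
    using poly_as_sum_of_monoms[of P] by simp
  then show ?thesis by (simp add: pcompose_sum pcompose_monom monom_power smult_monom)
qed

lemma coeff_pcompose_monom_right: "\<not> n dvd m \<Longrightarrow> coeff (pcompose P (monom 1 n)) m = 0"
  for P :: "'a::comm_ring_1 poly"
  unfolding pcompose_monom_right_eq coeff_sum by (intro sum.neutral) auto

text \<open>Frobenius turns (X - X^q)^(q^i) into X^(q^i) - X^(q^(i+1)). Composing gs(g) = T_n with X
  - X^q thus yields the polynomial \<open>h\<close> of \<open>linearised_pair\<close>.\<close>

lemma telescoping_pcompose_trace_poly:
  assumes "prime p" "of_nat p = (0 :: 'a::field)" "q = p ^ k"
  shows "pcompose (trace_poly q n) (monom 1 1 - monom (1 :: 'a) q) = monom 1 1 - monom 1 (q ^ n)"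
proof -
  have c: "of_nat p = (0 :: 'a poly)" using assms by (simp add: of_nat_poly)
  have "pcompose (trace_poly q n) (monom 1 1 - monom (1 :: 'a) q) = (\<Sum>i<n. (monom 1 1 - monom (1 :: 'a) q) ^ (q ^ i))"
    by (simp add: trace_poly_def pcompose_sum pcompose_monom)
  also have "\<dots> = (\<Sum>i<n. monom 1 (q ^ i) - monom 1 (q ^ Suc i))"
    by (intro sum.cong refl)
      (simp add: assms(3) frobenius_diff[OF assms(1) c] monom_power flip: power_mult)
  also have "\<dots> = monom 1 1 - monom 1 (q ^ n)"
    using sum_lessThan_telescope'[of "\<lambda>i. monom (1 :: 'a) (q ^ i)" n] by simp
  finally show ?thesis .
qed

locale linearised_poly =
  fixes p k q n r s :: nat and gs :: "'a::{field,finite} poly"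
  assumes p: "prime p" and k: "k > 0" and q: "q = p ^ k"
    and card: "card (UNIV :: 'a set) = q ^ n"
    and r: "r < n" and s: "0 < s"
    and gs: "q_polynomial q gs" "lead_coeff gs = 1" "degree gs = q ^ s"
begin

lemma q_gt_1: "q > 1"
  using p k q prime_gt_1_nat by (metis one_less_power)

lemma n_pos: "n > 0"
  using r by simp

lemma power_q_n: "(c::'a) ^ (q ^ n) = c"
  using power_card_UNIV[of c] card by simp

lemma char_a: "of_nat p = (0 :: 'a)"
proof -
  have "of_nat (q ^ n) = (0 :: 'a)" using of_nat_card_UNIV_eq_0 card by metis
  then show ?thesis using q by simp
qed

lemma char_poly: "of_nat p = (0 :: 'a poly)"
  using char_a by (simp add: of_nat_poly)

lemma power_sum_poly: "sum f S ^ (q ^ i) = (\<Sum>j\<in>S. f j ^ (q ^ i))" for f :: "'i \<Rightarrow> 'a poly"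
  using frobenius_sum[OF p char_poly, where k = "k * i"] by (simp add: q power_mult)

lemma power_add_poly: "(a + b) ^ (q ^ i) = a ^ (q ^ i) + b ^ (q ^ i)" for a b :: "'a poly"
  using frobenius_add[OF p char_poly, where k = "k * i"] by (simp add: q power_mult)

lemma pcompose_q_polynomial_add:
  assumes "q_polynomial q (P :: 'a poly)"
  shows "pcompose P (a + b) = pcompose P a + pcompose P b"
proof -
  obtain l c where P: "P = (\<Sum>i\<le>l. monom (c i) (q ^ i))" using assms by (auto simp: q_polynomial_def)
  show ?thesis
    unfolding P pcompose_sum pcompose_monom power_add_poly smult_add_right sum.distrib ..
qed

lemma pcompose_q_polynomial_diff:
  assumes "q_polynomial q (P :: 'a poly)"
  shows "pcompose P (a - b) = pcompose P a - pcompose P b"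
  using pcompose_q_polynomial_add[OF assms, of "a - b" b] by (metis add_diff_cancel_right' diff_add_cancel)

lemma q_polynomial_pcompose:
  assumes P: "q_polynomial q P" and Q: "q_polynomial q (Q :: 'a poly)"
  shows "q_polynomial q (pcompose P Q)"
proof -
  obtain l c where Pc: "P = (\<Sum>i\<le>l. monom (c i) (q ^ i))" using P by (auto simp: q_polynomial_def)
  obtain l' d where Qd: "Q = (\<Sum>i\<le>l'. monom (d i) (q ^ i))" using Q by (auto simp: q_polynomial_def)
  have "Q ^ (q ^ i) = (\<Sum>j\<le>l'. monom (d j ^ (q ^ i)) (q ^ (j + i)))" for i
    by (simp add: Qd power_sum_poly monom_power power_add)
  then have "pcompose P Q = (\<Sum>i\<le>l. \<Sum>j\<le>l'. monom (c i * d j ^ (q ^ i)) (q ^ (j + i)))"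
    by (simp add: Pc pcompose_sum pcompose_monom smult_sum_right smult_monom)
  then show ?thesis by (elim ssubst) (intro q_polynomial_sum q_polynomial_monom q_gt_1)
qed

lemma pcompose_power_q_n: "P ^ (q ^ n) = pcompose P (monom 1 (q ^ n))" for P :: "'a poly"
proof -
  have "P ^ (q ^ n) = (\<Sum>i\<le>degree P. monom (coeff P i) i) ^ (q ^ n)"
    using poly_as_sum_of_monoms[of P] by simp
  then show ?thesis
    by (simp add: power_sum_poly monom_power power_q_n pcompose_monom_right_eq mult.commute)
qed

end

text \<open>As \<open>X\<^sup>Q\<close>, \<open>Q = q\<^sup>n\<close>, commutes with all \<open>q\<close>-polynomials over the field with \<open>Q\<close> elements,
  the right inverse \<open>h\<close> of \<open>gs\<close> modulo \<open>X - X\<^sup>Q\<close> is a left inverse as well.\<close>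

locale linearised_pair = linearised_poly p k q n r s gs
  for p k q n r s and gs :: "'a::{field,finite} poly" +
  fixes h :: "'a poly"
  assumes h: "q_polynomial q h" and gs_h: "pcompose gs h = monom 1 1 - monom 1 (q ^ n)"
begin

lemma h_gs: "pcompose h gs = monom 1 1 - monom 1 (q ^ n)"
proof -
  define D where "D = pcompose h gs - (monom 1 1 - monom 1 (q ^ n))"
  have X: "pcompose P (monom 1 1) = P" for P :: "'a poly"
    using pcompose_idR[of P] by (simp add: monom_altdef)
  have X': "pcompose (monom 1 1) P = P" for P :: "'a poly" by (simp add: pcompose_monom)
  have "pcompose gs (pcompose h gs) = pcompose (monom 1 1 - monom 1 (q ^ n)) gs"
    by (simp add: pcompose_assoc gs_h)
  also have "\<dots> = gs - pcompose gs (monom 1 (q ^ n))"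
    by (simp only: pcompose_diff X') (simp add: pcompose_monom pcompose_power_q_n)
  also have "\<dots> = pcompose gs (monom 1 1 - monom 1 (q ^ n))"
    unfolding pcompose_q_polynomial_diff[OF gs(1)] X ..
  finally have 0: "pcompose gs D = 0" by (simp add: D_def pcompose_q_polynomial_diff[OF gs(1)])
  \<comment> \<open>gs(D) = 0 makes D constant, and a q-polynomial has no constant term.\<close>
  have "q_polynomial q D"
    unfolding D_def using q_polynomial_monom[OF q_gt_1, of 1 0]
    by (intro q_polynomial_diff q_polynomial_pcompose h gs q_gt_1 q_polynomial_monom) auto
  then have "coeff D 0 = 0" using q_polynomial_coeff_nonzero q_gt_1 by (metis less_nat_zero_code power_eq_0_iff)
  moreover have "degree D = 0" using pcompose_eq_0[OF 0] gs(2) by fastforce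
  ultimately have "D = 0" by (metis degree_eq_zeroE coeff_pCons_0 pCons_0_0)
  then show ?thesis by (simp add: D_def)
qed

section \<open>Splitting \<open>h\<close> at degree \<open>N\<close>, and the polynomial U\<close>

abbreviation "N \<equiv> q ^ (n - r)"

text \<open>The inverse of the \<open>N\<close>-th power map on the coefficients.\<close>

abbreviation \<sigma> :: "'a \<Rightarrow> 'a" where "\<sigma> c \<equiv> c ^ (q ^ r)"

lemma \<sigma>_power: "\<sigma> c ^ N = c"
  using r power_q_n[of c] by (simp flip: power_mult power_add)

lemma N_gt_1: "N > 1"
  using one_less_power[OF q_gt_1, of "n - r"] r by simp

text \<open>Over a perfect field a polynomial in X^N is an N-th power: the root has the N-th roots
  of the coefficients.\<close>

lemma pcompose_monom_N: "pcompose P (monom 1 N) = map_poly \<sigma> P ^ N"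
proof -
  have deg: "degree (map_poly \<sigma> P) = degree P" by (rule degree_map_poly) auto
  have "map_poly \<sigma> P ^ N = (\<Sum>i\<le>degree P. monom (\<sigma> (coeff P i)) i) ^ N"
    using poly_as_sum_of_monoms[of "map_poly \<sigma> P"] q_gt_1 by (simp add: deg coeff_map_poly)
  also have "\<dots> = (\<Sum>i\<le>degree P. monom (coeff P i) (N * i))"
    by (simp add: power_sum_poly monom_power \<sigma>_power mult.commute)
  finally show ?thesis by (simp add: pcompose_monom_right_eq)
qed

lemma coeff_power_N: "\<not> N dvd m \<Longrightarrow> coeff (P ^ N) m = 0" for P :: "'a poly"
proof -
  assume m: "\<not> N dvd m"
  have "P ^ N = (\<Sum>i\<le>degree P. monom (coeff P i) i) ^ N"
    using poly_as_sum_of_monoms[of P] by simp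
  also have "\<dots> = (\<Sum>i\<le>degree P. monom (coeff P i ^ N) (i * N))"
    by (simp add: power_sum_poly monom_power)
  finally show ?thesis using m by (auto simp: coeff_sum intro!: sum.neutral)
qed

lemma not_N_dvd: "i < n - r \<Longrightarrow> \<not> N dvd q ^ i"
  using q_gt_1 by (metis linorder_not_le power_dvd_imp_le)

definition h_low :: "'a poly" where
  "h_low = (\<Sum>i<n - r. monom (coeff h (q ^ i)) (q ^ i))"

definition h_high :: "'a poly" where
  "h_high = (SOME E. q_polynomial q E \<and> h - h_low = pcompose E (monom 1 N))"

lemma q_polynomial_h_low: "q_polynomial q h_low"
  unfolding h_low_def by (intro q_polynomial_sum q_polynomial_monom q_gt_1)

lemma coeff_h_low: "coeff h_low (q ^ i) = (if i < n - r then coeff h (q ^ i) else 0)"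
proof -
  have "coeff h_low (q ^ i) = (\<Sum>j<n - r. if j = i then coeff h (q ^ i) else 0)"
    unfolding h_low_def coeff_sum using q_gt_1 by (intro sum.cong) auto
  then show ?thesis by simp
qed

lemma h_high: "q_polynomial q h_high" "h - h_low = pcompose h_high (monom 1 N)"
proof -
  define E where "E = (\<Sum>i\<le>degree h. monom (coeff h (q ^ (i + (n - r)))) (q ^ i))"
  have hL: "h = (\<Sum>i\<le>degree h + (n - r). monom (coeff h (q ^ i)) (q ^ i))"
  proof (rule q_polynomialD[OF q_gt_1 h])
    have "degree h \<le> q ^ degree h" using power_gt_expt[OF q_gt_1[unfolded One_nat_def], of "degree h"] by simp
    also have "\<dots> \<le> q ^ (degree h + (n - r))" using q_gt_1 by (intro power_increasing) auto
    finally show "degree h \<le> q ^ (degree h + (n - r))" .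
  qed
  have "pcompose E (monom 1 N) = (\<Sum>i\<le>degree h. monom (coeff h (q ^ (i + (n - r)))) (q ^ (i + (n - r))))"
    by (simp add: E_def pcompose_sum pcompose_monom monom_power smult_monom power_add mult.commute)
  also have "\<dots> = (\<Sum>i\<in>{n - r..degree h + (n - r)}. monom (coeff h (q ^ i)) (q ^ i))"
    by (rule sum.reindex_bij_witness[of _ "\<lambda>i. i - (n - r)" "\<lambda>i. i + (n - r)"]) auto
  finally have E: "pcompose E (monom 1 N) = \<dots>" .
  have "{..degree h + (n - r)} = {..<n - r} \<union> {n - r..degree h + (n - r)}" by auto
  then have "(\<Sum>i\<le>degree h + (n - r). monom (coeff h (q ^ i)) (q ^ i)) = h_low + pcompose E (monom 1 N)"
    unfolding E h_low_def by (simp add: sum.union_disjoint ivl_disj_int)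
  with hL have "h = h_low + pcompose E (monom 1 N)" by (rule trans)
  then have "h - h_low = pcompose E (monom 1 N)" by (metis add_diff_cancel_left')
  moreover have "q_polynomial q E" unfolding E_def by (intro q_polynomial_sum q_polynomial_monom q_gt_1)
  ultimately have "q_polynomial q E \<and> h - h_low = pcompose E (monom 1 N)" by blast
  then show "q_polynomial q h_high" "h - h_low = pcompose h_high (monom 1 N)"
    unfolding h_high_def by (metis (mono_tags, lifting) someI_ex)+
qed

text \<open>From h(gs) = X - X^(q^n) and h = h_low + h_high(X^N) it follows that X - h_low(gs) =
  X^(q^n) + h_high(gs^N), a sum of two N-th powers. So \<open>- h_low\<close> has the defining
  property of U.\<close>

lemma X_minus_h_low_gs:
  "\<exists>Q. q_polynomial q Q \<and> Q ^ N = monom 1 1 - pcompose h_low gs"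
proof -
  have "monom 1 1 - pcompose h_low gs = monom 1 1 - pcompose h gs + pcompose (pcompose h_high (monom 1 N)) gs"
    using arg_cong[OF h_high(2), of "\<lambda>P. pcompose P gs"] by (simp add: pcompose_diff algebra_simps)
  also have "\<dots> = (monom 1 (q ^ r)) ^ N + pcompose (map_poly \<sigma> h_high) gs ^ N"
  proof -
    have "q ^ r * N = q ^ n" using r by (simp flip: power_add)
    then show ?thesis by (simp add: h_gs pcompose_monom_N monom_power pcompose_power)
  qed
  also have "\<dots> = (monom 1 (q ^ r) + pcompose (map_poly \<sigma> h_high) gs) ^ N"
    by (simp add: power_add_poly)
  finally have "(monom 1 (q ^ r) + pcompose (map_poly \<sigma> h_high) gs) ^ N = monom 1 1 - pcompose h_low gs" ..
  moreover have "q_polynomial q (monom 1 (q ^ r) + pcompose (map_poly \<sigma> h_high) gs)"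
    using q_gt_1 by (intro q_polynomial_add q_polynomial_monom q_polynomial_pcompose
        q_polynomial_map_poly h_high gs) auto
  ultimately show ?thesis by blast
qed

text \<open>If it vanished, X would be an N-th power.\<close>

lemma h_low_nonzero: "h_low \<noteq> 0"
proof
  assume "h_low = 0"
  then obtain Q where "Q ^ N = monom (1 :: 'a) 1" using X_minus_h_low_gs by auto
  then have "coeff (Q ^ N) 1 = 1" by simp
  moreover have "\<not> N dvd 1" using N_gt_1 by (metis less_irrefl nat_dvd_1_iff_1)
  ultimately show False using coeff_power_N[of 1 Q] by simp
qed

lemma degree_h_low: "degree h_low \<le> q ^ (n - r - 1)"
  unfolding h_low_def
proof (rule degree_sum_le)
  fix i assume "i \<in> {..<n - r}"
  then have "q ^ i \<le> q ^ (n - r - 1)" using q_gt_1 by (intro power_increasing) auto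
  then show "degree (monom (coeff h (q ^ i)) (q ^ i)) \<le> q ^ (n - r - 1)"
    using degree_monom_le order.trans by blast
qed simp

text \<open>Composing with \<open>h\<close> from the right turns \<open>X + U(gs)\<close> into \<open>h + U\<close>, up to a polynomial in \<open>X\<^sup>N\<close>.\<close>

lemma U_poly_eq: "U_poly q n r gs = - h_low"
  unfolding U_poly_def
proof (rule the_equality)
  have "[:0, 1:] + pcompose (- h_low) gs = monom 1 1 - pcompose h_low gs"
    by (simp add: pcompose_uminus monom_altdef)
  then show "q_polynomial q (- h_low) \<and> degree (- h_low) \<le> q ^ (n - r - 1) \<and>
     (\<exists>Q. q_polynomial q Q \<and> Q ^ N = [:0, 1:] + pcompose (- h_low) gs)"
    using X_minus_h_low_gs degree_h_low q_polynomial_uminus[OF q_gt_1 q_polynomial_h_low] by simp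
next
  fix U assume U: "q_polynomial q U \<and> degree U \<le> q ^ (n - r - 1) \<and>
     (\<exists>Q. q_polynomial q Q \<and> Q ^ N = [:0, 1:] + pcompose U gs)"
  then obtain Q where Q: "Q ^ N = [:0, 1:] + pcompose U gs" by blast
  have "pcompose Q h ^ N = pcompose ([:0, 1:] + pcompose U gs) h" by (simp add: Q flip: pcompose_power)
  also have "\<dots> = h + pcompose U (pcompose gs h)"
    by (simp add: pcompose_add pcompose_assoc pcompose_pCons)
  also have "\<dots> = h + U - pcompose U (monom 1 (q ^ n))"
    using U pcompose_idR[of U] by (simp add: gs_h pcompose_q_polynomial_diff monom_altdef)
  finally have *: "pcompose Q h ^ N = h + U - pcompose U (monom 1 (q ^ n))" .
  \<comment> \<open>Exponents q^i with i < n - r are not divisible by \<open>N\<close>, so neither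
    the N-th power nor U(X^(q^n)) contributes to these coefficients.\<close>
  have "coeff U (q ^ i) = - coeff h (q ^ i)" if "i < n - r" for i
  proof -
    have "\<not> q ^ n dvd q ^ i" using not_N_dvd[OF that] q_gt_1 that by (meson le_imp_power_dvd diff_le_self dvd_trans)
    then show ?thesis
      using arg_cong[OF *, of "\<lambda>P. coeff P (q ^ i)"] coeff_power_N[OF not_N_dvd[OF that]]
        coeff_pcompose_monom_right by (simp add: eq_neg_iff_add_eq_0 add.commute)
  qed
  then have "coeff U (q ^ i) = coeff (- h_low) (q ^ i)" if "i \<le> n - r - 1" for i
    using that r by (simp add: coeff_h_low)
  then show "U = - h_low"
    using q_polynomialD[OF q_gt_1, of U "n - r - 1"] q_polynomialD[OF q_gt_1, of "- h_low" "n - r - 1"]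
      U degree_h_low q_polynomial_uminus[OF q_gt_1 q_polynomial_h_low]
    by (metis (no_types, lifting) atMost_iff degree_minus sum.cong)
qed

lemma degree_h_low_eq: "degree h_low = q ^ u_of q n r gs"
proof -
  obtain i where i: "degree h_low = q ^ i" using q_polynomial_degree[OF q_polynomial_h_low h_low_nonzero] .
  have "u_of q n r gs = i"
    unfolding u_of_def U_poly_eq using i h_low_nonzero q_gt_1 by (intro the_equality) auto
  then show ?thesis using i by simp
qed

lemma u_of_le: "u_of q n r gs \<le> n - r - 1"
  using degree_h_low q_gt_1 by (simp add: degree_h_low_eq)

text \<open>Built so that V_root(X^N) = X - gs(h_low). After the substitution y = w^N -
  h_low(x^(N+1)) this is the part of the curve equation whose N-th root enters
  \<open>R\<close>.\<close>

definition V_root :: "'a poly" where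
  "V_root = monom 1 (q ^ r) + pcompose gs h_high"

lemma q_polynomial_V_root: "q_polynomial q V_root"
  unfolding V_root_def using q_gt_1
  by (intro q_polynomial_add q_polynomial_monom q_polynomial_pcompose h_high gs)

lemma pcompose_V_root: "pcompose V_root (monom 1 N) = monom 1 1 - pcompose gs h_low"
proof -
  have "pcompose V_root (monom 1 N) = monom 1 (q ^ n) + pcompose gs (h - h_low)"
    using r by (simp add: V_root_def pcompose_add pcompose_monom pcompose_assoc h_high(2) monom_power flip: power_add)
  then show ?thesis by (simp add: pcompose_q_polynomial_diff[OF gs(1)] gs_h)
qed

text \<open>Since s > 0, the term X lies below the degree q^(s+u) of gs(h_low) in
  V_root(X^N).\<close>

lemma degree_V_root: "N * degree V_root = q ^ (s + u_of q n r gs)"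
proof -
  have d: "degree (pcompose gs h_low) = q ^ (s + u_of q n r gs)"
    by (simp add: degree_pcompose gs degree_h_low_eq power_add)
  moreover have "1 < q ^ (s + u_of q n r gs)" using q_gt_1 s by (intro one_less_power) auto
  ultimately have "degree (monom 1 1 - pcompose gs h_low) = q ^ (s + u_of q n r gs)"
    using degree_add_eq_right[of "monom 1 1" "- pcompose gs h_low"] by (simp add: degree_monom_eq)
  then show ?thesis
    unfolding pcompose_V_root[symmetric] by (simp add: degree_pcompose degree_monom_eq mult.commute)
qed

end

section \<open>The second model and the generic case\<close>

lemma semigroup_gen_add: "a \<in> semigroup_gen S \<Longrightarrow> b \<in> semigroup_gen S \<Longrightarrow> a + b \<in> semigroup_gen S"
  by (induction rule: semigroup_gen.induct) (auto simp: add.assoc intro: semigroup_gen.add)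

lemma semigroup_gen_mult: "a \<in> S \<Longrightarrow> i * a \<in> semigroup_gen S"
  by (induction i) (auto intro: semigroup_gen.intros)

lemma semigroup_gen_subset:
  assumes "0 \<in> H" "\<And>a b. a \<in> H \<Longrightarrow> b \<in> H \<Longrightarrow> a + b \<in> H" "S \<subseteq> H"
  shows "semigroup_gen S \<subseteq> H"
proof
  fix a assume "a \<in> semigroup_gen S"
  then show "a \<in> H" by induction (use assms in auto)
qed

context plane_curve
begin

text \<open>D(x) has a pole, so \<open>z\<close> must have one too; then the leading terms on both
  sides can be compared.\<close>

lemma sim_of_hev_eq:
  assumes V: "V \<in> places \<iota>" "x \<notin> V" and eq: "K.hev z P = K.hev x D"
    and P: "P \<noteq> 0" and D: "degree D > 0"
  shows "z \<notin> V" "valuation_ring.sim V (z ^ degree P) (x ^ degree D)"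
proof -
  interpret valuation_ring V using V(1) by (rule place_valuation_ring)
  have "D \<noteq> 0" using D by auto
  then have D': "sim (K.hev x D) (x ^ degree D)" using sim_hev[OF V] by simp
  show z: "z \<notin> V"
  proof
    assume "z \<in> V"
    then have "K.hev z P \<in> V"
      unfolding K.hev_altdef using iota_mem_place[OF V(1)] by (intro sum_mem mult_mem power_mem)
    then have "x ^ degree D \<in> V" using D' eq sim_mem_iff by simp
    then show False using power_memD D V(2) by blast
  qed
  show "sim (z ^ degree P) (x ^ degree D)"
    using sim_trans[OF sim_sym[OF sim_hev[OF V(1) z P]]] D' eq by simp
qed

lemma hev_divide_power_mem:
  assumes V: "V \<in> places \<iota>" and z: "z \<notin> V" and deg: "degree P \<le> d"
  shows "K.hev z P / z ^ d \<in> V"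
proof -
  interpret valuation_ring V using V by (rule place_valuation_ring)
  show ?thesis
  proof (cases "P = 0")
    case False
    have z0: "z \<noteq> 0" using z zero_mem by auto
    have "sim (K.hev z P * inverse (z ^ d)) (z ^ degree P * inverse (z ^ d))"
      using sim_hev[OF V z False] z0 by (intro sim_mult sim_refl) auto
    also have "z ^ degree P * inverse (z ^ d) = inverse z ^ (d - degree P)"
      using z0 deg by (simp add: power_diff field_simps)
    finally show ?thesis
      using sim_mem_iff power_mem[OF max_ideal_subset[OF not_mem_inverse[OF z]]] by (simp add: divide_inverse)
  qed (simp add: zero_mem)
qed

lemma sim_iota_mult:
  assumes V: "V \<in> places \<iota>" and "c \<noteq> 0" "a \<noteq> 0"
  shows "valuation_ring.sim V (\<iota> c * a) a"
proof -
  interpret valuation_ring V using V by (rule place_valuation_ring)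
  have "unt (\<iota> c)" using assms iota_mem_place[OF V] iota_inverse[of c]
    by (metis iota_eq_0_iff unt_def)
  then show ?thesis using assms(3) by (rule sim_unt_mult)
qed

end

section \<open>The curve, the root \<open>w\<close> and its equation\<close>

locale trace_curve = linearised_pair p k q n r s gs h
  for p k q n r s and gs h :: "'a::{field,finite} poly" +
  fixes \<iota> :: "'a \<Rightarrow> 'f::field" and x y :: 'f
  assumes ff: "is_function_field (curve_poly q n r gs) \<iota> x y"
    and s_le_r: "s \<le> r"
begin

abbreviation f :: "'a poly" where
  "f \<equiv> monom 1 (q ^ n + N) - monom 1 (N + 1)"

lemma degree_const_coeffs: "degree (map_poly (\<lambda>a. [:a:]) gs) = q ^ s"
  by (subst degree_map_poly) (auto simp: gs)

sublocale C: plane_curve \<iota> x y "curve_poly q n r gs"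
proof
  have pos: "q ^ s > 0" using q_gt_1 by simp
  then have "degree [:f:] < degree (map_poly (\<lambda>a. [:a:]) gs)" by (simp add: degree_const_coeffs)
  moreover have "curve_poly q n r gs = map_poly (\<lambda>a. [:a:]) gs + - [:f:]"
    unfolding curve_poly_def by (simp only: diff_conv_add_uminus)
  ultimately have d: "degree (curve_poly q n r gs) = q ^ s"
    using degree_add_eq_left[of "- [:f:]" "map_poly (\<lambda>a. [:a:]) gs"]
    by (simp only: degree_minus degree_const_coeffs)
  then show "degree (curve_poly q n r gs) > 0" using pos by simp
  show "lead_coeff (curve_poly q n r gs) = 1"
    unfolding d using pos gs(2,3)
    by (auto simp: curve_poly_def coeff_map_poly coeff_pCons one_pCons split: nat.splits)
qed (rule ff)

lemma curve_eq: "C.K.hev y gs = x ^ (q ^ n + N) - x ^ (N + 1)"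
proof -
  have "C.Kx.hev y (map_poly (\<lambda>a. [:a:]) P) = C.K.hev y P" for P
    by (induction P) (auto simp: map_poly_pCons C.Kx.hev_pCons C.K.hev_pCons)
  moreover have "C.Kx.hev y (curve_poly q n r gs) = 0" by (simp add: C.hev_eq_0_iff)
  ultimately show ?thesis
    by (simp add: curve_poly_def C.Kx.hev_diff C.K.hev_diff C.K.hev_monom C.K.hom_1)
qed

lemma curve_eq': "C.K.hev y gs = C.K.hev x f"
  by (simp add: curve_eq C.K.hev_diff C.K.hev_monom C.K.hom_1)

text \<open>Apply h to gs(y) = f(x) and use h(gs) = X - X^(q^n).\<close>

lemma power_y: "y ^ (q ^ n) = y - C.K.hev x (pcompose h f)"
proof -
  have "C.K.hev y (pcompose h gs) = C.K.hev x (pcompose h f)"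
    by (simp only: C.K.hev_pcompose curve_eq')
  then have "C.K.hev x (pcompose h f) = y - y ^ (q ^ n)"
    by (simp add: h_gs C.K.hev_diff C.K.hev_monom C.K.hom_1)
  then show ?thesis by (simp only: diff_diff_eq2 add_diff_cancel_left')
qed

sublocale C: frobenius_curve \<iota> x y "curve_poly q n r gs" p "k * n" "pcompose h f"
proof
  show "k * n > 0" using k n_pos by simp
  show "c ^ p ^ (k * n) = c" for c :: 'a using power_q_n[of c] by (simp add: q power_mult)
  show "y ^ p ^ (k * n) = y - C.K.hev x (pcompose h f)" using power_y by (simp add: q power_mult)
qed (use p char_a in auto)

lemma frobenius_q_add: "(a + b) ^ (q ^ i) = a ^ (q ^ i) + b ^ (q ^ i)" for a b :: 'f
  using frobenius_add[OF p C.char_F, where k = "k * i"] by (simp add: q power_mult)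

lemma hev_power_N: "C.K.hev (z ^ N) P = C.K.hev z (map_poly \<sigma> P) ^ N"
  using arg_cong[OF pcompose_monom_N[of P], of "C.K.hev z"]
  by (simp add: C.K.hev_pcompose C.K.hev_monom C.K.hom_1 C.K.hev_power)

lemma hev_q_polynomial_add:
  assumes "q_polynomial q P"
  shows "C.K.hev (a + b) P = C.K.hev a P + C.K.hev b P"
proof -
  obtain l c where P: "P = (\<Sum>i\<le>l. monom (c i) (q ^ i))" using assms by (auto simp: q_polynomial_def)
  show ?thesis
    by (simp add: P C.K.hev_sum C.K.hev_monom frobenius_q_add distrib_left sum.distrib)
qed

lemma hev_q_polynomial_diff:
  assumes "q_polynomial q P"
  shows "C.K.hev (a - b) P = C.K.hev a P - C.K.hev b P"
  using hev_q_polynomial_add[OF assms, of "a - b" b] by (metis add_diff_cancel_right' diff_add_cancel)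

lemma power_N_inject: "a ^ N = b ^ N \<Longrightarrow> a = b" for a b :: 'f
proof -
  assume "a ^ N = b ^ N"
  moreover have "a ^ N = (a - b) ^ N + b ^ N" using frobenius_q_add[of "a - b" b "n - r"] by simp
  ultimately have "(a - b) ^ N = 0" by simp
  then show "a = b" by simp
qed

text \<open>Put b = x^(q^r+1) and c = x^(N+1), so f(x) = b^N - c. Then \<open>power_y\<close> gives
  y + h_low(c) = y^(q^n) + h(b^N) - h_high(c^N), and the three terms of \<open>w\<close> are the
  N-th roots of these summands.\<close>

definition w :: 'f where
  "w = y ^ (q ^ r) + C.K.hev (x ^ (q ^ r + 1)) (map_poly \<sigma> h) - C.K.hev (x ^ (N + 1)) (map_poly \<sigma> h_high)"

lemma x_power_N: "(x ^ (q ^ r + 1)) ^ N = x ^ (q ^ n + N)"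
proof -
  have "(q ^ r + 1) * N = q ^ n + N" using r by (simp add: distrib_right flip: power_add)
  then show ?thesis by (simp only: flip: power_mult)
qed

lemma w_power: "w ^ N = y + C.K.hev (x ^ (N + 1)) h_low"
proof -
  let ?b = "x ^ (q ^ r + 1)"
  have diffN: "(a - b) ^ N = a ^ N - b ^ N" for a b :: 'f
    using frobenius_q_add[of "a - b" b "n - r"] by (metis add_diff_cancel_right' diff_add_cancel)
  have "w ^ N = (y ^ (q ^ r)) ^ N + C.K.hev (?b ^ N) h - C.K.hev ((x ^ (N + 1)) ^ N) h_high"
    unfolding w_def diffN frobenius_q_add hev_power_N ..
  also have "(y ^ (q ^ r)) ^ N = y ^ (q ^ n)" using r by (simp flip: power_mult power_add)
  also have "C.K.hev ((x ^ (N + 1)) ^ N) h_high = C.K.hev (x ^ (N + 1)) (h - h_low)"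
    unfolding h_high(2) by (simp add: C.K.hev_pcompose C.K.hev_monom C.K.hom_1)
  also have "y ^ (q ^ n) = y - (C.K.hev (?b ^ N) h - C.K.hev (x ^ (N + 1)) h)"
    unfolding power_y C.K.hev_pcompose x_power_N
    by (simp add: C.K.hev_diff C.K.hev_monom C.K.hom_1 hev_q_polynomial_diff[OF h])
  finally show ?thesis by (simp add: C.K.hev_diff)
qed

definition R :: "'a poly" where
  "R = monom 1 (q ^ r + 1) - pcompose (map_poly \<sigma> V_root) (monom 1 (N + 1))"

lemma hev_x_R: "C.K.hev x R = x ^ (q ^ r + 1) - C.K.hev (x ^ (N + 1)) (map_poly \<sigma> V_root)"
  by (simp add: R_def C.K.hev_diff C.K.hev_pcompose C.K.hev_monom C.K.hom_1)

text \<open>Proved for N-th powers, which are injective in characteristic p. There gs(w^N) = gs(y) +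
  gs(h_low(x^(N+1))), and the term -x^(N+1) of the curve equation cancels against the X in
  V_root(X^N) = X - gs(h_low).\<close>

lemma w_equation: "C.K.hev w (map_poly \<sigma> gs) = C.K.hev x R"
proof (rule power_N_inject)
  let ?X = "x ^ (N + 1)"
  have diffN: "(a - b) ^ N = a ^ N - b ^ N" for a b :: 'f
    using frobenius_q_add[of "a - b" b "n - r"] by (metis add_diff_cancel_right' diff_add_cancel)
  have "C.K.hev w (map_poly \<sigma> gs) ^ N = C.K.hev y gs + C.K.hev ?X (pcompose gs h_low)"
    by (simp only: hev_power_N[symmetric] w_power hev_q_polynomial_add[OF gs(1)] C.K.hev_pcompose)
  also have "pcompose gs h_low = monom 1 1 - pcompose V_root (monom 1 N)" by (simp add: pcompose_V_root)
  also have "C.K.hev y gs + C.K.hev ?X (monom 1 1 - pcompose V_root (monom 1 N)) = x ^ (q ^ n + N) - C.K.hev (?X ^ N) V_root"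
    by (simp add: curve_eq C.K.hev_diff C.K.hev_pcompose C.K.hev_monom C.K.hom_1)
  also have "\<dots> = C.K.hev x R ^ N"
    unfolding hev_x_R diffN x_power_N hev_power_N ..
  finally show "C.K.hev w (map_poly \<sigma> gs) ^ N = C.K.hev x R ^ N" .
qed

lemma w_mem: "w \<in> C.A"
proof -
  have "C.K.hev (x ^ i) P \<in> C.A" for i P
    unfolding C.K.hev_altdef using C.iota_mem C.x_mem
    by (intro C.A.sum_mem C.A.mult_mem C.A.power_mem)
  then show ?thesis unfolding w_def using C.y_mem
    by (intro C.A.diff_mem C.A.add_mem C.A.power_mem)
qed

lemma map_\<sigma>_gs: "degree (map_poly \<sigma> gs) = q ^ s" "coeff (map_poly \<sigma> gs) (q ^ s) = 1" "map_poly \<sigma> gs \<noteq> 0"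
proof -
  show "degree (map_poly \<sigma> gs) = q ^ s" by (subst degree_map_poly) (auto simp: gs)
  show 1: "coeff (map_poly \<sigma> gs) (q ^ s) = 1" using gs(2,3) q_gt_1 by (simp add: coeff_map_poly)
  then show "map_poly \<sigma> gs \<noteq> 0" by auto
qed

text \<open>The K[x]-module \<open>M\<close> spanned by these powers is closed under multiplication
  by \<open>w\<close>, as \<open>w_equation\<close> is monic of degree q^s in \<open>w\<close>.
  Hence it is a ring, and it contains y = w^N - h_low(x^(N+1)).\<close>

lemma span_powers_w:
  assumes "a \<in> C.A"
  shows "\<exists>c. a = (\<Sum>j<q ^ s. C.K.hev x (c j) * w ^ j)"
proof -
  define e where "e = q ^ s"
  have e: "e > 0" using q_gt_1 by (simp add: e_def)
  define M where "M = {\<Sum>j<e. C.K.hev x (c j) * w ^ j | c. True}"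
  have add: "a + b \<in> M" if "a \<in> M" "b \<in> M" for a b
  proof -
    from that obtain c d where "a = (\<Sum>j<e. C.K.hev x (c j) * w ^ j)" "b = (\<Sum>j<e. C.K.hev x (d j) * w ^ j)"
      by (auto simp: M_def)
    then have "a + b = (\<Sum>j<e. C.K.hev x (c j + d j) * w ^ j)"
      by (simp add: C.K.hev_add distrib_right sum.distrib)
    then show ?thesis unfolding M_def by (intro CollectI exI[of _ "\<lambda>j. c j + d j"]) simp
  qed
  have scale: "C.K.hev x D * a \<in> M" if "a \<in> M" for a D
  proof -
    from that obtain c where "a = (\<Sum>j<e. C.K.hev x (c j) * w ^ j)" by (auto simp: M_def)
    then have "C.K.hev x D * a = (\<Sum>j<e. C.K.hev x (D * c j) * w ^ j)"
      by (simp add: C.K.hev_mult sum_distrib_left mult.assoc)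
    then show ?thesis unfolding M_def by (intro CollectI exI[of _ "\<lambda>j. D * c j"]) simp
  qed
  have pow: "w ^ i \<in> M" if "i < e" for i
  proof -
    have "w ^ i = (\<Sum>j<e. C.K.hev x (if j = i then 1 else 0) * w ^ j)"
      using that by (simp add: if_distrib[of "C.K.hev x"] if_distrib[of "\<lambda>a. a * _"] C.K.hev_const[of x 1, folded one_pCons] C.K.hom_1 cong: if_cong)
    then show ?thesis unfolding M_def by (intro CollectI exI[of _ "\<lambda>j. if j = i then 1 else 0"]) simp
  qed
  have zero: "0 \<in> M" using scale[OF pow[OF e], of 0] by simp
  have sum: "sum g S \<in> M" if "\<And>i. i \<in> S \<Longrightarrow> g i \<in> M" for g :: "nat \<Rightarrow> 'f" and S
    using that by (induction S rule: infinite_finite_induct) (auto simp: add zero)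
  have we: "w ^ e \<in> M"
  proof -
    have "C.K.hev x R = (\<Sum>j\<le>e. \<iota> (coeff (map_poly \<sigma> gs) j) * w ^ j)"
      unfolding w_equation[symmetric] C.K.hev_altdef[of w] map_\<sigma>_gs(1) e_def ..
    also have "\<dots> = w ^ e + (\<Sum>j<e. \<iota> (coeff (map_poly \<sigma> gs) j) * w ^ j)"
      using map_\<sigma>_gs(2) by (simp add: e_def C.K.hom_1 add.commute flip: lessThan_Suc_atMost)
    finally have "w ^ e = C.K.hev x R * w ^ 0 + C.K.hev x (- 1) * (\<Sum>j<e. C.K.hev x [:coeff (map_poly \<sigma> gs) j:] * w ^ j)"
      by (simp add: C.K.hev_uminus C.K.hev_const[of x 1, folded one_pCons] C.K.hom_1)
    also have "\<dots> \<in> M" using pow pow[OF e] by (intro add scale sum) auto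
    finally show ?thesis .
  qed
  have w_mult: "w * a \<in> M" if "a \<in> M" for a
  proof -
    from that obtain c where "a = (\<Sum>j<e. C.K.hev x (c j) * w ^ j)" by (auto simp: M_def)
    then have "w * a = (\<Sum>j<e. C.K.hev x (c j) * w ^ Suc j)" by (simp add: sum_distrib_left mult_ac)
    also have "\<dots> \<in> M"
    proof (intro sum scale)
      fix j assume "j \<in> {..<e}"
      then show "w ^ Suc j \<in> M" using pow[of "Suc j"] we by (cases "Suc j = e") auto
    qed
    finally show ?thesis .
  qed
  have w_pow_mult: "w ^ i * a \<in> M" if "a \<in> M" for a i
    by (induction i) (auto simp: that mult.assoc w_mult)
  have mult: "a * b \<in> M" if "a \<in> M" "b \<in> M" for a b
  proof -
    from that(1) obtain c where "a = (\<Sum>j<e. C.K.hev x (c j) * w ^ j)" by (auto simp: M_def)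
    then have "a * b = (\<Sum>j<e. C.K.hev x (c j) * (w ^ j * b))" by (simp add: sum_distrib_right mult.assoc)
    also have "\<dots> \<in> M" using that(2) by (intro sum scale w_pow_mult)
    finally show ?thesis .
  qed
  have hev: "C.K.hev x D \<in> M" for D using scale[OF pow[OF e], of D] by simp
  have "C.K.hev (x ^ (N + 1)) h_low = C.K.hev x (pcompose h_low (monom 1 (N + 1)))"
    by (simp add: C.K.hev_pcompose C.K.hev_monom C.K.hom_1)
  then have "y = w ^ N * w ^ 0 + C.K.hev x (- pcompose h_low (monom 1 (N + 1)))"
    using w_power by (simp add: C.K.hev_uminus)
  also have "\<dots> \<in> M" by (intro add w_pow_mult pow e hev)
  finally have "y \<in> M" .
  moreover have "\<iota> c \<in> M" for c using hev[of "[:c:]"] by simp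
  moreover have "x \<in> M" using hev[of "[:0, 1:]"] by simp
  ultimately have "C.A \<subseteq> M" using add mult by (intro C.A_subset)
  then show ?thesis using assms by (auto simp: M_def e_def)
qed

text \<open>Passing from the powers of \<open>w\<close> to monic polynomials of the same degrees is
  a unitriangular change of spanning set.\<close>

lemma span_monic:
  assumes B: "\<And>j. j < q ^ s \<Longrightarrow> \<exists>P. lead_coeff P = 1 \<and> degree P = j \<and> C.Kx.hev w P = B j"
    and a: "a \<in> C.A"
  shows "\<exists>c. a = (\<Sum>j<q ^ s. C.K.hev x (c j) * B j)"
proof -
  have "\<exists>d. (\<Sum>j<i. C.K.hev x (c j) * w ^ j) = (\<Sum>j<i. C.K.hev x (d j) * B j)" if "i \<le> q ^ s" for i c
    using that
  proof (induction i arbitrary: c)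
    case (Suc i)
    obtain P where P: "lead_coeff P = 1" "degree P = i" "C.Kx.hev w P = B i" using B[of i] Suc.prems by auto
    have "B i = (\<Sum>j<i. C.K.hev x (coeff P j) * w ^ j) + w ^ i"
      using P(1,2) unfolding P(3)[symmetric] C.Kx.hev_altdef
      by (simp add: C.Kx.hom_1 flip: lessThan_Suc_atMost)
    then have wi: "w ^ i = B i - (\<Sum>j<i. C.K.hev x (coeff P j) * w ^ j)" by simp
    have "(\<Sum>j<Suc i. C.K.hev x (c j) * w ^ j) = (\<Sum>j<i. C.K.hev x (c j - c i * coeff P j) * w ^ j) + C.K.hev x (c i) * B i"
      by (simp add: wi C.K.hev_diff C.K.hev_mult left_diff_distrib right_diff_distrib sum_subtractf sum_distrib_left mult.assoc)
    moreover obtain d where "(\<Sum>j<i. C.K.hev x (c j - c i * coeff P j) * w ^ j) = (\<Sum>j<i. C.K.hev x (d j) * B j)"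
      using Suc.IH[of "\<lambda>j. c j - c i * coeff P j"] Suc.prems by auto
    ultimately have "(\<Sum>j<Suc i. C.K.hev x (c j) * w ^ j) = (\<Sum>j<i. C.K.hev x (d j) * B j) + C.K.hev x (c i) * B i"
      by simp
    also have "\<dots> = (\<Sum>j<Suc i. C.K.hev x ((d(i := c i)) j) * B j)" by simp
    finally show ?case by blast
  qed simp
  then show ?thesis using span_powers_w[OF a] by (metis order.refl)
qed

lemma infinite_basisI:
  assumes B: "\<And>j. j < q ^ s \<Longrightarrow> \<exists>P. lead_coeff P = 1 \<and> degree P = j \<and> C.Kx.hev w P = B j"
    and inj: "inj_on (\<lambda>j. \<mu> j mod q ^ s) {..<q ^ s}"
    and B_sim: "\<And>V j. V \<in> places \<iota> \<Longrightarrow> x \<notin> V \<Longrightarrow> j < q ^ s \<Longrightarrow>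
      valuation_ring.sim V (B j ^ (q ^ s)) (x ^ \<mu> j)"
    and coprime: "\<exists>j<q ^ s. coprime (\<mu> j) (q ^ s)"
  shows "infinite_basis \<iota> x y (curve_poly q n r gs) p (k * n) (pcompose h f) (q ^ s) B \<mu> (q ^ n + N)"
proof
  fix j assume "j < q ^ s"
  then obtain P where P: "C.Kx.hev w P = B j" using B by blast
  show "B j \<in> C.A"
    unfolding P[symmetric] C.Kx.hev_altdef using C.hev_x_mem w_mem
    by (intro C.A.sum_mem C.A.mult_mem C.A.power_mem)
next
  fix V assume V: "V \<in> places \<iota>" "x \<notin> V"
  have "N + 1 < q ^ n + N" using one_less_power[OF q_gt_1 n_pos] by simp
  then have f: "degree f = q ^ n + N"
    using degree_add_eq_left[of "- monom (1::'a) (N + 1)" "monom 1 (q ^ n + N)"]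
    by (simp add: degree_monom_eq del: power_Suc)
  have "gs \<noteq> 0" using gs(2) by auto
  then show "valuation_ring.sim V (y ^ q ^ s) (x ^ (q ^ n + N))"
    using C.sim_of_hev_eq(2)[OF V curve_eq'] q_gt_1 unfolding f gs(3) by simp
next
  have "q ^ s < q ^ n" using s_le_r r q_gt_1 by (intro power_strict_increasing) auto
  then show "q ^ s < q ^ n + N" by simp
qed (use inj coprime B_sim span_monic[OF B] q_gt_1 in auto)

text \<open>Here \<open>w\<close> has pole order q^r + 1, which is 1 modulo q^s because s <= r. So
  the powers of \<open>w\<close> below q^s already represent each residue once.\<close>

theorem weierstrass_semigroup_two_generators:
  assumes deg: "degree R = q ^ r + 1" and H: "H = weierstrass_semigroup \<iota> (P_infty \<iota> x y)"
  shows "H = semigroup_gen {q ^ s, q ^ r + 1}" "telescopic H" "symmetric_semigroup H"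
proof -
  define e where "e = q ^ s"
  define \<mu> where "\<mu> j = j * (q ^ r + 1)" for j
  have e1: "e > 1" using one_less_power[OF q_gt_1 s] by (simp add: e_def)
  have e_dvd: "e dvd q ^ r" using s_le_r by (simp add: e_def le_imp_power_dvd)
  have "coprime (q ^ r + 1) (q ^ r)" by (rule coprime_add_one_left)
  then have cop: "coprime (q ^ r + 1) e" by (rule coprime_divisors[OF dvd_refl e_dvd])
  interpret I: infinite_basis \<iota> x y "curve_poly q n r gs" p "k * n" "pcompose h f" "q ^ s" "\<lambda>j. w ^ j" \<mu> "q ^ n + N"
  proof (rule infinite_basisI)
    fix j show "\<exists>P. lead_coeff P = 1 \<and> degree P = j \<and> C.Kx.hev w P = w ^ j"
      by (intro exI[of _ "monom 1 j"]) (auto simp: degree_monom_eq C.Kx.hev_monom C.Kx.hom_1)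
  next
    have "\<mu> j mod e = j" if "j < e" for j
    proof -
      obtain l where "q ^ r = e * l" using e_dvd by blast
      then have "\<mu> j = j + e * (j * l)" by (simp add: \<mu>_def algebra_simps)
      then show ?thesis using that by simp
    qed
    then show "inj_on (\<lambda>j. \<mu> j mod q ^ s) {..<q ^ s}" unfolding e_def[symmetric] by (intro inj_onI) auto
  next
    fix V j assume V: "V \<in> places \<iota>" "x \<notin> V"
    interpret valuation_ring V using V(1) by (rule C.place_valuation_ring)
    have "sim (w ^ e) (x ^ (q ^ r + 1))"
      using C.sim_of_hev_eq(2)[OF V w_equation map_\<sigma>_gs(3)] by (simp add: deg map_\<sigma>_gs e_def)
    then have "sim ((w ^ e) ^ j) ((x ^ (q ^ r + 1)) ^ j)" by (rule sim_power)
    also have "(w ^ e) ^ j = (w ^ j) ^ q ^ s" by (simp only: e_def power_mult[symmetric] mult.commute)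
    also have "(x ^ (q ^ r + 1)) ^ j = x ^ \<mu> j" by (simp only: \<mu>_def power_mult[symmetric] mult.commute)
    finally show "sim ((w ^ j) ^ q ^ s) (x ^ \<mu> j)" .
  next
    show "\<exists>j<q ^ s. coprime (\<mu> j) (q ^ s)"
      using e1 cop by (intro exI[of _ 1]) (simp add: \<mu>_def e_def)
  qed
  have Heq: "H = {i * e + \<mu> j | i j. j < e}" unfolding H e_def by (rule I.weierstrass_semigroup_eq)
  show gen: "H = semigroup_gen {q ^ s, q ^ r + 1}"
  proof
    have "i * e + \<mu> j \<in> semigroup_gen {q ^ s, q ^ r + 1}" for i j
      unfolding \<mu>_def e_def by (intro semigroup_gen_add semigroup_gen_mult insertI1 insertI2)
    then show "H \<subseteq> semigroup_gen {q ^ s, q ^ r + 1}" unfolding Heq by blast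
    have mem: "i * e + \<mu> j \<in> H" if "j < e" for i j unfolding Heq using that by blast
    have "0 \<in> H" using mem[of 0 0] e1 by (simp add: \<mu>_def)
    moreover have "e \<in> H" using mem[of 0 1] e1 by (simp add: \<mu>_def)
    moreover have "q ^ r + 1 \<in> H" using mem[of 1 0] e1 by (simp add: \<mu>_def)
    ultimately show "semigroup_gen {q ^ s, q ^ r + 1} \<subseteq> H"
      using I.weierstrass_semigroup_add unfolding H e_def by (intro semigroup_gen_subset) auto
  qed
  show "symmetric_semigroup H"
  proof (rule symmetric_semigroupI[OF _ _ _ _ Heq])
    show "inj_on (\<lambda>j. \<mu> j mod e) {..<e}" using I.inj by (simp add: e_def)
    show "\<mu> j + \<mu> (e - 1 - j) = \<mu> (e - 1)" if "j < e" for j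
    proof -
      have "j + (e - 1 - j) = e - 1" using that by simp
      then show ?thesis by (simp only: \<mu>_def add_mult_distrib[symmetric])
    qed
    have "e \<le> (e - 1) * 2" using e1 by simp
    also have "\<dots> \<le> \<mu> (e - 1)" using q_gt_1 unfolding \<mu>_def by (intro mult_le_mono2) simp
    finally show "e \<le> \<mu> (e - 1)" .
  qed (use e1 in simp)
  show "telescopic H"
    unfolding telescopic_def
  proof (intro exI conjI)
    show "H = semigroup_gen (set [q ^ s, q ^ r + 1])" using gen by simp
    have g: "gcd (q ^ s) (q ^ r + 1) = 1" using cop by (simp add: e_def coprime_iff_gcd_eq_1 gcd.commute)
    \<comment> \<open>The semigroup S_1 is generated by a_1/d_1 = 1, so only the gcd condition has
      content.\<close>
    have "m \<in> semigroup_gen {Suc 0}" for m using semigroup_gen_mult[of "Suc 0" "{Suc 0}" m] by simp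
    then show "telescopic_sequence [q ^ s, q ^ r + 1]"
      using g q_gt_1 unfolding telescopic_sequence_def
      by (auto simp: Let_def numeral_2_eq_2 le_Suc_eq)
  qed
qed

end

section \<open>The case of four generators\<close>

text \<open>A q-polynomial has no exponents strictly between q^i and q^(i+1).\<close>

lemma (in linearised_pair) q_polynomial_degree_reduce:
  assumes P: "q_polynomial q P" "degree P \<le> q ^ Suc i" "coeff P (q ^ Suc i) = 0"
  shows "degree P \<le> q ^ i"
proof (cases "P = 0")
  case False
  obtain j where j: "degree P = q ^ j" using q_polynomial_degree[OF P(1) False] .
  have "j \<noteq> Suc i" using P(3) False j by (metis leading_coeff_0_iff)
  moreover have "j \<le> Suc i" using P(2) q_gt_1 by (simp add: j del: power_Suc)
  ultimately show ?thesis using q_gt_1 by (simp add: j)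
qed simp

text \<open>The case s = 2r - n + 1, u = n - r - 1: \<open>ns\<close> restates the first equation,
  and \<open>deg_V\<close> follows from N * degree V_root = q^(s+u) with s + u = (n - r) + (s -
  1).\<close>

locale telescopic_curve = trace_curve +
  assumes s2: "s \<ge> 2" and ns: "n - r = r - s + 1" and deg_V: "degree V_root = q ^ (s - 1)"
begin

lemma r_pos: "r \<ge> 2"
  using s2 s_le_r by simp

lemma N_power: "N * q ^ (s - 1) = q ^ r"
proof -
  have "n - r + (s - 1) = r" using ns s2 s_le_r by simp
  then show ?thesis by (simp only: flip: power_add)
qed

lemma q_N_le: "q * N \<le> q ^ r"
proof -
  have "q * N = q ^ Suc (n - r)" by simp
  also have "\<dots> \<le> q ^ r" using ns s2 s_le_r q_gt_1 by (intro power_increasing) auto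
  finally show ?thesis .
qed

text \<open>The negative of the leading coefficient of \<open>R\<close>.\<close>

definition v :: 'a where "v = coeff (map_poly \<sigma> V_root) (q ^ (s - 1))"

text \<open>The root of order q^(s-1) of \<open>v\<close>, an inverse Frobenius power since q^n-th
  powers are trivial on K. To leading order w^(q^s) is -v x^((N+1) q^(s-1)), so w^q is -c x^(N+1),
  and this is what \<open>z\<close> cancels.\<close>

definition c :: 'a where "c = v ^ (q ^ (n - (s - 1)))"

definition c' :: 'a where "c' = inverse c ^ (q ^ (n - 1))"

lemma v_nonzero: "v \<noteq> 0"
proof -
  have "V_root \<noteq> 0" using deg_V q_gt_1 by auto
  then have "coeff V_root (q ^ (s - 1)) \<noteq> 0" using deg_V by (metis leading_coeff_0_iff)
  then show ?thesis using q_gt_1 by (simp add: v_def coeff_map_poly)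
qed

lemma c_power: "c ^ (q ^ (s - 1)) = v"
proof -
  have "n - (s - 1) + (s - 1) = n" using s_le_r r by simp
  then show ?thesis by (simp add: c_def power_q_n flip: power_mult power_add)
qed

lemma c_nonzero: "c \<noteq> 0"
  using v_nonzero by (simp add: c_def)

lemma c'_power: "c' ^ q = inverse c"
proof -
  have "q ^ (n - 1) * q = q ^ n" using n_pos power_minus_mult[of n q] by simp
  then show ?thesis unfolding c'_def by (simp only: power_q_n flip: power_mult)
qed

definition z :: 'b where "z = w ^ q + \<iota> c * x ^ (N + 1)"

text \<open>Since \<alpha> q = q^r - N, the term x^(\<alpha> q) w^q / c is -x^(q^r+1) to leading
  order, the opposite of z^(q^(s-1)). This makes the leading terms cancel in t^q.\<close>

definition \<alpha> :: nat where "\<alpha> = q ^ (r - 1) - q ^ (r - s)"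

definition t :: 'b where "t = z ^ (q ^ (s - 2)) + \<iota> c' * (x ^ \<alpha> * w)"

lemma \<alpha>_mult: "\<alpha> * q = q ^ r - N"
proof -
  have "q ^ (r - 1) * q = q ^ r" using r_pos power_minus_mult[of r q] by simp
  moreover have "q ^ (r - s) * q = N" using ns by simp
  ultimately show ?thesis by (simp add: \<alpha>_def diff_mult_distrib)
qed

text \<open>What remains of the equation for \<open>w\<close> once the leading terms of both
  q-polynomials are removed; \<open>asymptotics\<close> shows that it is of lower order in
  \<open>z_power\<close> and \<open>t_power\<close>.\<close>

definition L :: 'b where
  "L = C.K.hev w (map_poly \<sigma> gs - monom 1 (q ^ s))
     + C.K.hev (x ^ (N + 1)) (map_poly \<sigma> V_root - monom v (q ^ (s - 1)))"

lemma z_power: "z ^ (q ^ (s - 1)) = x ^ (q ^ r + 1) - L"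
proof -
  have qs: "q * q ^ (s - 1) = q ^ s" using s2 by (cases s) auto
  have "z ^ (q ^ (s - 1)) = w ^ (q ^ s) + \<iota> v * (x ^ (N + 1)) ^ (q ^ (s - 1))"
    by (simp only: z_def frobenius_q_add power_mult_distrib C.K.hom_power[symmetric] c_power qs power_mult[symmetric])
  moreover have "C.K.hev w (map_poly \<sigma> gs - monom 1 (q ^ s)) = C.K.hev x R - w ^ (q ^ s)"
    by (simp add: C.K.hev_diff w_equation C.K.hev_monom C.K.hom_1)
  moreover have "C.K.hev (x ^ (N + 1)) (map_poly \<sigma> V_root - monom v (q ^ (s - 1)))
      = x ^ (q ^ r + 1) - C.K.hev x R - \<iota> v * (x ^ (N + 1)) ^ (q ^ (s - 1))"
    by (simp only: hev_x_R C.K.hev_diff C.K.hev_monom) simp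
  ultimately show ?thesis by (simp add: L_def)
qed

text \<open>Replacing w^q by z - c x^(N+1) produces -x^(q^r+1), which cancels the main term of
  \<open>z_power\<close> and leaves a multiple of \<open>z\<close> as the new main term.\<close>

lemma t_power: "t ^ q = \<iota> (inverse c) * (x ^ (q ^ r - N) * z) - L"
proof -
  have q1: "(a + b) ^ q = a ^ q + b ^ q" for a b :: 'b using frobenius_q_add[of a b 1] by simp
  have "q ^ (s - 2) * q = q ^ Suc (s - 2)" by simp
  also have "Suc (s - 2) = s - 1" using s2 by simp
  finally have qs: "q ^ (s - 2) * q = q ^ (s - 1)" .
  have "t ^ q = z ^ (q ^ (s - 1)) + \<iota> (inverse c) * (x ^ (q ^ r - N) * w ^ q)"
    by (simp only: t_def q1 power_mult_distrib C.K.hom_power[symmetric] c'_power \<alpha>_mult qs power_mult[symmetric])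
  also have "w ^ q = z - \<iota> c * x ^ (N + 1)" by (simp add: z_def)
  also have "\<iota> (inverse c) * (x ^ (q ^ r - N) * (z - \<iota> c * x ^ (N + 1)))
      = \<iota> (inverse c) * (x ^ (q ^ r - N) * z) - \<iota> (inverse c * c) * (x ^ (q ^ r - N) * x ^ (N + 1))"
    by (simp only: C.K.hom_mult right_diff_distrib mult_ac)
  also have "x ^ (q ^ r - N) * x ^ (N + 1) = x ^ (q ^ r + 1)"
  proof -
    have "N \<le> q ^ r" using q_N_le q_gt_1 by (metis le_trans mult_le_mono1 nat_mult_1 less_imp_le)
    then have "q ^ r - N + (N + 1) = q ^ r + 1" by simp
    then show ?thesis by (simp only: flip: power_add)
  qed
  finally show ?thesis using c_nonzero unfolding z_power by (simp add: C.K.hom_1)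
qed

lemma degree_R: "degree R = q ^ r + q ^ (s - 1)"
proof -
  have "degree (map_poly \<sigma> V_root) = q ^ (s - 1)"
    by (subst degree_map_poly) (auto simp: deg_V)
  then have d: "degree (pcompose (map_poly \<sigma> V_root) (monom 1 (N + 1))) = q ^ r + q ^ (s - 1)"
    using N_power by (simp add: degree_pcompose degree_monom_eq algebra_simps del: power_Suc)
  have "1 < q ^ (s - 1)" using one_less_power[OF q_gt_1, of "s - 1"] s2 by simp
  then show ?thesis
    unfolding R_def diff_conv_add_uminus using d
    by (subst degree_add_eq_right) (simp_all add: degree_monom_eq)
qed

text \<open>The order of \<open>w\<close> comes from \<open>degree_R\<close>. For \<open>z\<close>
  and \<open>t\<close> it suffices that L is bounded by x^T with T <= q^r, so that the main terms of
  \<open>z_power\<close> and \<open>t_power\<close> dominate.\<close>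

lemma asymptotics:
  assumes V: "V \<in> places \<iota>" "x \<notin> V"
  shows "valuation_ring.sim V (w ^ (q ^ s)) (x ^ (q ^ r + q ^ (s - 1)))"
    and "valuation_ring.sim V (z ^ (q ^ s)) (x ^ (q ^ (r + 1) + q))"
    and "valuation_ring.sim V (t ^ (q ^ s)) (x ^ (q ^ (r + s - 1) + 1))"
proof -
  interpret valuation_ring V using V(1) by (rule C.place_valuation_ring)
  have x0: "x \<noteq> 0" using V(2) zero_mem by auto
  have q0: "q > 0" using q_gt_1 by simp
  \<comment> \<open>After its leading term, gs has degree at most q^(s-1) and V_root at most
    q^(s-2). As w^q has the size of x^(N+1), both parts of L are bounded by
    (x^(N+1))^(q^(s-2)).\<close>
  define T where "T = (N + 1) * q ^ (s - 2)"
  have qs1: "q ^ (s - 2) * q = q ^ (s - 1)"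
  proof -
    have "q ^ (s - 2) * q = q ^ Suc (s - 2)" by simp
    also have "Suc (s - 2) = s - 1" using s2 by simp
    finally show ?thesis .
  qed
  have qs2: "q * q ^ (s - 1) = q ^ s" using s2 by (cases s) auto
  have T: "T \<le> q ^ r"
  proof -
    have "T = N * q ^ (s - 2) + q ^ (s - 2)" by (simp add: T_def)
    also have "\<dots> \<le> 2 * (N * q ^ (s - 2))" using N_gt_1 by simp
    also have "\<dots> \<le> q * (N * q ^ (s - 2))" using q_gt_1 by (intro mult_le_mono1) simp
    also have "\<dots> = N * (q ^ (s - 2) * q)" by simp
    also have "\<dots> = q ^ r" by (simp only: qs1 N_power)
    finally show ?thesis .
  qed
  have ix: "inverse (x ^ i) \<in> V" for i
    using power_mem[OF max_ideal_subset[OF not_mem_inverse[OF V(2)]]] by (simp add: power_inverse)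
  have ixm: "inverse (x ^ i) \<in> max_ideal V" if "i > 0" for i
    using max_ideal_power[OF not_mem_inverse[OF V(2)] that] by (simp add: power_inverse)
  have wV: "w \<notin> V" and w: "sim (w ^ (q ^ s)) (x ^ (q ^ r + q ^ (s - 1)))"
    using C.sim_of_hev_eq[OF V w_equation map_\<sigma>_gs(3)] q0 by (simp_all add: degree_R map_\<sigma>_gs)
  show "sim (w ^ (q ^ s)) (x ^ (q ^ r + q ^ (s - 1)))" by (rule w)
  have w0: "w \<noteq> 0" using wV zero_mem by auto
  have "q ^ r + q ^ (s - 1) = (N + 1) * q ^ (s - 1)" by (simp only: add_mult_distrib N_power nat_mult_1)
  then have "sim ((w ^ q) ^ (q ^ (s - 1))) ((x ^ (N + 1)) ^ (q ^ (s - 1)))"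
    using w by (simp only: qs2 power_mult[symmetric])
  then have "sim (w ^ q) (x ^ (N + 1))" by (rule sim_powerD) (use q0 in simp)
  then have "sim ((w ^ q) ^ (q ^ (s - 2))) ((x ^ (N + 1)) ^ (q ^ (s - 2)))" by (rule sim_power)
  then have wT: "sim (w ^ (q ^ (s - 1))) (x ^ T)"
    using qs1 by (simp only: T_def mult.commute power_mult[symmetric])
  have "L / x ^ T \<in> V"
  proof -
    have s_eq: "Suc (s - 1) = s" "Suc (s - 2) = s - 1" using s2 by simp_all
    let ?P = "map_poly \<sigma> gs - monom 1 (q ^ s)"
    have "degree ?P \<le> q ^ (s - 1)"
    proof (rule q_polynomial_degree_reduce)
      show "q_polynomial q ?P" using q_gt_1 gs(1)
        by (intro q_polynomial_diff q_polynomial_map_poly q_polynomial_monom) auto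
      show "degree ?P \<le> q ^ Suc (s - 1)" unfolding s_eq
        by (intro degree_diff_le degree_monom_le) (simp add: map_\<sigma>_gs)
      show "coeff ?P (q ^ Suc (s - 1)) = 0" unfolding s_eq by (simp add: map_\<sigma>_gs)
    qed
    then have 1: "C.K.hev w ?P / w ^ (q ^ (s - 1)) \<in> V"
      by (rule C.hev_divide_power_mem[OF V(1) wV])
    have "w ^ (q ^ (s - 1)) / x ^ T \<in> V" using wT by (simp add: sim_def unt_def)
    then have "C.K.hev w ?P / w ^ (q ^ (s - 1)) * (w ^ (q ^ (s - 1)) / x ^ T) \<in> V"
      using 1 mult_mem by blast
    then have 2: "C.K.hev w ?P / x ^ T \<in> V" using w0 by simp
    let ?Q = "map_poly \<sigma> V_root - monom v (q ^ (s - 1))"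
    have "degree ?Q \<le> q ^ (s - 2)"
    proof (rule q_polynomial_degree_reduce)
      show "q_polynomial q ?Q" using q_gt_1 q_polynomial_V_root
        by (intro q_polynomial_diff q_polynomial_map_poly q_polynomial_monom) auto
      show "degree ?Q \<le> q ^ Suc (s - 2)" unfolding s_eq
        using map_poly_degree_leq[of \<sigma> V_root] deg_V
        by (intro degree_diff_le degree_monom_le) simp
      show "coeff ?Q (q ^ Suc (s - 2)) = 0" unfolding s_eq by (simp add: v_def)
    qed
    moreover have "x ^ (N + 1) \<notin> V" using power_memD[of x "N + 1"] V(2) by auto
    ultimately have "C.K.hev (x ^ (N + 1)) ?Q / (x ^ (N + 1)) ^ (q ^ (s - 2)) \<in> V"
      by (intro C.hev_divide_power_mem[OF V(1)])
    then have "C.K.hev (x ^ (N + 1)) ?Q / x ^ T \<in> V" by (simp only: T_def power_mult)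
    then show ?thesis using 2 add_mem by (simp add: L_def add_divide_distrib)
  qed
  then have L: "- L / x ^ T \<in> V" using uminus_mem by fastforce
  have Lx: "- L / b \<in> max_ideal V" if "x ^ T / b \<in> max_ideal V" for b
  proof -
    have "x ^ T / b * (- L / x ^ T) \<in> max_ideal V" using that L by (rule max_ideal_mult)
    then show ?thesis using x0 by simp
  qed
  have "x ^ T / x ^ (q ^ r + 1) = inverse (x ^ (q ^ r + 1 - T))"
    using T x0 by (simp add: power_diff field_simps)
  also have "\<dots> \<in> max_ideal V" using T by (intro ixm) simp
  finally have zs: "sim (z ^ (q ^ (s - 1))) (x ^ (q ^ r + 1))"
    unfolding z_power using sim_add[of "x ^ (q ^ r + 1)" "- L"] Lx x0 by simp
  then have "sim ((z ^ (q ^ (s - 1))) ^ q) ((x ^ (q ^ r + 1)) ^ q)" by (rule sim_power)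
  moreover have "(q ^ r + 1) * q = q ^ (r + 1) + q" by simp
  ultimately show "sim (z ^ (q ^ s)) (x ^ (q ^ (r + 1) + q))"
    by (simp only: power_mult[symmetric] mult.commute[of _ q] qs2)
  have z0: "z \<noteq> 0"
  proof
    assume "z = 0"
    then have "z ^ (q ^ (s - 1)) = 0" using q0 by (simp add: power_0_left)
    then show False using sim_nonzero(1)[OF zs] by simp
  qed
  \<comment> \<open>After raising to the power q^(s-1), x^(q^r) is compared with x^(q^r+1). This
    margin of one factor x makes x^(q^r-N) z dominate x^T even if T = q^r.\<close>
  have xz: "x ^ N / z \<in> max_ideal V"
  proof (rule max_ideal_powerD)
    have "sim ((x ^ N) ^ (q ^ (s - 1)) * inverse (z ^ (q ^ (s - 1)))) ((x ^ N) ^ (q ^ (s - 1)) * inverse (x ^ (q ^ r + 1)))"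
      using zs x0 by (intro sim_mult sim_inverse sim_refl) auto
    also have xN: "(x ^ N) ^ (q ^ (s - 1)) = x ^ (q ^ r)" by (simp only: N_power flip: power_mult)
    also have "x ^ (q ^ r) * inverse (x ^ (q ^ r + 1)) = inverse x" using x0 by (simp add: field_simps)
    finally have "x ^ (q ^ r) * inverse (z ^ (q ^ (s - 1))) \<in> max_ideal V"
      using sim_max_ideal_iff not_mem_inverse[OF V(2)] by blast
    then show "(x ^ N / z) ^ (q ^ (s - 1)) \<in> max_ideal V"
      by (simp only: power_divide xN) (simp only: divide_inverse)
  qed (use q0 in simp)
  have N_le: "N \<le> q ^ r" using q_N_le q_gt_1 by (metis le_trans mult_le_mono1 nat_mult_1 less_imp_le)
  let ?b = "x ^ (q ^ r - N) * z"
  have "x ^ (q ^ r - N) * x ^ N = x ^ (q ^ r - T) * x ^ T" using N_le T by (simp flip: power_add)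
  then have "x ^ T / ?b = x ^ N / z * inverse (x ^ (q ^ r - T))"
    using x0 z0 by (simp add: field_simps)
  also have "\<dots> \<in> max_ideal V" using xz ix by (rule max_ideal_mult)
  finally have xb: "x ^ T / ?b \<in> max_ideal V" .
  have b: "sim (\<iota> (inverse c) * ?b) ?b" using c_nonzero x0 z0 V(1) by (intro C.sim_iota_mult) auto
  have "sim (x ^ T * inverse (\<iota> (inverse c) * ?b)) (x ^ T * inverse ?b)"
    by (rule sim_mult[OF sim_refl sim_inverse[OF b]]) (use x0 in simp)
  then have "x ^ T / (\<iota> (inverse c) * ?b) \<in> max_ideal V"
    using xb sim_max_ideal_iff unfolding divide_inverse by blast
  then have "sim (\<iota> (inverse c) * ?b + - L) (\<iota> (inverse c) * ?b)"
    using sim_nonzero(1)[OF b] by (intro sim_add Lx)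
  then have "sim (\<iota> (inverse c) * ?b + - L) ?b" using b by (rule sim_trans)
  then have "sim (t ^ q) ?b" unfolding t_power diff_conv_add_uminus .
  then have "sim ((t ^ q) ^ (q ^ (s - 1))) (?b ^ (q ^ (s - 1)))" by (rule sim_power)
  also have "(t ^ q) ^ (q ^ (s - 1)) = t ^ (q ^ s)" using qs2 by (simp only: flip: power_mult)
  also have "?b ^ (q ^ (s - 1)) = x ^ ((q ^ r - N) * q ^ (s - 1)) * z ^ (q ^ (s - 1))"
    by (simp add: power_mult_distrib flip: power_mult)
  finally have "sim (t ^ (q ^ s)) (x ^ ((q ^ r - N) * q ^ (s - 1)) * z ^ (q ^ (s - 1)))" .
  moreover have "sim (x ^ ((q ^ r - N) * q ^ (s - 1)) * z ^ (q ^ (s - 1)))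
      (x ^ ((q ^ r - N) * q ^ (s - 1)) * x ^ (q ^ r + 1))"
    using zs x0 by (intro sim_mult sim_refl) auto
  moreover have "(q ^ r - N) * q ^ (s - 1) + (q ^ r + 1) = q ^ (r + s - 1) + 1"
  proof -
    have "(q ^ r - N) * q ^ (s - 1) = q ^ r * q ^ (s - 1) - q ^ r"
      by (simp only: diff_mult_distrib N_power)
    moreover have "q ^ r \<le> q ^ (r + s - 1)" using q_gt_1 s2 by (intro power_increasing) auto
    moreover have "q ^ r * q ^ (s - 1) = q ^ (r + s - 1)" using s2 by (simp flip: power_add)
    ultimately show ?thesis by simp
  qed
  ultimately show "sim (t ^ (q ^ s)) (x ^ (q ^ (r + s - 1) + 1))"
    by (simp only: power_add[symmetric]) (rule sim_trans)
qed

end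

text \<open>(N+1) degree V_root <= 2 N degree V_root <= 2 q^(r-1) <= q^r.\<close>

lemma (in trace_curve) degree_R_small:
  assumes u: "s + u_of q n r gs < r"
  shows "degree R = q ^ r + 1"
proof -
  have "N * degree V_root \<le> q ^ (r - 1)"
    using u q_gt_1 unfolding degree_V_root by (intro power_increasing) auto
  moreover have "degree V_root \<le> N * degree V_root" using N_gt_1 by simp
  moreover have "(N + 1) * degree V_root = N * degree V_root + degree V_root" by simp
  ultimately have "(N + 1) * degree V_root \<le> 2 * q ^ (r - 1)" by linarith
  also have "\<dots> \<le> q ^ (r - 1) * q" using q_gt_1 by simp
  also have "\<dots> = q ^ r" using u power_minus_mult[of r q] by simp
  finally have le: "(N + 1) * degree V_root \<le> q ^ r" .
  have "degree (map_poly \<sigma> V_root) = degree V_root" by (rule degree_map_poly) auto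
  then have "degree (pcompose (map_poly \<sigma> V_root) (monom 1 (N + 1))) < q ^ r + 1"
    using le by (simp add: degree_pcompose degree_monom_eq mult.commute del: power_Suc)
  then show ?thesis
    unfolding R_def diff_conv_add_uminus by (subst degree_add_eq_left) (simp_all add: degree_monom_eq)
qed

text \<open>The gcds d_1, ..., d_4 are q^s, q^(s-1), q and 1.\<close>

lemma telescopic_sequence_four_generators:
  assumes q: "q > 1" and s: "2 \<le> s" "s \<le> r"
  shows "telescopic_sequence [q ^ s, q ^ r + q ^ (s - 1), q ^ (r + 1) + q, q ^ (r + s - 1) + 1]"
proof -
  obtain i where i: "s = i + 2" using s(1) by (metis add.commute le_Suc_ex)
  obtain l where l: "r = i + 2 + l" using s(2) i by (metis le_Suc_ex)
  define Q where "Q = q ^ i"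
  define P where "P = q ^ l"
  have pos: "Q > 0" "P > 0" "q > 0" using q by (auto simp: Q_def P_def)
  have a1: "q ^ s = q * q * Q" by (simp add: i Q_def)
  have a2: "q ^ r + q ^ (s - 1) = q * Q * (q * P + 1)"
    by (simp add: l i Q_def P_def power_add algebra_simps)
  have a3: "q ^ (r + 1) + q = q * (q * q * Q * P + 1)"
    by (simp add: l Q_def P_def power_add algebra_simps)
  have a4: "q ^ (r + s - 1) + 1 = q * q * q * Q * Q * P + 1"
    by (simp add: l i Q_def P_def power_add algebra_simps)
  have d2: "gcd (q * q * Q) (q * Q * (q * P + 1)) = q * Q"
  proof -
    have "gcd (q * q * Q) (q * Q * (q * P + 1)) = gcd (q * Q * q) (q * Q * (q * P + 1))"
      by (simp add: mult_ac)
    also have "\<dots> = q * Q * gcd q (q * P + 1)" by (simp only: gcd_mult_distrib_nat)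
    also have "gcd q (q * P + 1) = 1" by (metis coprime_iff_gcd_eq_1 coprime_add_one_right coprime_mult_left_iff)
    finally show ?thesis by simp
  qed
  have d3: "gcd (q * Q) (q * (q * q * Q * P + 1)) = q"
  proof -
    have "gcd (q * Q) (q * (q * q * Q * P + 1)) = q * gcd Q (q * q * Q * P + 1)"
      by (simp only: gcd_mult_distrib_nat)
    also have "gcd Q (q * q * Q * P + 1) = 1"
      by (metis coprime_iff_gcd_eq_1 coprime_add_one_right coprime_mult_left_iff)
    finally show ?thesis by simp
  qed
  have d4: "gcd q (q * q * q * Q * Q * P + 1) = 1"
    by (metis coprime_iff_gcd_eq_1 coprime_add_one_right coprime_mult_left_iff)
  have S1: "m \<in> semigroup_gen {Suc 0}" for m
    using semigroup_gen_mult[of "Suc 0" "{Suc 0}" m] by simp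
  \<comment> \<open>Here and in \<open>S3\<close> the new quotient a_i/d_i equals the last generator
    of S_(i-1) plus a multiple of its first generator.\<close>
  have S2: "q * q * Q * P + 1 \<in> semigroup_gen {q, q * P + 1}"
  proof -
    have "P * (q * Q - 1) * q + 1 * (q * P + 1) \<in> semigroup_gen {q, q * P + 1}"
      by (intro semigroup_gen_add semigroup_gen_mult) auto
    moreover have "q * P \<le> q * q * Q * P" using pos by simp
    then have "P * (q * Q - 1) * q + 1 * (q * P + 1) = q * q * Q * P + 1"
      by (simp add: algebra_simps diff_mult_distrib diff_mult_distrib2)
    ultimately show ?thesis by simp
  qed
  have S3: "q * q * q * Q * Q * P + 1 \<in> semigroup_gen {q * Q, Q * (q * P + 1), q * q * Q * P + 1}"
  proof -
    have "q * P * (q * Q - 1) * (q * Q) + 1 * (q * q * Q * P + 1)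
        \<in> semigroup_gen {q * Q, Q * (q * P + 1), q * q * Q * P + 1}"
      by (intro semigroup_gen_add semigroup_gen_mult) auto
    moreover have "q * q * Q * P \<le> q * q * q * Q * Q * P" using pos by simp
    then have "q * P * (q * Q - 1) * (q * Q) + 1 * (q * q * Q * P + 1) = q * q * q * Q * Q * P + 1"
      by (simp add: algebra_simps diff_mult_distrib diff_mult_distrib2)
    ultimately show ?thesis by simp
  qed
  define b1 b2 b3 b4 where b: "b1 = q * q * Q" "b2 = q * Q * (q * P + 1)"
    "b3 = q * (q * q * Q * P + 1)" "b4 = q * q * q * Q * Q * P + 1"
  have G: "gcd b1 b2 = q * Q" "gcd b1 (gcd b2 b3) = q" "gcd b1 (gcd b2 (gcd b3 b4)) = 1"
    unfolding b using d2 d3 d4 by (simp_all flip: gcd.assoc)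
  have D: "b1 div b1 = Suc 0" "b1 div (q * Q) = q" "b2 div (q * Q) = q * P + 1" "b1 div q = q * Q"
    "b2 div q = Q * (q * P + 1)" "b3 div q = q * q * Q * P + 1" "b1 > 0" "b2 > 0" "b3 > 0" "b4 > 0"
    using pos by (simp_all add: b mult.assoc)
  have 2: "b2 div (q * Q) \<in> semigroup_gen {b1 div b1}" using S1 D by simp
  have 3: "b3 div q \<in> semigroup_gen {b1 div (q * Q), b2 div (q * Q)}" using S2 D by simp
  have 4: "b4 \<in> semigroup_gen {b1 div q, b2 div q, b3 div q}" unfolding D b(4) by (rule S3)
  have "telescopic_sequence [b1, b2, b3, b4]"
    unfolding telescopic_sequence_def Let_def
  proof (intro conjI ballI)
    fix i assume "i \<in> {2..length [b1, b2, b3, b4]}"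
    then consider "i = 2" | "i = 3" | "i = 4" by fastforce
    then show "[b1, b2, b3, b4] ! (i - 1) div Gcd (set (take i [b1, b2, b3, b4]))
      \<in> semigroup_gen ((\<lambda>a. a div Gcd (set (take (i - 1) [b1, b2, b3, b4]))) ` set (take (i - 1) [b1, b2, b3, b4]))"
    proof cases
      case 1 then show ?thesis using 2 by (simp add: G)
    next
      case 2 then show ?thesis using 3 by (simp add: G)
    next
      case 3 then show ?thesis using 4 by (simp add: G[unfolded One_nat_def])
    qed
  qed (use G(3) D(7-10) in auto)
  then show ?thesis unfolding a1 a2 a3 a4 b .
qed

section \<open>The basis of monomials in \<open>w\<close>, \<open>z\<close> and
  \<open>t\<close>\<close>

context telescopic_curve
begin

abbreviation M :: nat where "M \<equiv> q ^ (s - 2)"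

text \<open>Mixed-radix notation with radices q, M, q, whose product is q^s. The weights 1, q, qM
  are the degrees of \<open>w\<close>, \<open>z\<close>, \<open>t\<close> as polynomials in
  \<open>w\<close>.\<close>

definition comp :: "nat \<Rightarrow> nat \<Rightarrow> nat \<Rightarrow> nat" where "comp i j l = i + q * (j + M * l)"

abbreviation d0 :: "nat \<Rightarrow> nat" where "d0 j \<equiv> j mod q"
abbreviation d1 :: "nat \<Rightarrow> nat" where "d1 j \<equiv> j div q mod M"
abbreviation d2 :: "nat \<Rightarrow> nat" where "d2 j \<equiv> j div q div M"

lemma e_eq: "q ^ s = q * (M * q)" "q ^ (s - 1) = q * M"
proof -
  obtain i where "s = i + 2" using s2 by (metis add.commute le_Suc_ex)
  then show "q ^ s = q * (M * q)" "q ^ (s - 1) = q * M" by simp_all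
qed

lemma comp_digits: "comp (d0 j) (d1 j) (d2 j) = j"
  by (simp add: comp_def)

lemma digits_less:
  assumes "j < q ^ s"
  shows "d0 j < q" "d1 j < M" "d2 j < q"
proof -
  show "d0 j < q" "d1 j < M" using q_gt_1 by simp_all
  show "d2 j < q" using assms q_gt_1 unfolding e_eq
    by (simp add: less_mult_imp_div_less mult.commute div_less_iff_less_mult)
qed

lemma digits_comp:
  assumes "i < q" "j < M" "l < q"
  shows "d0 (comp i j l) = i" "d1 (comp i j l) = j" "d2 (comp i j l) = l" "comp i j l < q ^ s"
proof -
  show 1: "d0 (comp i j l) = i" using assms by (simp add: comp_def)
  have 2: "comp i j l div q = j + M * l" using assms by (simp add: comp_def)
  show "d1 (comp i j l) = j" "d2 (comp i j l) = l" unfolding 2 using assms by simp_all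
  have "j + M * l + 1 \<le> M * (l + 1)" using assms by (simp add: algebra_simps)
  also have "\<dots> \<le> M * q" using assms by (intro mult_le_mono2) simp
  finally have "q * (j + M * l + 1) \<le> q * (M * q)" by (rule mult_le_mono2)
  then show "comp i j l < q ^ s" using assms by (simp add: comp_def e_eq algebra_simps)
qed

definition \<mu> :: "nat \<Rightarrow> nat" where
  "\<mu> j = d0 j * (q ^ r + q ^ (s - 1)) + d1 j * (q ^ (r + 1) + q) + d2 j * (q ^ (r + s - 1) + 1)"

definition B :: "nat \<Rightarrow> 'b" where
  "B j = w ^ d0 j * z ^ d1 j * t ^ d2 j"

text \<open>Modulo q^s the orders of \<open>w\<close>, \<open>z\<close>, \<open>t\<close> are
  q^(s-1) = qM, q and 1: the digit weights in reversed order. So \<open>\<mu>\<close> reverses the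
  digits of j, which makes the residues distinct.\<close>

lemma \<mu>_mod:
  assumes "j < q ^ s"
  shows "\<mu> j mod q ^ s = comp (d2 j) (d1 j) (d0 j)"
proof -
  obtain l where l: "q ^ r = q ^ s * l" using s_le_r le_imp_power_dvd[of s r q] by blast
  have "q ^ (r + s - 1) = q ^ r * q ^ (s - 1)" using s2 by (simp flip: power_add)
  then have "\<mu> j = comp (d2 j) (d1 j) (d0 j) + q ^ s * (d0 j * l + d1 j * l * q + d2 j * l * q ^ (s - 1))"
    unfolding \<mu>_def comp_def using l e_eq(2) by (simp add: algebra_simps)
  then show ?thesis using digits_comp(4)[of "d2 j" "d1 j" "d0 j"] digits_less[OF assms] by simp
qed

text \<open>Since s >= 2 gives qM > 1, the correction c' x^\<alpha> w in \<open>t\<close> does not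
  disturb the leading term w^(qM). The degrees of \<open>w\<close>, \<open>z\<close>,
  \<open>t\<close> are therefore the digit weights, and digits d0, d1, d2 give degree j.\<close>

lemma monic_basis: "\<exists>P. lead_coeff P = 1 \<and> degree P = j \<and> C.Kx.hev w P = B j"
proof -
  define Z :: "'a poly poly" where "Z = monom 1 q + [:monom c (N + 1):]"
  define T :: "'a poly poly" where "T = Z ^ M + monom (monom c' \<alpha>) 1"
  have Z: "degree Z = q" "lead_coeff Z = 1"
  proof -
    show 1: "degree Z = q" unfolding Z_def using q_gt_1
      by (subst degree_add_eq_left) (simp_all add: degree_monom_eq)
    show "lead_coeff Z = 1" unfolding 1 using q_gt_1 by (simp add: Z_def coeff_pCons split: nat.splits)
  qed
  then have Z0: "Z \<noteq> 0" by auto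
  have ZM: "degree (Z ^ M) = q * M" "lead_coeff (Z ^ M) = 1"
    using Z(1) Z0 by (simp add: degree_power_eq, unfold lead_coeff_power Z(2), simp)
  have "1 < q * M" using one_less_power[OF q_gt_1, of "s - 1"] s2 e_eq(2) by simp
  then have lt: "degree (monom (monom c' \<alpha>) 1) < degree (Z ^ M)"
    using degree_monom_le[of "monom c' \<alpha>" 1] ZM by simp
  have T: "degree T = q * M" "lead_coeff T = 1"
  proof -
    show "degree T = q * M" unfolding T_def using lt ZM by (simp add: degree_add_eq_left)
    show "lead_coeff T = 1"
      unfolding T_def add.commute[of "Z ^ M"] using lead_coeff_add_le[OF lt] ZM(2) by argo
  qed
  then have T0: "T \<noteq> 0" by auto
  let ?P = "monom 1 (d0 j) * Z ^ d1 j * T ^ d2 j"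
  have "lead_coeff ?P = 1"
    unfolding lead_coeff_mult lead_coeff_power Z(2) T(2) by (simp add: degree_monom_eq)
  moreover have "degree (monom 1 i * Z ^ j * T ^ l) = comp i j l" for i j l
    using Z0 T0 by (simp add: degree_mult_eq degree_power_eq degree_monom_eq Z T comp_def algebra_simps)
  then have "degree ?P = j" by (simp only: comp_digits)
  moreover have "C.Kx.hev w Z = z" unfolding Z_def z_def
    by (simp add: C.Kx.hev_add C.Kx.hev_monom C.Kx.hom_1 C.K.hev_monom)
  then have "C.Kx.hev w ?P = B j"
    by (simp add: C.Kx.hev_mult C.Kx.hev_power C.Kx.hev_monom C.Kx.hom_1 B_def T_def t_def
        C.Kx.hev_add C.K.hev_monom mult.assoc)
  ultimately show ?thesis by blast
qed

theorem weierstrass_semigroup_four_generators: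
  assumes H: "H = weierstrass_semigroup \<iota> (P_infty \<iota> x y)"
  shows "H = semigroup_gen {q ^ s, q ^ r + q ^ (s - 1), q ^ (r + 1) + q, q ^ (r + s - 1) + 1}"
    (is "_ = semigroup_gen ?S") "telescopic H" "symmetric_semigroup H"
proof -
  define e where "e = q ^ s"
  have q0: "q > 0" "M > 0" using q_gt_1 by simp_all
  have e1: "e > 1" using one_less_power[OF q_gt_1 s] by (simp add: e_def)
  have qs1: "1 < q ^ (s - 1)" using one_less_power[OF q_gt_1, of "s - 1"] s2 by simp
  have comp4: "comp 0 0 1 < q ^ s" "\<mu> (comp 0 0 1) = q ^ (r + s - 1) + 1"
    using digits_comp[of 0 0 1] q_gt_1 by (simp_all add: \<mu>_def)
  interpret I: infinite_basis \<iota> x y "curve_poly q n r gs" p "k * n" "pcompose h f" "q ^ s" B \<mu> "q ^ n + N"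
  proof (rule infinite_basisI[OF monic_basis])
    show "inj_on (\<lambda>j. \<mu> j mod q ^ s) {..<q ^ s}"
    proof (rule inj_onI)
      fix i j assume ij: "i \<in> {..<q ^ s}" "j \<in> {..<q ^ s}" "\<mu> i mod q ^ s = \<mu> j mod q ^ s"
      note lt = digits_less[of i] digits_less[of j]
      have "comp (d2 i) (d1 i) (d0 i) = comp (d2 j) (d1 j) (d0 j)"
        using ij \<mu>_mod[of i] \<mu>_mod[of j] by simp
      then have "d0 i = d0 j" "d1 i = d1 j" "d2 i = d2 j"
        using digits_comp(1-3)[OF lt(3,2,1)] digits_comp(1-3)[OF lt(6,5,4)] ij(1,2) by (metis lessThan_iff)+
      then show "i = j" using comp_digits by metis
    qed
  next
    fix V j assume V: "V \<in> places \<iota>" "x \<notin> V"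
    interpret valuation_ring V using V(1) by (rule C.place_valuation_ring)
    have "sim ((w ^ q ^ s) ^ d0 j * (z ^ q ^ s) ^ d1 j * (t ^ q ^ s) ^ d2 j)
      ((x ^ (q ^ r + q ^ (s - 1))) ^ d0 j * (x ^ (q ^ (r + 1) + q)) ^ d1 j * (x ^ (q ^ (r + s - 1) + 1)) ^ d2 j)"
      using asymptotics[OF V] by (intro sim_mult sim_power)
    also have "(w ^ q ^ s) ^ d0 j * (z ^ q ^ s) ^ d1 j * (t ^ q ^ s) ^ d2 j = B j ^ q ^ s"
    proof -
      have "(a ^ i) ^ l = (a ^ l) ^ i" for a :: 'b and i l by (simp add: mult.commute flip: power_mult)
      then show ?thesis unfolding B_def power_mult_distrib by metis
    qed
    also have "(x ^ (q ^ r + q ^ (s - 1))) ^ d0 j * (x ^ (q ^ (r + 1) + q)) ^ d1 j * (x ^ (q ^ (r + s - 1) + 1)) ^ d2 j = x ^ \<mu> j"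
      unfolding power_mult[symmetric] power_add[symmetric] \<mu>_def by (simp only: mult.commute)
    finally show "sim (B j ^ q ^ s) (x ^ \<mu> j)" .
  next
    have "q ^ s dvd q ^ (r + s - 1)" using s2 s_le_r by (intro le_imp_power_dvd) simp
    then have "coprime (q ^ (r + s - 1) + 1) (q ^ s)"
      by (rule coprime_divisors[OF dvd_refl _ coprime_add_one_left])
    then show "\<exists>j<q ^ s. coprime (\<mu> j) (q ^ s)" using comp4 by metis
  qed
  have Heq: "H = {i * e + \<mu> j | i j. j < e}" unfolding H e_def by (rule I.weierstrass_semigroup_eq)
  show gen: "H = semigroup_gen ?S"
  proof
    have "i * e + \<mu> j \<in> semigroup_gen ?S" for i j
      unfolding \<mu>_def e_def by (intro semigroup_gen_add semigroup_gen_mult insertI1 insertI2)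
    then show "H \<subseteq> semigroup_gen ?S" unfolding Heq by blast
    have mem: "i * e + \<mu> j \<in> H" if "j < e" for i j unfolding Heq using that by blast
    have "\<mu> 0 = 0" by (simp add: \<mu>_def)
    then have 0: "0 \<in> H" and "e \<in> H" using mem[of 0 0] mem[of 0 1] e1 by simp_all
    then have 1: "q ^ s \<in> H" by (simp add: e_def)
    have "\<mu> 1 = q ^ r + q ^ (s - 1)" using q_gt_1 by (simp add: \<mu>_def)
    then have 2: "q ^ r + q ^ (s - 1) \<in> H" using mem[of 1 0] e1 by simp
    have 4: "q ^ (r + s - 1) + 1 \<in> H" using mem[of "comp 0 0 1" 0] comp4 by (simp add: e_def)
    have 3: "q ^ (r + 1) + q \<in> H"
    \<comment> \<open>For s = 2 one has M = 1, so \<open>z\<close> does not occur in the basis; its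
      order is that of \<open>w\<close> plus a multiple of q^s.\<close>
    proof (cases "s = 2")
      case True
      have "r - 2 + 2 = r" using r_pos by simp
      then have "q ^ r = q ^ (r - 2) * q ^ 2" by (metis power_add)
      then have "q ^ (r - 2) * (q - 1) * e + (q ^ r + q ^ (s - 1)) = q ^ (r + 1) + q"
        using q_gt_1 True by (simp add: e_def diff_mult_distrib2 diff_mult_distrib algebra_simps power2_eq_square)
      then show ?thesis
        using mem[of 1 "q ^ (r - 2) * (q - 1)"] e1 \<open>\<mu> 1 = q ^ r + q ^ (s - 1)\<close> by simp
    next
      case False
      then have "1 < M" using one_less_power[OF q_gt_1, of "s - 2"] s2 by simp
      then show ?thesis using digits_comp[of 0 1 0] mem[of "comp 0 1 0" 0] q_gt_1 by (simp add: \<mu>_def e_def)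
    qed
    show "semigroup_gen ?S \<subseteq> H"
      using 0 1 2 3 4 I.weierstrass_semigroup_add unfolding H by (intro semigroup_gen_subset) auto
  qed
  show "symmetric_semigroup H"
  proof (rule symmetric_semigroupI[OF _ _ _ _ Heq])
    show "inj_on (\<lambda>j. \<mu> j mod e) {..<e}" using I.inj by (simp add: e_def)
    have top: "comp (q - 1) (M - 1) (q - 1) = e - 1"
    proof -
      have "a - 1 + a * (b - 1 + b * (a - 1)) = a * (b * a) - 1" if "a > 0" "b > 0" for a b :: nat
        using that by (cases a; cases b) (simp_all add: algebra_simps)
      then show ?thesis unfolding e_def e_eq comp_def using q0 by blast
    qed
    have \<mu>_comp: "\<mu> (comp i j l) = i * (q ^ r + q ^ (s - 1)) + j * (q ^ (r + 1) + q) + l * (q ^ (r + s - 1) + 1)"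
      if "i < q" "j < M" "l < q" for i j l unfolding \<mu>_def digits_comp(1-3)[OF that] ..
    \<comment> \<open>All digits of e - 1 are maximal, so subtracting j complements each digit
      without borrowing, and \<open>\<mu>\<close> is linear in the digits.\<close>
    show "\<mu> j + \<mu> (e - 1 - j) = \<mu> (e - 1)" if "j < e" for j
    proof -
      have j: "d0 j < q" "d1 j < M" "d2 j < q" using digits_less that by (simp_all add: e_def)
      have "comp (q - 1 - d0 j) (M - 1 - d1 j) (q - 1 - d2 j) + comp (d0 j) (d1 j) (d2 j)
          = comp (q - 1) (M - 1) (q - 1)"
      proof -
        have "comp (i' - i) (j' - j) (l' - l) + comp i j l = comp i' j' l'"
          if "i \<le> i'" "j \<le> j'" "l \<le> l'" for i j l i' j' l'
          using that by (auto simp: comp_def le_iff_add algebra_simps)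
        then show ?thesis using j by (metis Suc_diff_1 less_Suc_eq_le q0)
      qed
      then have dual: "e - 1 - j = comp (q - 1 - d0 j) (M - 1 - d1 j) (q - 1 - d2 j)"
        unfolding comp_digits top by linarith
      have 1: "\<mu> (e - 1 - j) = (q - 1 - d0 j) * (q ^ r + q ^ (s - 1)) + (M - 1 - d1 j) * (q ^ (r + 1) + q)
          + (q - 1 - d2 j) * (q ^ (r + s - 1) + 1)"
        unfolding dual using q0 by (intro \<mu>_comp) auto
      have 2: "\<mu> (e - 1) = (q - 1) * (q ^ r + q ^ (s - 1)) + (M - 1) * (q ^ (r + 1) + q)
          + (q - 1) * (q ^ (r + s - 1) + 1)"
        unfolding top[symmetric] using q0 by (intro \<mu>_comp) auto
      have split: "d * a + (m - d) * a = m * a" if "d \<le> m" for d m a :: nat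
        using that by (simp flip: add_mult_distrib)
      have sum: "(a + b + c) + (a' + b' + c') = A + B + C"
        if "a + a' = A" "b + b' = B" "c + c' = C" for a b c a' b' c' A B C :: nat
        using that by simp
      have "d0 j \<le> q - 1" "d1 j \<le> M - 1" "d2 j \<le> q - 1" using j by linarith+
      then show ?thesis unfolding \<mu>_def[of j] 1 2 by (intro sum split)
    qed
    have "e \<le> q ^ (r + s - 1)" unfolding e_def using q_gt_1 r_pos by (intro power_increasing) auto
    also have "\<dots> \<le> (q - 1) * (q ^ (r + s - 1) + 1)" using q_gt_1 by (cases "q - 1") auto
    also have "\<dots> \<le> \<mu> (comp (q - 1) (M - 1) (q - 1))"
      using \<mu>_comp[of "q - 1" "M - 1" "q - 1"] q0 by (metis diff_less le_add2 zero_less_one)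
    finally show "e \<le> \<mu> (e - 1)" unfolding top .
  qed (use e1 in simp)
  show "telescopic H"
    unfolding telescopic_def using telescopic_sequence_four_generators[OF q_gt_1 s2 s_le_r] gen by (intro exI conjI) auto
qed

end

theorem theorem3p4:
  fixes p k q n r s :: nat
    and gs g :: "'a::{field,finite} poly"
    and \<iota> :: "'a \<Rightarrow> 'f::field" and x y :: 'f
    and H :: "nat set" and u :: nat
  assumes "prime p" and "k > 0" and "q = p ^ k"
    and "card (UNIV :: 'a set) = q ^ n"
    and "n \<ge> 2"
    and "r \<in> {nat \<lceil>real n / 2\<rceil>..n - 1}"
    and "gcd n r = 1"
    and "0 < s" and "s < n - 1"
    and "q_polynomial q gs" and "lead_coeff gs = 1" and "degree gs = q ^ s"
    and "splits gs"
    and "q_polynomial q g" and "lead_coeff g = 1"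
    and "pcompose gs g = trace_poly q n"
    and "is_function_field (curve_poly q n r gs) \<iota> x y"
    and "H = weierstrass_semigroup \<iota> (P_infty \<iota> x y)"
    and "u = u_of q n r gs"
  shows "(s \<le> 2 * r - n \<longrightarrow> H = semigroup_gen {q ^ s, q ^ r + 1}) \<and>
    (s = 2 * r - n + 1 \<longrightarrow>
       H = (if u = n - r - 1
            then semigroup_gen {q ^ s, q ^ r + q ^ (s - 1), q ^ (r + 1) + q, q ^ (r + s - 1) + 1}
            else semigroup_gen {q ^ s, q ^ r + 1})) \<and>
    (s \<le> 2 * r - n \<or> s = 2 * r - n + 1 \<longrightarrow> telescopic H \<and> symmetric_semigroup H)"
proof -
  have "real n / 2 \<le> real r" using assms(6) by (simp add: nat_le_iff ceiling_le_iff)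
  \<comment> \<open>This makes the truncated difference 2r - n in the statement a true one.\<close>
  then have n_le: "n \<le> 2 * r" by linarith
  have rn: "r < n" using assms(5,6) by auto
  interpret base: linearised_poly p k q n r s gs
    by unfold_locales (use assms rn in auto)
  define h where "h = pcompose g (monom 1 1 - monom 1 q)"
  have "q_polynomial q (monom 1 1 - monom (1 :: 'a) q)"
    using q_polynomial_diff[OF base.q_gt_1 q_polynomial_monom[OF base.q_gt_1, of 1 0]
        q_polynomial_monom[OF base.q_gt_1, of 1 1]] by simp
  then have "q_polynomial q h" unfolding h_def by (rule base.q_polynomial_pcompose[OF assms(14)])
  moreover have "pcompose gs h = monom 1 1 - monom 1 (q ^ n)"
    unfolding h_def pcompose_assoc assms(16)
    by (rule telescoping_pcompose_trace_poly[OF assms(1) base.char_a assms(3)])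
  ultimately interpret pair: linearised_pair p k q n r s gs h by unfold_locales
  have u_le: "u \<le> n - r - 1" using pair.u_of_le assms(19) by simp
  consider "s \<le> 2 * r - n \<or> s = 2 * r - n + 1 \<and> u \<noteq> n - r - 1" | "s = 2 * r - n + 1" "u = n - r - 1"
    | "\<not> (s \<le> 2 * r - n \<or> s = 2 * r - n + 1)" by blast
  then show ?thesis
  proof cases
    case 1
    \<comment> \<open>Either s <= 2r - n and u <= n - r - 1, or s is larger by one and u smaller by
      at least one; both give s + u <= r - 1.\<close>
    then have "s \<le> r" "s + u < r" using u_le n_le rn assms(8) by auto
    interpret trace_curve p k q n r s gs h \<iota> x y
      by unfold_locales (use assms(17) \<open>s \<le> r\<close> in auto)
    have "degree R = q ^ r + 1" using \<open>s + u < r\<close> assms(19) by (intro degree_R_small) simp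
    from weierstrass_semigroup_two_generators[OF this assms(18)] 1 show ?thesis by auto
  next
    case 2
    \<comment> \<open>With n = 2r the value s = 2r - n + 1 would be 1, but
      \<open>telescopic_curve\<close> requires s >= 2. Coprimality would force r = 1 and n = 2,
      leaving no s with 0 < s < n - 1.\<close>
    have "n \<noteq> 2 * r"
    proof
      assume "n = 2 * r"
      then have "r = 1" using assms(7) by simp
      then show False using \<open>n = 2 * r\<close> assms(8,9) by simp
    qed
    then have sr: "s \<le> r" "s \<ge> 2" "n - r = r - s + 1" using 2 n_le rn by auto
    interpret trace_curve p k q n r s gs h \<iota> x y
      by unfold_locales (use assms(17) sr in auto)
    have "s + u = n - r + (s - 1)" using 2 sr rn by simp
    then have "q ^ (n - r) * degree pair.V_root = q ^ (n - r) * q ^ (s - 1)"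
      using pair.degree_V_root assms(19) by (simp add: power_add)
    then have "degree pair.V_root = q ^ (s - 1)" using base.q_gt_1 by simp
    then interpret telescopic_curve p k q n r s gs h \<iota> x y
      by unfold_locales (use sr in auto)
    from weierstrass_semigroup_four_generators[OF assms(18)] 2 show ?thesis by auto
  next
    case 3
    then show ?thesis by blast
  qed
qed

end
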